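(* Let $r\ge 1$ be an integer and let $G$ be a graph with $n$ vertices and at most $r$ cycles. (I) If $n\ge 3r-1$, then $$m(G)\le g(n,r),$$ with equality if and only if $G\cong G(n,r)$. (II) If $n\ge 3r$ and $G$ is connected, then $$m(G)\le c(n,r),$$ with equality if and only if $G\cong C(n,r)$ or one of the following exceptional cases holds: - $(n,r)=(4,1)$ and $G\cong P_4$; - $(n,r)=(5,1)$ and $G\cong C_5$; - $(n,r)=(7,2)$ and $G\cong C(7,1)$ or $G\cong E$.
   Context: All graphs are finite and simple. For a graph $G=(V,E)$, a set $I\subseteq V$ is independent if no edge of $G$ joins two vertices of $I$; it is maximal if it is not properly contained in another independent set. $m(G)$ denotes the number of maximal independent sets of $G$. The number of cycles of a graph is the number of its subgraphs that are cycles. $K_m$, $P_m$, $C_m$ denote the complete graph, path and cycle on $m$ vertices. $G\uplus H$ denotes the disjoint union of graphs, and $tG$ the disjoint union of $t\ge 0$ copies of $G$. For positive integers $n,r$ with $n\ge 3r-1$ define $$G(n,r)=\begin{cases} rK_3\uplus\frac{n-3r}{2}K_2 & \text{if } n\equiv r \pmod 2,\\ (r-1)K_3\uplus\frac{n-3r+3}{2}K_2 & \text{if } n\not\equiv r\pmod 2,\end{cases}$$ and $$g(n,r)=m(G(n,r))=\begin{cases} 3^r\cdot 2^{\frac{n-3r}{2}} & \text{if } n\equiv r\pmod 2,\\ 3^{r-1}\cdot 2^{\frac{n-3r+3}{2}} & \text{if } n\not\equiv r\pmod 2.\end{cases}$$ If $G$ is a graph all of whose components are complete and $K_m$ is a complete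 graph disjoint from $G$, then $K_m * G$ denotes the graph obtained from $K_m\uplus G$ by picking a vertex $v_0$ of $K_m$ and connecting it by an edge to a single vertex in each component of $G$ (well defined up to isomorphism). For positive integers $n,r$ with $n\ge 3r$ define $$C(n,r)=\begin{cases} K_3 * \left((r-1)K_3\uplus\frac{n-3r}{2}K_2\right) & \text{if } n\equiv r\pmod 2,\\ K_1 * \left(rK_3\uplus\frac{n-3r-1}{2}K_2\right) & \text{if } n\not\equiv r\pmod 2,\end{cases}$$ and $$c(n,r)=m(C(n,r))=\begin{cases} 3^{r-1}\cdot 2^{\frac{n-3r+2}{2}}+2^{r-1} & \text{if } n\equiv r\pmod 2,\\ 3^r\cdot 2^{\frac{n-3r-1}{2}} & \text{if } n\not\equiv r\pmod 2.\end{cases}$$ In particular $C(7,1)=K_3*(2K_2)$. $E$ is the graph on $7$ vertices $c,a_1,a_2,b_1,b_2,p,q$ with edges $ca_1,\,ca_2,\,a_1a_2,\,cb_1,\,cb_2,\,b_1b_2,\,cp,\,pq$ (two triangles sharing the vertex $c$, together with a path of length $2$ attached at $c$). *)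

theory Defs
  imports Main
begin

record 'a sgraph =
  verts :: "'a set"
  edges :: "'a set set"

definition finite_simple_graph :: "'a sgraph \<Rightarrow> bool" where
  "finite_simple_graph G \<longleftrightarrow>
     finite (verts G) \<and> edges G \<subseteq> {e. e \<subseteq> verts G \<and> card e = 2}"

definition graph_iso :: "'a sgraph \<Rightarrow> 'b sgraph \<Rightarrow> bool" (infix "\<cong>\<^sub>G" 50) where
  "G \<cong>\<^sub>G H \<longleftrightarrow>
     (\<exists>f. bij_betw f (verts G) (verts H) \<and>
        (\<forall>u\<in>verts G. \<forall>v\<in>verts G. {u, v} \<in> edges G \<longleftrightarrow> {f u, f v} \<in> edges H))"

definition subgraph :: "'a sgraph \<Rightarrow> 'a sgraph \<Rightarrow> bool" where
  "subgraph H G \<longleftrightarrow>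
     finite_simple_graph H \<and> verts H \<subseteq> verts G \<and> edges H \<subseteq> edges G"

definition adj_rel :: "'a sgraph \<Rightarrow> ('a \<times> 'a) set" where
  "adj_rel G = {(u, v). u \<in> verts G \<and> v \<in> verts G \<and> {u, v} \<in> edges G}"

definition connected_graph :: "'a sgraph \<Rightarrow> bool" where
  "connected_graph G \<longleftrightarrow>
     verts G \<noteq> {} \<and> (\<forall>u\<in>verts G. \<forall>v\<in>verts G. (u, v) \<in> (adj_rel G)\<^sup>*)"

definition components :: "'a sgraph \<Rightarrow> 'a set set" where
  "components G = {{v \<in> verts G. (u, v) \<in> (adj_rel G)\<^sup>*} |u. u \<in> verts G}"


definition independent_set :: "'a sgraph \<Rightarrow> 'a set \<Rightarrow> bool" where
  "independent_set G I \<longleftrightarrow>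
     I \<subseteq> verts G \<and> (\<forall>u\<in>I. \<forall>v\<in>I. {u, v} \<notin> edges G)"

definition maximal_independent_set :: "'a sgraph \<Rightarrow> 'a set \<Rightarrow> bool" where
  "maximal_independent_set G I \<longleftrightarrow>
     independent_set G I \<and> (\<forall>J. independent_set G J \<longrightarrow> \<not> I \<subset> J)"

definition num_mis :: "'a sgraph \<Rightarrow> nat" where
  "num_mis G = card {I. maximal_independent_set G I}"


definition complete_graph :: "nat \<Rightarrow> nat sgraph" where
  "complete_graph m =
     \<lparr>verts = {..<m}, edges = {{i, j} |i j. i < m \<and> j < m \<and> i \<noteq> j}\<rparr>"

definition path_graph :: "nat \<Rightarrow> nat sgraph" where
  "path_graph m = \<lparr>verts = {..<m}, edges = {{i, i + 1} |i. i + 1 < m}\<rparr>"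

(* a simple graph, and used, only for m \<ge> 3 *)
definition cycle_graph :: "nat \<Rightarrow> nat sgraph" where
  "cycle_graph m = \<lparr>verts = {..<m}, edges = {{i, (i + 1) mod m} |i. i < m}\<rparr>"

definition num_cycles :: "'a sgraph \<Rightarrow> nat" where
  "num_cycles G = card {H. subgraph H G \<and> (\<exists>k\<ge>3. H \<cong>\<^sub>G cycle_graph k)}"

definition disjoint_union :: "'a sgraph \<Rightarrow> 'b sgraph \<Rightarrow> ('a + 'b) sgraph" (infixr "\<uplus>\<^sub>G" 65) where
  "G \<uplus>\<^sub>G H =
     \<lparr>verts = Inl ` verts G \<union> Inr ` verts H,
      edges = (\<lambda>e. Inl ` e) ` edges G \<union> (\<lambda>e. Inr ` e) ` edges H\<rparr>"

definition copies :: "nat \<Rightarrow> 'a sgraph \<Rightarrow> (nat \<times> 'a) sgraph" where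
  "copies t G =
     \<lparr>verts = {..<t} \<times> verts G,
      edges = {Pair i ` e |i e. i < t \<and> e \<in> edges G}\<rparr>"

(* K_m * G, for m \<ge> 1 and all components of G complete: the vertex picked in K_m is 0,
   the one picked in each component of G is given by SOME. *)
definition star_join :: "nat \<Rightarrow> 'a sgraph \<Rightarrow> (nat + 'a) sgraph" where
  "star_join m G =
     \<lparr>verts = verts (complete_graph m \<uplus>\<^sub>G G),
      edges = edges (complete_graph m \<uplus>\<^sub>G G)
                \<union> {{Inl 0, Inr (SOME v. v \<in> W)} |W. W \<in> components G}\<rparr>"


(* In G_graph and g_bound the intended range is n \<ge> 3r - 1; the summand 3 comes first because
   n - 3r would be truncated at n = 3r - 1. In C_graph and c_bound it is n \<ge> 3r. Always r \<ge> 1. *)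

definition G_graph :: "nat \<Rightarrow> nat \<Rightarrow> (nat \<times> nat + nat \<times> nat) sgraph" where
  "G_graph n r =
     (if n mod 2 = r mod 2
      then copies r (complete_graph 3) \<uplus>\<^sub>G copies ((n - 3 * r) div 2) (complete_graph 2)
      else copies (r - 1) (complete_graph 3) \<uplus>\<^sub>G copies ((n + 3 - 3 * r) div 2) (complete_graph 2))"

definition g_bound :: "nat \<Rightarrow> nat \<Rightarrow> nat" where
  "g_bound n r =
     (if n mod 2 = r mod 2
      then 3 ^ r * 2 ^ ((n - 3 * r) div 2)
      else 3 ^ (r - 1) * 2 ^ ((n + 3 - 3 * r) div 2))"

definition C_graph :: "nat \<Rightarrow> nat \<Rightarrow> (nat + (nat \<times> nat + nat \<times> nat)) sgraph" where
  "C_graph n r =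
     (if n mod 2 = r mod 2
      then star_join 3 (copies (r - 1) (complete_graph 3)
                          \<uplus>\<^sub>G copies ((n - 3 * r) div 2) (complete_graph 2))
      else star_join 1 (copies r (complete_graph 3)
                          \<uplus>\<^sub>G copies ((n - 3 * r - 1) div 2) (complete_graph 2)))"

definition c_bound :: "nat \<Rightarrow> nat \<Rightarrow> nat" where
  "c_bound n r =
     (if n mod 2 = r mod 2
      then 3 ^ (r - 1) * 2 ^ ((n + 2 - 3 * r) div 2) + 2 ^ (r - 1)
      else 3 ^ r * 2 ^ ((n - 3 * r - 1) div 2))"

datatype E_vertex = v_c | v_a1 | v_a2 | v_b1 | v_b2 | v_p | v_q

definition E_graph :: "E_vertex sgraph" where
  "E_graph =
     \<lparr>verts = UNIV,
      edges = {{v_c, v_a1}, {v_c, v_a2}, {v_a1, v_a2},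
               {v_c, v_b1}, {v_c, v_b2}, {v_b1, v_b2},
               {v_c, v_p}, {v_p, v_q}}\<rparr>"

end

theory Submission
  imports Defs Complex_Main
begin

text \<open>
  Give a graph with \<open>n\<close> vertices and \<open>r\<close> cycles the weight \<open>2^(n/2) (9/8)^(r/2)\<close>. It is multiplicative
  under disjoint unions and equals \<open>m(G)\<close> for \<open>K_2\<close> and \<open>K_3\<close>. Among connected graphs only these two
  attain their weight: \<open>m(G)\<close> of every other one is smaller by at least the factor \<open>8/9\<close>, as if two cycles
  were wasted. If \<open>n\<close> and \<open>r\<close> have different parity, then a disjoint union of copies of \<open>K_2\<close> and \<open>K_3\<close>
  has to waste one cycle, which is still better; this gives part (I).

  For part (II), choose a cut vertex \<open>x\<close> such that some component \<open>H\<close> of \<open>G - x\<close> is as large as possible.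
  Then no vertex in the other components is a cut vertex of \<open>G\<close>. A vertex of degree \<open>d \<ge> 3\<close> that is not a
  cut vertex lies on at least \<open>d choose 2\<close> cycles, too many for an extremal graph, so each of the other
  components is a single leaf or closes up to a cycle through \<open>x\<close>. Branching on the vertices of
  these pieces reduces the count to \<open>H\<close> and \<open>H - N(x)\<close>; the second graph falls short of its weight unless it is
  a disjoint union of copies of \<open>K_2\<close> and \<open>K_3\<close>. In the remaining case deleting a single vertex of \<open>G\<close> leaves
  only copies of \<open>K_2\<close> and \<open>K_3\<close>, and \<open>m(G)\<close> can be computed exactly.
\<close>

section \<open>Maximal independent sets of induced subgraphs\<close>

text \<open>Cycles enter only through lower bounds on their number: disjoint vertex sets contribute
  separately, and a vertex lies on a cycle of its own for each pair of its neighbours in one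
  connected piece of the rest. The cycles of the extremal graphs are never counted. The obstacle in
  part (II) is that after branching at \<open>x\<close> only \<open>H\<close> is known to be
  connected, while \<open>H - N(x)\<close> can be arbitrary and has to be measured by its weight.
  The slack comes from the factor 8/9, and where this factor is missing the graph turns out to be a
  union of cliques plus one vertex. Moreover \<open>H\<close> may have fewer than
  \<open>3 * r\<close> vertices, so the target must be extended to that range by a bound that the
  recursion reproduces. Reals are used because the weight of a pair of the wrong parity is
  irrational. A few tight cases are settled by parity, and one by integrality.\<close>

text \<open>Induced subgraphs of a fixed graph are represented by their vertex sets \<open>S\<close>, with \<open>E\<close> the adjacency
  relation of the whole graph.\<close>

definition mis :: "('a \<Rightarrow> 'a \<Rightarrow> bool) \<Rightarrow> 'a set \<Rightarrow> 'a set set" where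
  "mis E S = {I. I \<subseteq> S \<and> (\<forall>u\<in>I. \<forall>v\<in>I. \<not> E u v) \<and> (\<forall>v\<in>S - I. \<exists>u\<in>I. E v u)}"

definition nbhd :: "('a \<Rightarrow> 'a \<Rightarrow> bool) \<Rightarrow> 'a set \<Rightarrow> 'a \<Rightarrow> 'a set" where
  "nbhd E S v = {u \<in> S. E v u}"

text \<open>Formulated by cuts, so that the empty set counts as connected. The piece
  \<open>H\<close> in \<open>pendants\<close> may therefore be empty.\<close>

definition conn :: "('a \<Rightarrow> 'a \<Rightarrow> bool) \<Rightarrow> 'a set \<Rightarrow> bool" where
  "conn E S \<longleftrightarrow> (\<forall>A\<subseteq>S. A \<noteq> {} \<longrightarrow> A \<noteq> S \<longrightarrow> (\<exists>a\<in>A. \<exists>b\<in>S - A. E a b))"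

text \<open>A cycle is recorded by its edge set, so that the rotations and reflections of one vertex
  list count once.\<close>

definition cycs :: "('a \<Rightarrow> 'a \<Rightarrow> bool) \<Rightarrow> 'a set \<Rightarrow> 'a set set set" where
  "cycs E S = {F. \<exists>xs. 3 \<le> length xs \<and> distinct xs \<and> set xs \<subseteq> S \<and>
      (\<forall>i<length xs. E (xs ! i) (xs ! (Suc i mod length xs))) \<and>
      F = {{xs ! i, xs ! (Suc i mod length xs)} |i. i < length xs}}"

abbreviation nmis :: "('a \<Rightarrow> 'a \<Rightarrow> bool) \<Rightarrow> 'a set \<Rightarrow> nat" where
  "nmis E S \<equiv> card (mis E S)"

abbreviation ncyc :: "('a \<Rightarrow> 'a \<Rightarrow> bool) \<Rightarrow> 'a set \<Rightarrow> nat" where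
  "ncyc E S \<equiv> card (cycs E S)"

locale ugraph =
  fixes E :: "'a \<Rightarrow> 'a \<Rightarrow> bool"
  assumes sym: "E u v \<Longrightarrow> E v u" and irr: "\<not> E v v"
begin

lemma finite_mis: "finite S \<Longrightarrow> finite (mis E S)"
  by (rule finite_subset[of _ "Pow S"]) (auto simp: mis_def)

lemma misI:
  assumes "I \<subseteq> S" "\<And>u v. u \<in> I \<Longrightarrow> v \<in> I \<Longrightarrow> \<not> E u v"
    "\<And>v. v \<in> S \<Longrightarrow> v \<notin> I \<Longrightarrow> \<exists>u\<in>I. E v u"
  shows "I \<in> mis E S"
  using assms by (auto simp: mis_def)

lemma mis_sub: "I \<in> mis E S \<Longrightarrow> v \<in> I \<Longrightarrow> v \<in> S"
  and mis_indep: "I \<in> mis E S \<Longrightarrow> u \<in> I \<Longrightarrow> v \<in> I \<Longrightarrow> \<not> E u v"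
  and mis_dom: "I \<in> mis E S \<Longrightarrow> v \<in> S \<Longrightarrow> v \<notin> I \<Longrightarrow> \<exists>u\<in>I. E v u"
  by (auto simp: mis_def)

lemma nbD: "nbhd E S q = X \<Longrightarrow> u \<in> S \<Longrightarrow> E q u \<Longrightarrow> u \<in> X"
  and nbE: "nbhd E S q = X \<Longrightarrow> u \<in> X \<Longrightarrow> u \<in> S \<and> E q u"
  by (auto simp: nbhd_def)

lemma mis_nb: "I \<in> mis E S \<Longrightarrow> v \<in> S \<Longrightarrow> nbhd E S v = X \<Longrightarrow> v \<in> I \<or> (\<exists>u\<in>X. u \<in> I)"
  using mis_dom[of I S v] mis_sub[of I S] nbD[of S v X] by blast

lemma mis_empty [simp]: "mis E {} = {{}}"
  by (auto simp: mis_def)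

lemma mis_extend:
  assumes "finite S" "J \<subseteq> S" "\<forall>u\<in>J. \<forall>v\<in>J. \<not> E u v"
  shows "\<exists>I\<in>mis E S. J \<subseteq> I"
proof -
  let ?P = "\<lambda>I. J \<subseteq> I \<and> I \<subseteq> S \<and> (\<forall>u\<in>I. \<forall>v\<in>I. \<not> E u v)"
  have "finite {I. ?P I}"
    by (rule finite_subset[of _ "Pow S"]) (use assms in auto)
  moreover have "J \<in> {I. ?P I}" using assms by auto
  ultimately obtain I where I: "I \<in> {I. ?P I}" "\<And>K. K \<in> {I. ?P I} \<Longrightarrow> I \<subseteq> K \<Longrightarrow> I = K"
    by (metis (no_types, lifting) finite_has_maximal2)
  have "\<exists>u\<in>I. E v u" if "v \<in> S - I" for v
  proof (rule ccontr)
    assume "\<not> ?thesis"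
    then have "?P (insert v I)" using I(1) that sym irr by blast
    then have "I = insert v I" using I(2)[of "insert v I"] by blast
    then show False using that by blast
  qed
  then have "I \<in> mis E S" using I(1) by (auto simp: mis_def)
  then show ?thesis using I(1) by blast
qed

text \<open>Extend each \<open>J\<close> in \<open>mis E T\<close> to some \<open>f J\<close> in
  \<open>mis E S\<close>. As \<open>J\<close> dominates \<open>T\<close>, the extension adds nothing
  inside \<open>T\<close>, so \<open>J\<close> is recovered as \<open>f J \<inter> T\<close> and
  \<open>f\<close> is injective.\<close>

lemma nmis_mono:
  assumes "finite S" "T \<subseteq> S" shows "nmis E T \<le> nmis E S"
proof -
  define f where "f J = (SOME I. I \<in> mis E S \<and> J \<subseteq> I)" for J
  have f: "f J \<in> mis E S \<and> J \<subseteq> f J" if "J \<in> mis E T" for J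
  proof -
    have "\<exists>I\<in>mis E S. J \<subseteq> I" by (rule mis_extend) (use that assms in \<open>auto simp: mis_def\<close>)
    then show ?thesis unfolding f_def by (metis (mono_tags, lifting) someI)
  qed
  have eq: "f J \<inter> T = J" if "J \<in> mis E T" for J
  proof -
    have "v \<in> J" if vv: "v \<in> f J" "v \<in> T" for v
    proof (rule ccontr)
      assume "v \<notin> J"
      then obtain u where "u \<in> J" "E v u" using mis_dom[OF \<open>J \<in> mis E T\<close> vv(2)] by blast
      then show False using f[OF \<open>J \<in> mis E T\<close>] that mis_indep[of "f J" S] by blast
    qed
    then show ?thesis using f[OF that] that unfolding mis_def by blast
  qed
  have "inj_on f (mis E T)" by (rule inj_onI) (metis eq)
  then show ?thesis using f card_inj_on_le[of f "mis E T" "mis E S"] finite_mis[OF assms(1)] by blast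
qed

text \<open>Only an inequality, since a maximal independent set of \<open>S - {v}\<close> need not
  dominate \<open>v\<close>.\<close>

lemma mis_without:
  assumes "finite S" shows "card {I \<in> mis E S. v \<notin> I} \<le> nmis E (S - {v})"
  by (rule card_mono) (auto simp: mis_def finite_mis assms)

lemma mis_with:
  assumes "v \<in> S" shows "card {I \<in> mis E S. v \<in> I} = nmis E (S - insert v (nbhd E S v))"
proof -
  have "bij_betw (\<lambda>I. I - {v}) {I \<in> mis E S. v \<in> I} (mis E (S - insert v (nbhd E S v)))"
  proof (rule bij_betw_byWitness[where f' = "insert v"])
    show "(\<lambda>I. I - {v}) ` {I \<in> mis E S. v \<in> I} \<subseteq> mis E (S - insert v (nbhd E S v))"
    proof safe
      fix I assume I: "I \<in> mis E S" "v \<in> I"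
      show "I - {v} \<in> mis E (S - insert v (nbhd E S v))"
      proof (rule misI)
        fix w assume w: "w \<in> S - insert v (nbhd E S v)" "w \<notin> I - {v}"
        then obtain u where "u \<in> I" "E w u" using mis_dom[OF I(1), of w] by blast
        moreover have "u \<noteq> v" using w \<open>E w u\<close> sym by (auto simp: nbhd_def)
        ultimately show "\<exists>u\<in>I - {v}. E w u" by blast
      qed (use mis_indep[OF I(1)] mis_sub[OF I(1)] I(2) in \<open>auto simp: nbhd_def\<close>)
    qed
    show "insert v ` mis E (S - insert v (nbhd E S v)) \<subseteq> {I \<in> mis E S. v \<in> I}"
    proof safe
      fix I assume I: "I \<in> mis E (S - insert v (nbhd E S v))"
      have "\<exists>u\<in>insert v I. E w u" if "w \<in> S - insert v I" for w
      proof (cases "E v w")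
        case True then show ?thesis using sym by blast
      next
        case False then show ?thesis using I that unfolding mis_def nbhd_def by blast
      qed
      then show "insert v I \<in> mis E S"
        using I assms sym irr unfolding mis_def nbhd_def by blast
    qed
  qed (auto simp: mis_def)
  then show ?thesis by (rule bij_betw_same_card)
qed

lemma mis_split:
  assumes "finite S"
  shows "nmis E S = card {I \<in> mis E S. P I} + card {I \<in> mis E S. \<not> P I}"
proof -
  have "mis E S = {I \<in> mis E S. P I} \<union> {I \<in> mis E S. \<not> P I}" by blast
  then show ?thesis
    using card_Un_disjoint[of "{I \<in> mis E S. P I}" "{I \<in> mis E S. \<not> P I}"] finite_mis[OF assms]
    by (metis (no_types, lifting) disjoint_iff finite_Un mem_Collect_eq)
qed

section \<open>Branching inequalities and vertex deletions\<close>

lemma nmis_branch: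
  assumes "finite S" "v \<in> S"
  shows "nmis E S \<le> nmis E (S - {v}) + nmis E (S - insert v (nbhd E S v))"
  using mis_split[OF assms(1), of "\<lambda>I. v \<in> I"] mis_with[OF assms(2)] mis_without[OF assms(1), of v] by simp

lemma card_le_sum3:
  assumes "A \<subseteq> B \<union> C \<union> D" "finite B" "finite C" "finite D"
  shows "card A \<le> card B + card C + card D"
proof -
  have "card A \<le> card (B \<union> C \<union> D)" using assms by (intro card_mono) auto
  also have "\<dots> \<le> card B + card C + card D"
    by (meson add_le_mono card_Un_le le_trans order_refl)
  finally show ?thesis .
qed

text \<open>Domination of the leaf \<open>v\<close> puts \<open>v\<close> or \<open>u\<close> into
  every maximal independent set, so both branches lose a whole closed neighbourhood.\<close>

lemma nmis_leaf:
  assumes "finite S" "v \<in> S" "nbhd E S v = {u}"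
  shows "nmis E S \<le> nmis E (S - {v, u}) + nmis E (S - insert u (nbhd E S u))"
proof -
  have u: "u \<in> S" using assms(3) by (auto simp: nbhd_def)
  have "v \<in> I \<or> u \<in> I" if "I \<in> mis E S" for I
    using mis_nb[OF that assms(2,3)] by blast
  then have "mis E S \<subseteq> {I \<in> mis E S. v \<in> I} \<union> {I \<in> mis E S. u \<in> I} \<union> {}" by blast
  then have "nmis E S \<le> card {I \<in> mis E S. v \<in> I} + card {I \<in> mis E S. u \<in> I} + card ({}::'a set set)"
    by (rule card_le_sum3) (auto simp: finite_mis assms)
  then show ?thesis using mis_with[OF assms(2)] mis_with[OF u] assms(3) by simp
qed

lemma nmis_triangle:
  assumes "finite S" "q1 \<in> S" "q2 \<in> S" "nbhd E S q1 = {q2, x}" "nbhd E S q2 = {q1, x}"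
  shows "nmis E S \<le> 2 * nmis E (S - {q1, q2, x}) + nmis E (S - insert x (nbhd E S x))"
proof -
  have x: "x \<in> S" using assms(4) by (auto simp: nbhd_def)
  have "q1 \<in> I \<or> q2 \<in> I \<or> x \<in> I" if "I \<in> mis E S" for I
    using mis_nb[OF that assms(2,4)] by blast
  then have "mis E S \<subseteq> {I \<in> mis E S. q1 \<in> I} \<union> {I \<in> mis E S. q2 \<in> I} \<union> {I \<in> mis E S. x \<in> I}"
    by blast
  then have "nmis E S \<le> card {I \<in> mis E S. q1 \<in> I} + card {I \<in> mis E S. q2 \<in> I} + card {I \<in> mis E S. x \<in> I}"
    by (rule card_le_sum3) (auto simp: finite_mis assms)
  moreover have "insert q1 {q2, x} = {q1, q2, x}" "insert q2 {q1, x} = {q1, q2, x}" by auto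
  ultimately show ?thesis
    using mis_with[OF assms(2)] mis_with[OF assms(3)] mis_with[OF x] assms(4,5) by simp
qed

text \<open>A maximal set avoiding \<open>q2\<close> and \<open>q3\<close> must dominate them by
  \<open>q1\<close> and \<open>q4\<close>. The first two branches delete the closed neighbourhoods
  of \<open>q2\<close> and \<open>q3\<close>, the third those of \<open>q1\<close> and
  \<open>q4\<close>.\<close>

lemma nmis_chain:
  assumes "finite S" "q1 \<in> S" "q2 \<in> S" "q3 \<in> S" "q4 \<in> S"
    and n2: "nbhd E S q2 = {q1, q3}" and n3: "nbhd E S q3 = {q2, q4}" and ne: "\<not> E q1 q4"
    and "q1 \<noteq> q4"
  shows "nmis E S \<le> nmis E (S - {q1, q2, q3}) + nmis E (S - {q2, q3, q4})
           + nmis E (S - insert q1 (insert q4 (nbhd E S q1 \<union> nbhd E S q4)))"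
proof -
  let ?T = "S - insert q1 (insert q4 (nbhd E S q1 \<union> nbhd E S q4))"
  have "mis E S \<subseteq> {I \<in> mis E S. q2 \<in> I} \<union> {I \<in> mis E S. q3 \<in> I} \<union> {I \<in> mis E S. q1 \<in> I \<and> q4 \<in> I}"
  proof
    fix I assume I: "I \<in> mis E S"
    have "q2 \<in> I \<or> q1 \<in> I \<or> q3 \<in> I" "q3 \<in> I \<or> q2 \<in> I \<or> q4 \<in> I"
      using mis_nb[OF I assms(3) n2] mis_nb[OF I assms(4) n3] by blast+
    then show "I \<in> {I \<in> mis E S. q2 \<in> I} \<union> {I \<in> mis E S. q3 \<in> I} \<union> {I \<in> mis E S. q1 \<in> I \<and> q4 \<in> I}"
      using I by blast
  qed
  then have "nmis E S \<le> card {I \<in> mis E S. q2 \<in> I} + card {I \<in> mis E S. q3 \<in> I}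
      + card {I \<in> mis E S. q1 \<in> I \<and> q4 \<in> I}"
    by (rule card_le_sum3) (auto simp: finite_mis assms)
  moreover have "card {I \<in> mis E S. q1 \<in> I \<and> q4 \<in> I} \<le> nmis E ?T"
  proof (rule card_inj_on_le[of "\<lambda>I. I - {q1, q4}"])
    show "inj_on (\<lambda>I. I - {q1, q4}) {I \<in> mis E S. q1 \<in> I \<and> q4 \<in> I}"
      by (rule inj_onI) blast
    show "(\<lambda>I. I - {q1, q4}) ` {I \<in> mis E S. q1 \<in> I \<and> q4 \<in> I} \<subseteq> mis E ?T"
    proof safe
      fix I assume I: "I \<in> mis E S" "q1 \<in> I" "q4 \<in> I"
      have "\<exists>u\<in>I - {q1, q4}. E v u" if "v \<in> ?T - (I - {q1, q4})" for v
      proof -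
        from that I obtain u where u: "u \<in> I" "E v u" unfolding mis_def by blast
        have "u \<noteq> q1" "u \<noteq> q4" using that u sym unfolding nbhd_def by blast+
        then show ?thesis using u by blast
      qed
      then show "I - {q1, q4} \<in> mis E ?T"
        using I unfolding mis_def nbhd_def by blast
    qed
  qed (simp add: finite_mis assms)
  moreover have "insert q2 {q1, q3} = {q1, q2, q3}" "insert q3 {q2, q4} = {q2, q3, q4}" by auto
  ultimately show ?thesis
    using mis_with[OF assms(3)] mis_with[OF assms(4)] n2 n3 by simp
qed

text \<open>When \<open>u\<close> lies in \<open>I\<close>, each neighbour of \<open>u\<close> has a
  second neighbour in \<open>I\<close>, so \<open>I - {u}\<close> stays maximal in
  \<open>S - {u}\<close>. This also makes the deletion injective: if \<open>J\<close> agrees with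
  \<open>I\<close> except at \<open>u\<close>, then \<open>J\<close> contains a neighbour of
  \<open>u\<close>, which would be adjacent to another member of \<open>J\<close>.\<close>

lemma nmis_reduce:
  assumes "finite S" "u \<in> S"
    and dom: "\<And>I w. I \<in> mis E S \<Longrightarrow> u \<in> I \<Longrightarrow> w \<in> nbhd E S u \<Longrightarrow> \<exists>z\<in>I - {u}. E w z"
  shows "nmis E S \<le> nmis E (S - {u})"
proof (rule card_inj_on_le[of "\<lambda>I. I - {u}"])
  have sub: "I - {u} \<in> mis E (S - {u})" if I: "I \<in> mis E S" for I
  proof -
    have "\<exists>z\<in>I - {u}. E v z" if "v \<in> S - {u} - (I - {u})" for v
    proof -
      from that I obtain z where z: "z \<in> I" "E v z" unfolding mis_def by blast
      show ?thesis
      proof (cases "z = u")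
        case True
        then have "v \<in> nbhd E S u" using z that sym unfolding nbhd_def by blast
        then show ?thesis using dom[OF I] z True by blast
      qed (use z in blast)
    qed
    then show ?thesis using I unfolding mis_def by blast
  qed
  then show "(\<lambda>I. I - {u}) ` mis E S \<subseteq> mis E (S - {u})" by blast
  have aux: False if I: "I \<in> mis E S" "J \<in> mis E S" "I - {u} = J - {u}" "u \<in> I" "u \<notin> J" for I J
  proof -
    from I assms(2) obtain w where w: "w \<in> J" "E u w" unfolding mis_def by blast
    then have "w \<in> nbhd E S u" using I unfolding nbhd_def mis_def by blast
    then obtain z where "z \<in> I - {u}" "E w z" using dom[OF I(1,4)] by blast
    then show False using I w unfolding mis_def by blast
  qed
  show "inj_on (\<lambda>I. I - {u}) (mis E S)"
  proof (rule inj_onI)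
    fix I J assume *: "I \<in> mis E S" "J \<in> mis E S" "I - {u} = J - {u}"
    then have "u \<in> I \<longleftrightarrow> u \<in> J" using aux[of I J] aux[of J I] by auto
    then show "I = J" using * by blast
  qed
qed (simp add: finite_mis assms)

text \<open>Whatever excludes \<open>v\<close> also excludes its twin \<open>u\<close>, so a maximal
  set with \<open>u\<close> contains \<open>v\<close>, and \<open>v\<close> dominates all that
  \<open>u\<close> does.\<close>

lemma nmis_twin:
  assumes "finite S" "u \<in> S" "v \<in> S" "u \<noteq> v" "nbhd E S u = nbhd E S v"
  shows "nmis E S \<le> nmis E (S - {u})"
proof (rule nmis_reduce)
  fix I w assume I: "I \<in> mis E S" "u \<in> I" "w \<in> nbhd E S u"
  have "v \<in> I"
  proof (rule ccontr)
    assume "v \<notin> I"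
    then obtain z where z: "z \<in> I" "E v z" using mis_dom[OF I(1) assms(3)] by blast
    then have "z \<in> nbhd E S v" using mis_sub[OF I(1)] by (auto simp: nbhd_def)
    then have "E u z" using assms(5) by (auto simp: nbhd_def)
    then show False using mis_indep[OF I(1,2) z(1)] by blast
  qed
  moreover have "E w v" using I(3) assms(5) sym by (auto simp: nbhd_def)
  ultimately show "\<exists>z\<in>I - {u}. E w z" using assms(4) by blast
qed (use assms in auto)

text \<open>A maximal set containing the leaf \<open>l\<close> avoids \<open>x\<close>, so it meets
  \<open>{q1, q2}\<close>, and that vertex dominates the only neighbour \<open>x\<close> of
  \<open>l\<close>.\<close>

lemma nmis_leaf_triangle:
  assumes "finite S" "l \<in> S" "q1 \<in> S" "q2 \<in> S" "nbhd E S l = {x}"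
    and "nbhd E S q1 = {q2, x}" "nbhd E S q2 = {q1, x}"
  shows "nmis E S \<le> nmis E (S - {l})"
proof (rule nmis_reduce)
  fix I w assume I: "I \<in> mis E S" "l \<in> I" "w \<in> nbhd E S l"
  then have wx: "w = x" using assms by auto
  have "E l x" using assms(5) by (auto simp: nbhd_def)
  then have xI: "x \<notin> I" using mis_indep[OF I(1,2)] by blast
  have "q1 \<noteq> l" "q2 \<noteq> l"
    using assms(5-7) irr unfolding nbhd_def by (metis (lifting) insertCI mem_Collect_eq singletonD)+
  moreover have "q1 \<in> I \<or> q2 \<in> I"
    using mis_nb[OF I(1) assms(3,6)] xI by blast
  moreover have "E x q1" "E x q2" using assms(6,7) sym by (auto simp: nbhd_def)
  ultimately show "\<exists>z\<in>I - {l}. E w z" using wx by blast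
qed (use assms in auto)

section \<open>Products over disjoint unions, and cliques\<close>

lemma nmis_union:
  assumes "finite A" "finite B" "A \<inter> B = {}" "\<And>a b. a \<in> A \<Longrightarrow> b \<in> B \<Longrightarrow> \<not> E a b"
  shows "nmis E (A \<union> B) = nmis E A * nmis E B"
proof -
  have "bij_betw (\<lambda>(I, J). I \<union> J) (mis E A \<times> mis E B) (mis E (A \<union> B))"
  proof (rule bij_betw_byWitness[where f' = "\<lambda>I. (I \<inter> A, I \<inter> B)"])
    show "\<forall>a\<in>mis E A \<times> mis E B. ((case a of (I, J) \<Rightarrow> I \<union> J) \<inter> A, (case a of (I, J) \<Rightarrow> I \<union> J) \<inter> B) = a"
      using assms(3) by (auto simp: mis_def)
    show "\<forall>a'\<in>mis E (A \<union> B). (case (a' \<inter> A, a' \<inter> B) of (I, J) \<Rightarrow> I \<union> J) = a'"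
      by (auto simp: mis_def)
    show "(\<lambda>(I, J). I \<union> J) ` (mis E A \<times> mis E B) \<subseteq> mis E (A \<union> B)"
    proof safe
      fix I J assume *: "I \<in> mis E A" "J \<in> mis E B"
      have "\<not> E b a" if "a \<in> A" "b \<in> B" for a b using assms(4) sym that by blast
      then show "I \<union> J \<in> mis E (A \<union> B)"
        using * assms(4) unfolding mis_def by blast
    qed
    show "(\<lambda>I. (I \<inter> A, I \<inter> B)) ` mis E (A \<union> B) \<subseteq> mis E A \<times> mis E B"
    proof safe
      fix I assume I: "I \<in> mis E (A \<union> B)"
      have ba: "\<not> E b a" if "a \<in> A" "b \<in> B" for a b using assms(4) sym that by blast
      show "I \<inter> A \<in> mis E A" "I \<inter> B \<in> mis E B"
        using I assms(4) ba unfolding mis_def by blast+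
    qed
  qed
  then show ?thesis by (simp add: bij_betw_same_card[symmetric] card_cartesian_product)
qed

lemma mis_clique:
  assumes "C \<noteq> {}" "\<And>u v. u \<in> C \<Longrightarrow> v \<in> C \<Longrightarrow> u \<noteq> v \<Longrightarrow> E u v"
  shows "mis E C = (\<lambda>v. {v}) ` C"
proof
  show "mis E C \<subseteq> (\<lambda>v. {v}) ` C"
  proof
    fix I assume I: "I \<in> mis E C"
    then have "I \<noteq> {}" using assms(1) unfolding mis_def by blast
    then obtain v where v: "v \<in> I" by blast
    have "I = {v}" using I v assms(2) unfolding mis_def by blast
    then show "I \<in> (\<lambda>v. {v}) ` C" using I unfolding mis_def by blast
  qed
  show "(\<lambda>v. {v}) ` C \<subseteq> mis E C"
  proof safe
    fix v assume v: "v \<in> C"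
    show "{v} \<in> mis E C"
    proof (rule misI)
      show "\<exists>u\<in>{v}. E w u" if "w \<in> C" "w \<notin> {v}" for w using assms(2) that v by auto
    qed (use v irr in auto)
  qed
qed

lemma nmis_clique:
  assumes "C \<noteq> {}" "\<And>u v. u \<in> C \<Longrightarrow> v \<in> C \<Longrightarrow> u \<noteq> v \<Longrightarrow> E u v"
  shows "nmis E C = card C"
proof -
  have "mis E C = (\<lambda>v. {v}) ` C" by (rule mis_clique) (use assms in auto)
  then show ?thesis by (simp add: card_image)
qed

end

section \<open>Connectivity, cycles and disjoint unions of cliques\<close>

definition reach :: "('a \<Rightarrow> 'a \<Rightarrow> bool) \<Rightarrow> 'a set \<Rightarrow> 'a \<Rightarrow> 'a \<Rightarrow> bool" where
  "reach E S u v \<longleftrightarrow> (u, v) \<in> {(a, b). a \<in> S \<and> b \<in> S \<and> E a b}\<^sup>*"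

definition component :: "('a \<Rightarrow> 'a \<Rightarrow> bool) \<Rightarrow> 'a set \<Rightarrow> 'a \<Rightarrow> 'a set" where
  "component E S u = {v \<in> S. reach E S u v}"

definition cliques :: "('a \<Rightarrow> 'a \<Rightarrow> bool) \<Rightarrow> 'a set set \<Rightarrow> 'a set \<Rightarrow> bool" where
  "cliques E \<C> S \<longleftrightarrow> finite \<C> \<and> \<Union>\<C> = S \<and>
     (\<forall>C\<in>\<C>. card C \<in> {2, 3} \<and> (\<forall>u\<in>C. \<forall>v\<in>C. u \<noteq> v \<longrightarrow> E u v)) \<and>
     (\<forall>C\<in>\<C>. \<forall>D\<in>\<C>. C \<noteq> D \<longrightarrow> C \<inter> D = {} \<and> (\<forall>u\<in>C. \<forall>v\<in>D. \<not> E u v))"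

text \<open>These graphs, the empty one included, are the exceptions in
  \<open>weight_bounded\<close>.\<close>

definition small_cliques :: "('a \<Rightarrow> 'a \<Rightarrow> bool) \<Rightarrow> 'a set \<Rightarrow> bool" where
  "small_cliques E S \<longleftrightarrow> (\<exists>\<C>. cliques E \<C> S)"

context ugraph begin

section \<open>Connectivity and components\<close>

lemma connD: "conn E S \<Longrightarrow> A \<subseteq> S \<Longrightarrow> A \<noteq> {} \<Longrightarrow> A \<noteq> S \<Longrightarrow> \<exists>a\<in>A. \<exists>b\<in>S - A. E a b"
  unfolding conn_def by blast

lemma connI: "(\<And>A. A \<subseteq> S \<Longrightarrow> A \<noteq> {} \<Longrightarrow> A \<noteq> S \<Longrightarrow> \<exists>a\<in>A. \<exists>b\<in>S - A. E a b) \<Longrightarrow> conn E S"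
  unfolding conn_def by blast

lemma reach_refl: "reach E S u u"
  by (simp add: reach_def)

lemma reach_step: "reach E S u v \<Longrightarrow> v \<in> S \<Longrightarrow> w \<in> S \<Longrightarrow> E v w \<Longrightarrow> reach E S u w"
  unfolding reach_def by (rule rtrancl_into_rtrancl) auto

lemma reach_trans: "reach E S u v \<Longrightarrow> reach E S v w \<Longrightarrow> reach E S u w"
  unfolding reach_def by (rule rtrancl_trans)

lemma reach_edge: "u \<in> S \<Longrightarrow> v \<in> S \<Longrightarrow> E u v \<Longrightarrow> reach E S u v"
  using reach_step[OF reach_refl] by blast

lemma reach_sym: "reach E S u v \<Longrightarrow> reach E S v u"
proof -
  have s: "Relation.sym {(a, b). a \<in> S \<and> b \<in> S \<and> E a b}"
    by (rule symI) (auto intro: sym)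
  show "reach E S u v \<Longrightarrow> reach E S v u"
    unfolding reach_def by (rule symD[OF sym_rtrancl[OF s]])
qed

lemma reach_mono:
  assumes "S \<subseteq> T" "reach E S u v" shows "reach E T u v"
proof -
  have "{(a, b). a \<in> S \<and> b \<in> S \<and> E a b} \<subseteq> {(a, b). a \<in> T \<and> b \<in> T \<and> E a b}" using assms(1) by auto
  from rtrancl_mono[OF this] show ?thesis using assms(2) unfolding reach_def by blast
qed

lemma conn_reach:
  assumes "conn E S" "u \<in> S" "v \<in> S" shows "reach E S u v"
proof (rule ccontr)
  assume n: "\<not> reach E S u v"
  let ?A = "{w \<in> S. reach E S u w}"
  have "\<exists>a\<in>?A. \<exists>b\<in>S - ?A. E a b"
    by (rule connD[OF assms(1)]) (use n assms reach_refl in auto)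
  then show False using reach_step by blast
qed

lemma reach_conn:
  assumes "\<And>u v. u \<in> S \<Longrightarrow> v \<in> S \<Longrightarrow> reach E S u v" shows "conn E S"
proof (rule connI)
  fix A assume A: "A \<subseteq> S" "A \<noteq> {}" "A \<noteq> S"
  then obtain u v where uv: "u \<in> A" "v \<in> S" "v \<notin> A" by blast
  show "\<exists>a\<in>A. \<exists>b\<in>S - A. E a b"
  proof (rule ccontr)
    assume n: "\<not> ?thesis"
    have "(u, w) \<in> {(a, b). a \<in> S \<and> b \<in> S \<and> E a b}\<^sup>* \<Longrightarrow> w \<in> A" for w
      by (induction rule: rtrancl_induct) (use n uv in auto)
    then show False using assms[of u v] uv A unfolding reach_def by blast
  qed
qed

lemma comp_sub: "component E S u \<subseteq> S"
  by (auto simp: component_def)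

lemma comp_self: "u \<in> S \<Longrightarrow> u \<in> component E S u"
  by (auto simp: component_def reach_refl)

lemma comp_closed: "a \<in> component E S u \<Longrightarrow> b \<in> S \<Longrightarrow> E a b \<Longrightarrow> b \<in> component E S u"
  using reach_step by (auto simp: component_def)

lemma comp_eq:
  assumes "v \<in> component E S u" shows "component E S v = component E S u"
  using assms reach_trans reach_sym unfolding component_def by blast

lemma conn_comp: "conn E (component E S u)"
proof (rule connI)
  fix A assume A: "A \<subseteq> component E S u" "A \<noteq> {}" "A \<noteq> component E S u"
  show "\<exists>a\<in>A. \<exists>b\<in>component E S u - A. E a b"
  proof (rule ccontr)
    assume n: "\<not> ?thesis"
    from A obtain a where a: "a \<in> A" by blast
    then have au: "a \<in> component E S u" using A by blast
    have "(a, w) \<in> {(a, b). a \<in> S \<and> b \<in> S \<and> E a b}\<^sup>* \<Longrightarrow> w \<in> A" for w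
    proof (induction rule: rtrancl_induct)
      case (step y z)
      then have "y \<in> component E S u" using A by blast
      then have "z \<in> component E S u" using comp_closed step by blast
      then show ?case using step n by blast
    qed (rule a)
    then have "component E S a \<subseteq> A" by (auto simp: component_def reach_def)
    then show False using A comp_eq[OF au] by blast
  qed
qed

lemma conn_singleton: "conn E {v}"
  by (rule connI) blast

lemma conn_union:
  assumes "conn E A" "conn E B" "a \<in> A" "b \<in> B" "E a b" shows "conn E (A \<union> B)"
proof (rule reach_conn)
  have A: "reach E (A \<union> B) u v" if "u \<in> A" "v \<in> A" for u v
    using reach_mono[OF _ conn_reach[OF assms(1) that]] by blast
  have B: "reach E (A \<union> B) u v" if "u \<in> B" "v \<in> B" for u v
    using reach_mono[OF _ conn_reach[OF assms(2) that]] by blast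
  have ab: "reach E (A \<union> B) a b" using assms by (intro reach_edge) auto
  have AB: "reach E (A \<union> B) u v" if "u \<in> A" "v \<in> B" for u v
    using A[OF that(1) assms(3)] ab B[OF assms(4) that(2)] reach_trans by blast
  show "reach E (A \<union> B) u v" if "u \<in> A \<union> B" "v \<in> A \<union> B" for u v
    using that A B AB reach_sym by blast
qed

lemma conn_insert: "conn E A \<Longrightarrow> a \<in> A \<Longrightarrow> E v a \<Longrightarrow> conn E (insert v A)"
  using conn_union[of "{v}" A v a] conn_singleton by simp

text \<open>Given a cut of \<open>S - {v}\<close>, put \<open>v\<close> on the side of its only
  possible neighbour \<open>u\<close>. An edge crossing the resulting cut of \<open>S\<close> then
  avoids \<open>v\<close>.\<close>

lemma conn_remove_leaf:
  assumes "conn E S" "nbhd E S v \<subseteq> {u}" shows "conn E (S - {v})"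
proof (rule connI)
  fix A assume A: "A \<subseteq> S - {v}" "A \<noteq> {}" "A \<noteq> S - {v}"
  show "\<exists>a\<in>A. \<exists>b\<in>S - {v} - A. E a b"
  proof (cases "u \<in> A \<and> v \<in> S")
    case False
    have "A \<subseteq> S" "A \<noteq> S \<or> v \<notin> S" using A by auto
    then obtain a b where ab: "a \<in> A" "b \<in> S - A" "E a b"
      using connD[OF assms(1), of A] A by (metis Diff_empty Diff_insert0)
    have "b \<noteq> v"
    proof
      assume "b = v"
      then have "a \<in> nbhd E S v" using ab A sym by (auto simp: nbhd_def)
      then show False using assms(2) ab False \<open>b = v\<close> by auto
    qed
    then show ?thesis using ab by blast
  next
    case True
    have "insert v A \<subseteq> S" "insert v A \<noteq> S" using A True by auto
    then obtain a b where ab: "a \<in> insert v A" "b \<in> S - insert v A" "E a b"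
      using connD[OF assms(1), of "insert v A"] by blast
    have "a \<noteq> v" using ab assms(2) True by (auto simp: nbhd_def)
    then show ?thesis using ab by blast
  qed
qed

lemma conn_nb: "conn E S \<Longrightarrow> v \<in> S \<Longrightarrow> S \<noteq> {v} \<Longrightarrow> \<exists>u\<in>S. E v u \<and> u \<noteq> v"
  using connD[of S "{v}"] by blast

lemma reach_path:
  assumes "reach E S a b" "a \<in> S"
  shows "\<exists>xs. xs \<noteq> [] \<and> hd xs = a \<and> last xs = b \<and> distinct xs \<and> set xs \<subseteq> S \<and> successively E xs"
  using assms(1) unfolding reach_def
proof (induction rule: rtrancl_induct)
  case base
  then show ?case using assms(2) by (intro exI[of _ "[a]"]) auto
next
  case (step y z)
  then obtain xs where xs: "xs \<noteq> []" "hd xs = a" "last xs = y" "distinct xs" "set xs \<subseteq> S" "successively E xs"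
    by blast
  show ?case
  proof (cases "z \<in> set xs")
    case False
    show ?thesis
      using xs False step by (intro exI[of _ "xs @ [z]"]) (auto simp: successively_append_iff)
  next
    \<comment> \<open>The path already visits \<open>z\<close>: cut it off there.\<close>
    case True
    then obtain ys zs where "xs = ys @ z # zs" by (meson split_list)
    then show ?thesis
      using xs by (intro exI[of _ "ys @ [z]"]) (auto simp: successively_append_iff hd_append split: if_splits)
  qed
qed

section \<open>Lower bounds for the number of cycles\<close>

lemma cycs_sub: "F \<in> cycs E S \<Longrightarrow> e \<in> F \<Longrightarrow> e \<subseteq> S"
proof -
  assume "F \<in> cycs E S" "e \<in> F"
  then obtain xs i where xs: "set xs \<subseteq> S" "i < length xs" "e = {xs ! i, xs ! (Suc i mod length xs)}" "3 \<le> length xs"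
    unfolding cycs_def by auto
  then have "Suc i mod length xs < length xs" by (intro mod_less_divisor) auto
  then show "e \<subseteq> S" using xs nth_mem by auto
qed

text \<open>A nonempty edge shows in which vertex set a cycle lives; this separates the cycles of
  disjoint sets in \<open>ncyc_union\<close>.\<close>

lemma cycs_ne: "F \<in> cycs E S \<Longrightarrow> \<exists>e\<in>F. e \<noteq> {}"
proof -
  assume "F \<in> cycs E S"
  then obtain xs where xs: "3 \<le> length xs" "F = {{xs ! i, xs ! (Suc i mod length xs)} |i. i < length xs}"
    unfolding cycs_def by auto
  have "{xs ! 0, xs ! (Suc 0 mod length xs)} \<in> F"
    unfolding xs(2) using xs(1) by (intro CollectI exI[of _ 0] conjI refl) linarith
  then show "\<exists>e\<in>F. e \<noteq> {}" by (rule rev_bexI) simp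
qed

lemma finite_cycs: "finite S \<Longrightarrow> finite (cycs E S)"
  by (rule finite_subset[of _ "Pow (Pow S)"]) (use cycs_sub in \<open>blast, simp\<close>)

lemma cycs_mono: "S \<subseteq> T \<Longrightarrow> cycs E S \<subseteq> cycs E T"
  unfolding cycs_def by blast

lemma ncyc_mono: "finite T \<Longrightarrow> S \<subseteq> T \<Longrightarrow> ncyc E S \<le> ncyc E T"
  by (intro card_mono finite_cycs cycs_mono)

lemma ncyc_union:
  assumes "finite A" "finite B" "A \<inter> B = {}" shows "ncyc E A + ncyc E B \<le> ncyc E (A \<union> B)"
proof -
  have "cycs E A \<inter> cycs E B = {}"
  proof (rule ccontr)
    assume "\<not> ?thesis"
    then obtain F where F: "F \<in> cycs E A" "F \<in> cycs E B" by blast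
    from cycs_ne[OF F(1)] obtain e where "e \<in> F" "e \<noteq> {}" by blast
    then show False using cycs_sub[OF F(1), of e] cycs_sub[OF F(2), of e] assms(3) by blast
  qed
  then have "ncyc E A + ncyc E B = card (cycs E A \<union> cycs E B)"
    by (simp add: card_Un_disjoint finite_cycs assms)
  also have "\<dots> \<le> ncyc E (A \<union> B)"
    by (intro card_mono finite_cycs) (use assms cycs_mono[of A "A \<union> B"] cycs_mono[of B "A \<union> B"] in auto)
  finally show ?thesis .
qed

text \<open>The set equation recovers the two neighbours of \<open>v\<close> on the cycle from its
  edge set, so different pairs of neighbours give different cycles.\<close>

lemma cycle_through:
  assumes "v \<notin> S" "distinct xs" "2 \<le> length xs" "set xs \<subseteq> S" "successively E xs"
    and "E v (hd xs)" "E v (last xs)"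
  shows "\<exists>F\<in>cycs E (insert v S). {u. {v, u} \<in> F} = {hd xs, last xs}"
proof -
  define ys where "ys = v # xs"
  define n where "n = length ys"
  define F where "F = {{ys ! i, ys ! (Suc i mod n)} |i. i < n}"
  have n3: "3 \<le> n" using assms(3) by (simp add: n_def ys_def)
  have xsne: "xs \<noteq> []" using assms(3) by auto
  have dist: "distinct ys" using assms by (auto simp: ys_def)
  have "\<forall>i<n. E (ys ! i) (ys ! (Suc i mod n))"
  proof (intro allI impI)
    fix i assume i: "i < n"
    show "E (ys ! i) (ys ! (Suc i mod n))"
    proof (cases "Suc i = n")
      case True
      then have "ys ! i = last xs" using xsne by (auto simp: ys_def n_def last_conv_nth nth_Cons')
      then show ?thesis using True assms(7) sym by (simp add: ys_def)
    next
      case False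
      then have "Suc i < length ys" using i n_def by simp
      moreover have "successively E ys" using assms(5,6) xsne by (simp add: ys_def successively_Cons)
      ultimately show ?thesis using False i n_def by (auto simp: successively_conv_nth)
    qed
  qed
  then have "F \<in> cycs E (insert v S)"
    unfolding cycs_def using n3 dist assms(4) by (auto simp: F_def n_def ys_def intro!: exI[of _ ys])
  moreover have "{u. {v, u} \<in> F} = {hd xs, last xs}"
  proof (rule set_eqI, rule iffI)
    fix u assume "u \<in> {u. {v, u} \<in> F}"
    then have u: "{v, u} \<in> F" by simp
    then obtain i where i: "i < n" "{v, u} = {ys ! i, ys ! (Suc i mod n)}" by (auto simp: F_def)
    have m: "Suc i mod n < n" using n3 by (intro mod_less_divisor) auto
    have z: "ys ! j = v \<Longrightarrow> j < n \<Longrightarrow> j = 0" for j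
      using nth_eq_iff_index_eq[OF dist, of j 0] n3 by (auto simp: n_def ys_def)
    have "i = 0 \<or> Suc i mod n = 0" using i(2) z[OF _ i(1)] z[OF _ m] by (metis doubleton_eq_iff)
    then show "u \<in> {hd xs, last xs}"
    proof
      assume i0: "i = 0"
      then have "{v, u} = {v, hd xs}" using i n3 xsne by (auto simp: ys_def hd_conv_nth)
      then have "u = hd xs" by (metis doubleton_eq_iff)
      then show ?thesis by simp
    next
      assume "Suc i mod n = 0"
      then have "Suc i = n" using i by (metis Suc_leI le_neq_implies_less mod_less nat.distinct(1))
      then have "ys ! i = last xs" using xsne by (auto simp: ys_def n_def last_conv_nth nth_Cons')
      then have "{v, u} = {v, last xs}" using i \<open>Suc i mod n = 0\<close> by (auto simp: ys_def)
      then have "u = last xs" by (metis doubleton_eq_iff)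
      then show ?thesis by simp
    qed
  next
    fix u assume u: "u \<in> {hd xs, last xs}"
    have "{v, hd xs} = {ys ! 0, ys ! (Suc 0 mod n)}" using n3 xsne by (auto simp: ys_def hd_conv_nth)
    then have "{v, hd xs} \<in> F" unfolding F_def using n3 by (intro CollectI exI[of _ 0] conjI) auto
    moreover have "{v, last xs} = {ys ! (n - 1), ys ! (Suc (n - 1) mod n)}"
      using n3 xsne by (auto simp: ys_def n_def last_conv_nth nth_Cons')
    then have "{v, last xs} \<in> F" unfolding F_def using n3 by (intro CollectI exI[of _ "n - 1"] conjI) auto
    ultimately show "u \<in> {u. {v, u} \<in> F}" using u by auto
  qed
  ultimately show ?thesis by blast
qed

text \<open>Two neighbours of \<open>v\<close> in the same connected part are joined by a path
  avoiding \<open>v\<close>, which \<open>v\<close> closes to a cycle. These cycles differ from each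
  other in their edges at \<open>v\<close>, and from the cycles inside the union of the parts
  because they pass through \<open>v\<close>.\<close>

lemma ncyc_family:
  assumes fin: "finite \<C>" "\<And>C. C \<in> \<C> \<Longrightarrow> finite C" and v: "v \<notin> \<Union>\<C>"
    and disj: "\<And>C D. C \<in> \<C> \<Longrightarrow> D \<in> \<C> \<Longrightarrow> C \<noteq> D \<Longrightarrow> C \<inter> D = {}"
    and con: "\<And>C. C \<in> \<C> \<Longrightarrow> conn E C"
  shows "ncyc E (\<Union>\<C>) + (\<Sum>C\<in>\<C>. card (nbhd E C v) choose 2) \<le> ncyc E (insert v (\<Union>\<C>))"
proof -
  define S where "S = \<Union>\<C>"
  define P where "P C = {B. B \<subseteq> nbhd E C v \<and> card B = 2}" for C
  have finS: "finite S" using fin by (auto simp: S_def)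
  have fnb: "finite (nbhd E C v)" if "C \<in> \<C>" for C using fin that by (auto simp: nbhd_def)
  have finP: "finite (P C)" if "C \<in> \<C>" for C
    by (rule finite_subset[of _ "Pow (nbhd E C v)"]) (use fnb[OF that] in \<open>auto simp: P_def\<close>)
  have ex: "\<exists>F\<in>cycs E (insert v S). {u. {v, u} \<in> F} = p" if p: "p \<in> (\<Union>C\<in>\<C>. P C)" for p
  proof -
    from p obtain C where C: "C \<in> \<C>" "p \<subseteq> nbhd E C v" "card p = 2" by (auto simp: P_def)
    then obtain a b where ab: "p = {a, b}" "a \<noteq> b" by (metis card_2_iff)
    then have abC: "a \<in> C" "b \<in> C" "E v a" "E v b" using C by (auto simp: nbhd_def)
    have "reach E S a b"
      using reach_mono[of C S] conn_reach[OF con[OF C(1)] abC(1,2)] C by (auto simp: S_def)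
    moreover have "a \<in> S" using abC C by (auto simp: S_def)
    ultimately obtain xs where xs: "xs \<noteq> []" "hd xs = a" "last xs = b" "distinct xs" "set xs \<subseteq> S" "successively E xs"
      using reach_path by blast
    have "2 \<le> length xs" using xs ab(2) by (cases xs; cases "tl xs") auto
    then show ?thesis using cycle_through[OF _ xs(4) _ xs(5,6)] xs ab abC v by (auto simp: S_def)
  qed
  define f where "f p = (SOME F. F \<in> cycs E (insert v S) \<and> {u. {v, u} \<in> F} = p)" for p
  have f: "f p \<in> cycs E (insert v S)" "{u. {v, u} \<in> f p} = p" if "p \<in> (\<Union>C\<in>\<C>. P C)" for p
    using someI_ex[of "\<lambda>F. F \<in> cycs E (insert v S) \<and> {u. {v, u} \<in> F} = p"] ex[OF that]
    unfolding f_def by blast+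
  have inj: "inj_on f (\<Union>C\<in>\<C>. P C)" by (rule inj_onI) (metis f(2))
  have "f p \<notin> cycs E S" if p: "p \<in> (\<Union>C\<in>\<C>. P C)" for p
  proof
    assume F: "f p \<in> cycs E S"
    have "p \<noteq> {}" using p by (auto simp: P_def)
    then obtain u where "{v, u} \<in> f p" using f(2)[OF p] by blast
    then show False using cycs_sub[OF F] v by (auto simp: S_def)
  qed
  then have dj: "cycs E S \<inter> f ` (\<Union>C\<in>\<C>. P C) = {}" by blast
  have "card (\<Union>C\<in>\<C>. P C) = (\<Sum>C\<in>\<C>. card (P C))"
  proof (rule card_UN_disjoint)
    show "\<forall>C\<in>\<C>. \<forall>D\<in>\<C>. C \<noteq> D \<longrightarrow> P C \<inter> P D = {}"
    proof (intro ballI impI)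
      fix C D assume "C \<in> \<C>" "D \<in> \<C>" "C \<noteq> D"
      then have "nbhd E C v \<inter> nbhd E D v = {}" using disj by (auto simp: nbhd_def)
      then have "B = {}" if "B \<in> P C" "B \<in> P D" for B using that unfolding P_def by blast
      moreover have "{} \<notin> P C" by (simp add: P_def)
      ultimately show "P C \<inter> P D = {}" by blast
    qed
  qed (use fin finP in auto)
  moreover have "card (P C) = card (nbhd E C v) choose 2" if "C \<in> \<C>" for C
    unfolding P_def using n_subsets[OF fnb[OF that]] by blast
  ultimately have "ncyc E S + (\<Sum>C\<in>\<C>. card (nbhd E C v) choose 2) = ncyc E S + card (f ` (\<Union>C\<in>\<C>. P C))"
    by (simp add: card_image[OF inj])
  also have "\<dots> = card (cycs E S \<union> f ` (\<Union>C\<in>\<C>. P C))"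
    by (rule card_Un_disjoint[symmetric]) (use dj finS fin finP finite_cycs in auto)
  also have "\<dots> \<le> ncyc E (insert v S)"
    by (intro card_mono finite_cycs) (use f finS cycs_mono[of S "insert v S"] in auto)
  finally show ?thesis by (simp add: S_def)
qed

lemma nbhd_remove: "nbhd E (S - {v}) v = nbhd E S v"
  using irr by (auto simp: nbhd_def)

lemma ncyc_noncut:
  assumes "finite S" "v \<in> S" "conn E (S - {v})"
  shows "ncyc E (S - {v}) + (card (nbhd E S v) choose 2) \<le> ncyc E S"
  using ncyc_family[of "{S - {v}}" v] assms nbhd_remove by (simp add: insert_absorb)

lemma conn_clique: "(\<And>u v. u \<in> C \<Longrightarrow> v \<in> C \<Longrightarrow> u \<noteq> v \<Longrightarrow> E u v) \<Longrightarrow> conn E C"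
  by (rule connI) blast

lemma ncyc_triangle:
  assumes "card C = 3" "\<And>u v. u \<in> C \<Longrightarrow> v \<in> C \<Longrightarrow> u \<noteq> v \<Longrightarrow> E u v"
  shows "1 \<le> ncyc E C"
proof -
  have fin: "finite C" using assms(1) by (metis card.infinite zero_neq_numeral)
  obtain v where v: "v \<in> C" using assms(1) by fastforce
  have "nbhd E C v = C - {v}" using assms(2) v irr by (auto simp: nbhd_def)
  then have "card (nbhd E C v) = 2" using assms(1) v fin by simp
  moreover have "conn E (C - {v})" by (rule conn_clique) (use assms in auto)
  ultimately show ?thesis using ncyc_noncut[OF fin v] by simp
qed

section \<open>Disjoint unions of copies of \<open>K_2\<close> and \<open>K_3\<close>\<close>

lemma cliquesD:
  assumes "cliques E \<C> S"
  shows "finite \<C>" "\<Union>\<C> = S" "\<And>C. C \<in> \<C> \<Longrightarrow> card C = 2 \<or> card C = 3" "\<And>C. C \<in> \<C> \<Longrightarrow> finite C"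
    "\<And>C. C \<in> \<C> \<Longrightarrow> C \<noteq> {}"
    "\<And>C u v. C \<in> \<C> \<Longrightarrow> u \<in> C \<Longrightarrow> v \<in> C \<Longrightarrow> u \<noteq> v \<Longrightarrow> E u v"
    "\<And>C D. C \<in> \<C> \<Longrightarrow> D \<in> \<C> \<Longrightarrow> C \<noteq> D \<Longrightarrow> C \<inter> D = {}"
    "\<And>C D u v. C \<in> \<C> \<Longrightarrow> D \<in> \<C> \<Longrightarrow> C \<noteq> D \<Longrightarrow> u \<in> C \<Longrightarrow> v \<in> D \<Longrightarrow> \<not> E u v"
proof -
  show *: "\<And>C. C \<in> \<C> \<Longrightarrow> card C = 2 \<or> card C = 3" using assms by (auto simp: cliques_def)
  show "\<And>C. C \<in> \<C> \<Longrightarrow> finite C" using * by (metis card.infinite zero_neq_numeral)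
  show "\<And>C. C \<in> \<C> \<Longrightarrow> C \<noteq> {}" using * by fastforce
qed (use assms in \<open>auto simp: cliques_def\<close>)

lemma nmis_Union:
  assumes "finite \<C>" "\<And>C. C \<in> \<C> \<Longrightarrow> finite C"
    "\<And>C D. C \<in> \<C> \<Longrightarrow> D \<in> \<C> \<Longrightarrow> C \<noteq> D \<Longrightarrow> C \<inter> D = {}"
    "\<And>C D u v. C \<in> \<C> \<Longrightarrow> D \<in> \<C> \<Longrightarrow> C \<noteq> D \<Longrightarrow> u \<in> C \<Longrightarrow> v \<in> D \<Longrightarrow> \<not> E u v"
  shows "nmis E (\<Union>\<C>) = (\<Prod>C\<in>\<C>. nmis E C)"
  using assms
proof (induction \<C> rule: finite_induct)
  case (insert C \<C>)
  have "nmis E (C \<union> \<Union>\<C>) = nmis E C * nmis E (\<Union>\<C>)"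
  proof (rule nmis_union)
    show "C \<inter> \<Union>\<C> = {}" using insert.prems(2)[of C] insert.hyps by blast
    show "\<not> E a b" if ab: "a \<in> C" "b \<in> \<Union>\<C>" for a b
    proof -
      from ab obtain D where D: "D \<in> \<C>" "b \<in> D" by blast
      then have "C \<noteq> D" using insert.hyps by blast
      then show ?thesis using insert.prems(3)[of C D a b] D ab by blast
    qed
  qed (use insert in auto)
  moreover have "nmis E (\<Union>\<C>) = (\<Prod>C\<in>\<C>. nmis E C)"
  proof (rule insert.IH)
    show "\<not> E u v" if "C \<in> \<C>" "D \<in> \<C>" "C \<noteq> D" "u \<in> C" "v \<in> D" for C D u v
      using insert.prems(3)[of C D u v] that by blast
  qed (use insert.prems in auto)
  ultimately show ?case using insert.hyps by simp
qed simp

lemma ncyc_Union: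
  assumes "finite \<C>" "\<And>C. C \<in> \<C> \<Longrightarrow> finite C"
    "\<And>C D. C \<in> \<C> \<Longrightarrow> D \<in> \<C> \<Longrightarrow> C \<noteq> D \<Longrightarrow> C \<inter> D = {}"
  shows "(\<Sum>C\<in>\<C>. ncyc E C) \<le> ncyc E (\<Union>\<C>)"
  using assms
proof (induction \<C> rule: finite_induct)
  case (insert C \<C>)
  have "C \<inter> \<Union>\<C> = {}" using insert.prems(2)[of C] insert.hyps by blast
  then have "ncyc E C + ncyc E (\<Union>\<C>) \<le> ncyc E (C \<union> \<Union>\<C>)"
    using insert.prems insert.hyps by (intro ncyc_union) auto
  moreover have "(\<Sum>C\<in>\<C>. ncyc E C) \<le> ncyc E (\<Union>\<C>)" using insert by auto
  ultimately show ?case using insert.hyps by simp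
qed simp

lemma card_filter_split:
  fixes \<C> :: "'a set set"
  assumes "finite \<C>" "\<And>C. C \<in> \<C> \<Longrightarrow> card C = 2 \<or> card C = 3"
  shows "\<C> = {C \<in> \<C>. card C = 2} \<union> {C \<in> \<C>. card C = 3}"
    "{C \<in> \<C>. card C = 2} \<inter> {C \<in> \<C>. card C = 3} = {}"
  using assms by auto

lemma cliques_counts:
  assumes "cliques E \<C> S"
  defines "a \<equiv> card {C \<in> \<C>. card C = 2}" and "b \<equiv> card {C \<in> \<C>. card C = 3}"
  shows "finite S" "nmis E S = 2 ^ a * 3 ^ b" "card S = 2 * a + 3 * b" "b \<le> ncyc E S"
proof -
  note c = cliquesD[OF assms(1)]
  let ?A = "{C \<in> \<C>. card C = 2}" and ?B = "{C \<in> \<C>. card C = 3}"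
  have split: "\<C> = ?A \<union> ?B" "?A \<inter> ?B = {}" using card_filter_split[OF c(1,3)] by auto
  have fin: "finite ?A" "finite ?B" using c(1) by auto
  show "finite S" using c by auto
  have "nmis E S = (\<Prod>C\<in>\<C>. nmis E C)" using nmis_Union[of \<C>] c by auto
  also have "\<dots> = (\<Prod>C\<in>\<C>. card C)"
    by (rule prod.cong[OF refl]) (rule nmis_clique; use c in blast)
  also have "\<dots> = (\<Prod>C\<in>?A. card C) * (\<Prod>C\<in>?B. card C)"
    by (subst (1) split(1)) (rule prod.union_disjoint[OF fin split(2)])
  also have "\<dots> = 2 ^ a * 3 ^ b" by (simp add: a_def b_def)
  finally show "nmis E S = 2 ^ a * 3 ^ b" .
  have "card S = (\<Sum>C\<in>\<C>. card C)"
    unfolding c(2)[symmetric] by (rule card_Union_disjoint) (use c in \<open>auto simp: pairwise_def disjnt_def\<close>)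
  also have "\<dots> = (\<Sum>C\<in>?A. card C) + (\<Sum>C\<in>?B. card C)"
    by (subst (1) split(1)) (rule sum.union_disjoint[OF fin split(2)])
  finally show "card S = 2 * a + 3 * b" by (simp add: a_def b_def)
  have "b = (\<Sum>C\<in>?B. 1)" by (simp add: b_def)
  also have "\<dots> \<le> (\<Sum>C\<in>?B. ncyc E C)"
    by (rule sum_mono) (rule ncyc_triangle; use c in auto)
  also have "\<dots> \<le> (\<Sum>C\<in>\<C>. ncyc E C)" by (rule sum_mono2) (use c in auto)
  also have "\<dots> \<le> ncyc E S" using ncyc_Union[of \<C>] c by auto
  finally show "b \<le> ncyc E S" .
qed

lemma small_cliques_union:
  assumes "small_cliques E A" "small_cliques E B" "A \<inter> B = {}" "\<And>a b. a \<in> A \<Longrightarrow> b \<in> B \<Longrightarrow> \<not> E a b"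
  shows "small_cliques E (A \<union> B)"
proof -
  obtain \<C> \<D> where c: "cliques E \<C> A" and d: "cliques E \<D> B" using assms by (auto simp: small_cliques_def)
  note c' = cliquesD[OF c] and d' = cliquesD[OF d]
  have ba: "\<And>a b. a \<in> A \<Longrightarrow> b \<in> B \<Longrightarrow> \<not> E b a" using assms(4) sym by blast
  have sub: "C \<in> \<C> \<Longrightarrow> C \<subseteq> A" "C \<in> \<D> \<Longrightarrow> C \<subseteq> B" for C using c'(2) d'(2) by auto
  have "cliques E (\<C> \<union> \<D>) (A \<union> B)"
    unfolding cliques_def
  proof (intro conjI ballI impI)
    show "finite (\<C> \<union> \<D>)" "\<Union>(\<C> \<union> \<D>) = A \<union> B" using c' d' by auto
    show "card C \<in> {2, 3}" if "C \<in> \<C> \<union> \<D>" for C using c'(3) d'(3) that by blast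
    show "E u v" if "C \<in> \<C> \<union> \<D>" "u \<in> C" "v \<in> C" "u \<noteq> v" for C u v using c'(6) d'(6) that by blast
    show "C \<inter> D = {}" if "C \<in> \<C> \<union> \<D>" "D \<in> \<C> \<union> \<D>" "C \<noteq> D" for C D
      using that c'(7)[of C D] d'(7)[of C D] sub[of C] sub[of D] assms(3) by blast
    show "\<not> E u v" if "C \<in> \<C> \<union> \<D>" "D \<in> \<C> \<union> \<D>" "C \<noteq> D" "u \<in> C" "v \<in> D" for C D u v
      using that c'(8)[of C D] d'(8)[of C D] sub[of C] sub[of D] assms(4)[of u v] ba[of v u] by blast
  qed
  then show ?thesis by (auto simp: small_cliques_def)
qed

lemma small_cliques_clique:
  assumes "card C = 2 \<or> card C = 3" "\<And>u v. u \<in> C \<Longrightarrow> v \<in> C \<Longrightarrow> u \<noteq> v \<Longrightarrow> E u v"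
  shows "small_cliques E C"
  unfolding small_cliques_def cliques_def using assms by (intro exI[of _ "{C}"]) auto

lemma small_cliques_empty: "small_cliques E {}"
  unfolding small_cliques_def cliques_def by (intro exI[of _ "{}"]) auto

lemma small_cliques_conn:
  assumes "small_cliques E S" "conn E S" "S \<noteq> {}" shows "card S = 2 \<or> card S = 3"
proof -
  obtain \<C> where c: "cliques E \<C> S" using assms by (auto simp: small_cliques_def)
  note c' = cliquesD[OF c]
  from assms(3) c'(2) obtain C where C: "C \<in> \<C>" by blast
  have "C = S"
  proof (rule ccontr)
    assume "C \<noteq> S"
    then obtain a b where ab: "a \<in> C" "b \<in> S - C" "E a b"
      using connD[OF assms(2), of C] C c'(2,5) by blast
    then obtain D where "D \<in> \<C>" "b \<in> D" using c'(2) by blast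
    then show False using c'(8)[OF C, of D a b] ab by blast
  qed
  then show ?thesis using c'(3)[OF C] by blast
qed

end

section \<open>A vertex at which a connected graph can be reduced\<close>

context ugraph begin

lemma card2_other: "card N = 2 \<Longrightarrow> a \<in> N \<Longrightarrow> \<exists>b. b \<noteq> a \<and> N = {a, b}"
  by (metis card_2_iff insert_commute insert_iff singletonD)

text \<open>Four consecutive vertices of degree 2. The outer neighbours \<open>x\<close> and
  \<open>p\<close> may coincide; if then nothing else is left, the graph is a 5-cycle. As deleting
  \<open>q2\<close> keeps the graph connected, \<open>q2\<close> lies on a cycle; the last two
  clauses make two of the branches of \<open>nmis_chain\<close> connected.\<close>

definition chain :: "'a set \<Rightarrow> 'a \<Rightarrow> 'a \<Rightarrow> 'a \<Rightarrow> 'a \<Rightarrow> 'a \<Rightarrow> 'a \<Rightarrow> bool" where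
  "chain S x q1 q2 q3 q4 p \<longleftrightarrow> {x, q1, q2, q3, q4, p} \<subseteq> S \<and> distinct [x, q1, q2, q3, q4] \<and>
     p \<notin> {q1, q2, q3, q4} \<and>
     nbhd E S q1 = {x, q2} \<and> nbhd E S q2 = {q1, q3} \<and> nbhd E S q3 = {q2, q4} \<and> nbhd E S q4 = {q3, p} \<and>
     conn E (S - {q2}) \<and> conn E (S - {q1, q2, q3}) \<and> conn E (S - {q2, q3, q4})"

text \<open>Walk into the component from a neighbour \<open>q1\<close> of \<open>x\<close>. Degree 2
  makes every next vertex unique, so the walk either returns to \<open>x\<close> or goes on. A
  return after two vertices gives a triangle, a return after three makes \<open>q1\<close> and
  \<open>q3\<close> twins, and otherwise there is a \<open>chain\<close>.\<close>

lemma component_shape: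
  assumes fin: "finite S" and con: "conn E S" and x: "x \<in> S" and d: "d \<in> S - {x}" and n3: "3 \<le> card S"
    and nc: "\<And>u. u \<in> component E (S - {x}) d \<Longrightarrow> conn E (S - {u})"
    and deg: "\<And>u. u \<in> component E (S - {x}) d \<Longrightarrow> card (nbhd E S u) \<le> 2"
  shows "(component E (S - {x}) d = {d} \<and> nbhd E S d = {x}) \<or>
    (\<exists>q1 q2. q1 \<noteq> q2 \<and> component E (S - {x}) d = {q1, q2} \<and> nbhd E S q1 = {q2, x} \<and> nbhd E S q2 = {q1, x}) \<or>
    (\<exists>u v. u \<in> S \<and> v \<in> S \<and> u \<noteq> v \<and> nbhd E S u = nbhd E S v \<and> conn E (S - {u})) \<or>
    (\<exists>q1 q2 q3 q4 p. chain S x q1 q2 q3 q4 p)"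
proof -
  define D where "D = component E (S - {x}) d"
  have D: "D \<subseteq> S - {x}" "d \<in> D" "conn E D"
    using comp_sub comp_self[OF d] conn_comp unfolding D_def by auto
  have closed: "v \<in> D \<or> v = x" if "u \<in> D" "v \<in> S" "E u v" for u v
    using comp_closed[of u "S - {x}" d v] that unfolding D_def by blast
  have finb: "finite (nbhd E S u)" for u using fin by (auto simp: nbhd_def)
  have "D \<noteq> S" using x D by auto
  then obtain q1 where q1: "q1 \<in> D" "E q1 x"
    using connD[OF con, of D] D closed by blast
  show ?thesis
  proof (cases "D = {d}")
    case True
    have "nbhd E S d = {x}" using closed[of d] True irr q1 x by (auto simp: nbhd_def)
    then show ?thesis using True unfolding D_def by blast
  next
    case False
    \<comment> \<open>A leaf \<open>u\<close> inside a larger component would have its neighbour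
      \<open>w\<close> in the component as a cut vertex, against \<open>nc\<close>.\<close>
    have deg2: "card (nbhd E S u) = 2" if u: "u \<in> D" for u
    proof (rule ccontr)
      assume "card (nbhd E S u) \<noteq> 2"
      moreover have "card (nbhd E S u) \<le> 2" using deg u unfolding D_def by blast
      moreover have "nbhd E S u \<noteq> {}"
        using conn_nb[OF con, of u] u D x by (auto simp: nbhd_def)
      then have "card (nbhd E S u) \<noteq> 0" using finb by simp
      ultimately have "card (nbhd E S u) = 1" by linarith
      then obtain w where w: "nbhd E S u = {w}" by (auto simp: card_1_singleton_iff)
      have "\<exists>v\<in>D. E u v \<and> v \<noteq> u" by (rule conn_nb) (use D u False in auto)
      then have wD: "w \<in> D" using nbD[OF w] D by blast
      have "conn E (S - {w})" using nc wD unfolding D_def by blast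
      moreover have "u \<in> S - {w}" using u D nbE[OF w, of w] irr[of u] by auto
      moreover have "S - {w} \<noteq> {u}"
      proof
        assume "S - {w} = {u}"
        then have "S \<subseteq> {u, w}" by blast
        then have "card S \<le> card {u, w}" by (intro card_mono) auto
        also have "\<dots> \<le> 2" by (simp add: card_insert_if)
        finally show False using n3 by simp
      qed
      ultimately obtain v where "v \<in> S - {w}" "E u v" using conn_nb by blast
      then show False using nbD[OF w] by blast
    qed
    have inS: "u \<in> S" "u \<noteq> x" if "u \<in> D" for u using that D by auto
    have ne: "E u v \<Longrightarrow> u \<noteq> v" for u v using irr by blast
    obtain q2 where q2: "q2 \<noteq> x" "nbhd E S q1 = {x, q2}"
      using card2_other[OF deg2[OF q1(1)], of x] q1 x by (auto simp: nbhd_def)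
    have e12: "E q1 q2" "q2 \<in> D" using nbE[OF q2(2), of q2] closed[OF q1(1)] q2 by auto
    obtain q3 where q3: "q3 \<noteq> q1" "nbhd E S q2 = {q1, q3}"
      using card2_other[OF deg2[OF e12(2)], of q1] e12 sym inS[OF q1(1)] by (auto simp: nbhd_def)
    have e23: "E q2 q3" "q3 \<in> S" using nbE[OF q3(2), of q3] by auto
    show ?thesis
    proof (cases "q3 = x")
      case True
      have "D = {q1, q2}"
      proof (rule ccontr)
        assume "D \<noteq> {q1, q2}"
        then obtain a b where "a \<in> {q1, q2}" "b \<in> D - {q1, q2}" "E a b"
          using connD[OF D(3), of "{q1, q2}"] q1 e12 by blast
        then show False using nbD[OF q2(2), of b] nbD[OF q3(2), of b] inS[of b] True by auto
      qed
      then show ?thesis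
        using q2 q3 True ne[OF e12(1)] unfolding D_def by (metis insert_commute)
    next
      case False
      then have q3D: "q3 \<in> D" using closed[OF e12(2) e23(2,1)] by blast
      obtain q4 where q4: "q4 \<noteq> q2" "nbhd E S q3 = {q2, q4}"
        using card2_other[OF deg2[OF q3D], of q2] e23 sym inS[OF e12(2)] by (auto simp: nbhd_def)
      have e34: "E q3 q4" "q4 \<in> S" using nbE[OF q4(2), of q4] by auto
      show ?thesis
      proof (cases "q4 = x")
        \<comment> \<open>Here \<open>x q1 q2 q3\<close> is a 4-cycle in which \<open>q1\<close> and
          \<open>q3\<close> have the same neighbours.\<close>
        case True
        then have "nbhd E S q1 = nbhd E S q3" using q2 q4 by auto
        moreover have "conn E (S - {q1})" using nc q1 unfolding D_def by blast
        ultimately show ?thesis using q3 inS[OF q1(1)] e23 by metis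
      next
        case nx: False
        then have q4D: "q4 \<in> D" using closed[OF q3D e34(2,1)] by blast
        have e43: "E q4 q3" using sym e34 by blast
        obtain p where p: "p \<noteq> q3" "nbhd E S q4 = {q3, p}"
          using card2_other[OF deg2[OF q4D], of q3] e43 inS[OF q3D] by (auto simp: nbhd_def)
        have e4p: "E q4 p" "p \<in> S" using nbE[OF p(2), of p] by auto
        have q41: "q4 \<noteq> q1"
        proof
          assume "q4 = q1"
          then have "q3 \<in> {x, q2}" using nbD[OF q2(2) e23(2)] e43 by blast
          then show False using \<open>q3 \<noteq> x\<close> ne[OF e23(1)] by blast
        qed
        have pq: "p \<noteq> q1" "p \<noteq> q2"
        proof -
          show "p \<noteq> q1" using nbD[OF q2(2) e34(2)] sym[OF e4p(1)] nx q4(1) by auto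
          show "p \<noteq> q2" using nbD[OF q3(2) e34(2)] sym[OF e4p(1)] q41 ne[OF e34(1)] by auto
        qed
        have c2: "conn E (S - {q2})" and c3: "conn E (S - {q3})"
          using nc e12 q3D unfolding D_def by blast+
        \<comment> \<open>Once \<open>q2\<close> is deleted, \<open>q1\<close> and \<open>q3\<close>
          have at most one neighbour left, so they can be removed one by one without disconnecting
          the graph. The same works from the other end.\<close>
        have "conn E (S - {q2} - {q1})" by (rule conn_remove_leaf[OF c2, of _ x]) (use q2 in \<open>auto simp: nbhd_def\<close>)
        then have "conn E (S - {q2} - {q1} - {q3})"
          by (rule conn_remove_leaf[of _ _ q4]) (use q4 in \<open>auto simp: nbhd_def\<close>)
        moreover have "conn E (S - {q3} - {q2})" by (rule conn_remove_leaf[OF c3, of _ q1]) (use q3 in \<open>auto simp: nbhd_def\<close>)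
        then have "conn E (S - {q3} - {q2} - {q4})"
          by (rule conn_remove_leaf[of _ _ p]) (use p in \<open>auto simp: nbhd_def\<close>)
        moreover have "S - {q2} - {q1} - {q3} = S - {q1, q2, q3}" "S - {q3} - {q2} - {q4} = S - {q2, q3, q4}" by auto
        ultimately have "chain S x q1 q2 q3 q4 p"
          unfolding chain_def using q2 q3 q4 p c2 pq q41 \<open>q3 \<noteq> x\<close> nx x e4p
            inS[OF q1(1)] inS[OF e12(2)] inS[OF q3D] inS[OF q4D] ne[OF e12(1)] ne[OF e23(1)] ne[OF e34(1)] ne[OF e4p(1)]
          by auto
        then show ?thesis by blast
      qed
    qed
  qed
qed

text \<open>Triangles sharing the vertex \<open>x\<close>, with the rest \<open>H\<close> in one
  piece. With one triangle and \<open>H\<close> empty, \<open>S\<close> is a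
  \<open>K_3\<close>.\<close>

definition pendants :: "'a set \<Rightarrow> 'a \<Rightarrow> 'a set set \<Rightarrow> 'a set \<Rightarrow> bool" where
  "pendants S x \<T> H \<longleftrightarrow> x \<notin> \<Union>\<T> \<union> H \<and> S = insert x (\<Union>\<T> \<union> H) \<and> finite \<T> \<and> \<T> \<noteq> {} \<and> \<Union>\<T> \<inter> H = {} \<and> conn E H \<and>
     (\<forall>T\<in>\<T>. \<forall>U\<in>\<T>. T \<noteq> U \<longrightarrow> T \<inter> U = {}) \<and>
     (\<forall>T\<in>\<T>. \<exists>q1 q2. q1 \<noteq> q2 \<and> T = {q1, q2} \<and> nbhd E S q1 = {q2, x} \<and> nbhd E S q2 = {q1, x})"

text \<open>Both inductions on connected graphs branch on these five outcomes. Arguing by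
  contradiction turns the excluded outcomes into facts: no twins whose deletion keeps the graph
  connected, and degree at most 2 at every vertex that is not a cut vertex.\<close>

lemma conn_structure:
  assumes fin: "finite S" and con: "conn E S" and n3: "3 \<le> card S"
  obtains
    (deg3) v where "v \<in> S" "conn E (S - {v})" "3 \<le> card (nbhd E S v)"
  | (reduce) u where "u \<in> S" "conn E (S - {u})" "nmis E S \<le> nmis E (S - {u})"
  | (chain) x q1 q2 q3 q4 p where "chain S x q1 q2 q3 q4 p"
  | (leaf) l x where "l \<in> S" "x \<in> S" "l \<noteq> x" "nbhd E S l = {x}" "conn E (S - {l, x})" "S - {l, x} \<noteq> {}"
  | (pendants) x \<T> H where "pendants S x \<T> H"
proof (rule ccontr)
  assume neg: "\<not> thesis"
  have deg: "card (nbhd E S v) \<le> 2" if "v \<in> S" "conn E (S - {v})" for v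
    using neg deg3[OF that] by linarith
  have nored: False if "u \<in> S" "conn E (S - {u})" "nmis E S \<le> nmis E (S - {u})" for u
    using neg reduce[OF that] by blast
  have notwin: False if "u \<in> S" "v \<in> S" "u \<noteq> v" "nbhd E S u = nbhd E S v" "conn E (S - {u})" for u v
    using nored[OF that(1,5)] nmis_twin[OF fin that(1-4)] by blast
  have shape: "(component E (S - {x}) d = {d} \<and> nbhd E S d = {x}) \<or>
    (\<exists>q1 q2. q1 \<noteq> q2 \<and> component E (S - {x}) d = {q1, q2} \<and> nbhd E S q1 = {q2, x} \<and> nbhd E S q2 = {q1, x})"
    if x: "x \<in> S" and d: "d \<in> S - {x}" and nc: "\<And>u. u \<in> component E (S - {x}) d \<Longrightarrow> conn E (S - {u})" for x d
  proof -
    have "card (nbhd E S u) \<le> 2" if "u \<in> component E (S - {x}) d" for u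
      using deg[OF _ nc[OF that]] that comp_sub[of "S - {x}" d] by blast
    from component_shape[OF fin con x d n3 nc this] show ?thesis using notwin neg chain by metis
  qed
  show False
  proof (cases "\<forall>u\<in>S. conn E (S - {u})")
    case True
    \<comment> \<open>Without cut vertices, \<open>S - {x}\<close> is a single component for every
      \<open>x\<close>, and the only shape left for it is an edge closing a triangle with
      \<open>x\<close>.\<close>
    obtain x where x: "x \<in> S" using n3 by fastforce
    have "card (S - {x}) \<ge> 2" using n3 x fin by simp
    then have "S - {x} \<noteq> {}" by (metis card.empty not_numeral_le_zero)
    then obtain d where d: "d \<in> S - {x}" by blast
    have sub: "u \<in> component E (S - {x}) d \<Longrightarrow> u \<in> S" for u using comp_sub[of "S - {x}" d] by blast
    have cD: "component E (S - {x}) d = S - {x}"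
      using True x d conn_reach[of "S - {x}" d] by (auto simp: component_def)
    have sh: "(component E (S - {x}) d = {d} \<and> nbhd E S d = {x}) \<or>
      (\<exists>q1 q2. q1 \<noteq> q2 \<and> component E (S - {x}) d = {q1, q2} \<and> nbhd E S q1 = {q2, x} \<and> nbhd E S q2 = {q1, x})"
      by (rule shape[OF x d]) (use True sub in blast)
    show False
      using sh
    proof (elim disjE conjE exE)
      assume "component E (S - {x}) d = {d}"
      then show False using cD \<open>card (S - {x}) \<ge> 2\<close> by simp
    next
      fix q1 q2 assume q: "q1 \<noteq> q2" "component E (S - {x}) d = {q1, q2}" "nbhd E S q1 = {q2, x}" "nbhd E S q2 = {q1, x}"
      have "S = {x, q1, q2}" "x \<noteq> q1" "x \<noteq> q2" using q(2) cD x by blast+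
      then have "pendants S x {{q1, q2}} {}" using q x unfolding pendants_def by (auto simp: conn_def)
      then show False using neg pendants by blast
    qed
  next
    case False
    then obtain x0 where x0: "x0 \<in> S" "\<not> conn E (S - {x0})" by blast
    then obtain h0 where h0: "h0 \<in> S - {x0}" unfolding conn_def by blast
    define P where "P xh \<longleftrightarrow> fst xh \<in> S \<and> \<not> conn E (S - {fst xh}) \<and> snd xh \<in> S - {fst xh}" for xh
    define f where "f xh = card (component E (S - {fst xh}) (snd xh))" for xh
    have "P (x0, h0)" using x0 h0 by (simp add: P_def)
    moreover have "f xh \<le> card S" for xh
      unfolding f_def by (rule card_mono[OF fin]) (use comp_sub in blast)
    ultimately obtain xh where xh: "P xh" "\<And>y. P y \<Longrightarrow> f y \<le> f xh"
      using ex_has_greatest_nat[of P "(x0, h0)" f "Suc (card S)"] by (auto simp: less_Suc_eq_le)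
    obtain x h where xh_eq: "xh = (x, h)" by (cases xh)
    define H where "H = component E (S - {x}) h"
    have x: "x \<in> S" "\<not> conn E (S - {x})" "h \<in> S - {x}" using xh(1) by (auto simp: P_def xh_eq)
    have H: "H \<subseteq> S - {x}" "h \<in> H" "conn E H"
      unfolding H_def using comp_sub comp_self[OF x(3)] conn_comp by auto
    have closedH: "v \<in> H \<or> v = x" if "u \<in> H" "v \<in> S" "E u v" for u v
      using comp_closed[of u "S - {x}" h v] that unfolding H_def by blast
    have "H \<noteq> S" using H x by blast
    then obtain y where y: "y \<in> H" "E y x" using connD[OF con, of H] H closedH by blast
    have conHx: "conn E (insert x H)" using conn_insert[OF H(3) y(1)] sym y(2) by blast
    \<comment> \<open>Deleting \<open>u\<close> leaves \<open>insert x H\<close> in one component,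
      so a cut vertex \<open>u\<close> would contradict the choice of \<open>H\<close> as large as
      possible.\<close>
    have noncut: "conn E (S - {u})" if u: "u \<in> S - {x} - H" for u
    proof (rule ccontr)
      assume "\<not> conn E (S - {u})"
      then have "P (u, x)" using u x by (auto simp: P_def)
      then have "f (u, x) \<le> card H" using xh(2) by (fastforce simp: f_def xh_eq H_def)
      moreover have "insert x H \<subseteq> component E (S - {u}) x"
      proof
        fix w assume w: "w \<in> insert x H"
        have "insert x H \<subseteq> S - {u}" using H u x by auto
        then show "w \<in> component E (S - {u}) x"
          using reach_mono[OF _ conn_reach[OF conHx _ w], of "S - {u}" x] w by (auto simp: component_def)
      qed
      then have "card (insert x H) \<le> f (u, x)"
        unfolding f_def fst_conv snd_conv
        using finite_subset[OF comp_sub[of "S - {u}" x]] fin by (intro card_mono) auto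
      moreover have "card (insert x H) = Suc (card H)"
        by (rule card_insert_disjoint) (use H fin in \<open>auto intro: finite_subset\<close>)
      ultimately show False by linarith
    qed
    define R where "R = S - {x} - H"
    have "R \<noteq> {}" using x(2) H by (metis Diff_eq_empty_iff R_def subset_antisym)
    have compR: "component E (S - {x}) d \<subseteq> R" if d: "d \<in> R" for d
    proof
      fix u assume u: "u \<in> component E (S - {x}) d"
      have "u \<notin> H"
      proof
        assume "u \<in> H"
        then have "H = component E (S - {x}) u" using comp_eq[of u "S - {x}" h] by (simp add: H_def)
        then have "d \<in> H" using comp_eq[OF u] comp_self[of d "S - {x}"] d by (auto simp: R_def)
        then show False using d by (auto simp: R_def)
      qed
      then show "u \<in> R" using comp_sub[of "S - {x}" d] u by (auto simp: R_def)
    qed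
    have shapeR: "(component E (S - {x}) d = {d} \<and> nbhd E S d = {x}) \<or>
      (\<exists>q1 q2. q1 \<noteq> q2 \<and> component E (S - {x}) d = {q1, q2} \<and> nbhd E S q1 = {q2, x} \<and> nbhd E S q2 = {q1, x})"
      if d: "d \<in> R" for d
      by (rule shape) (use x d compR[OF d] noncut in \<open>auto simp: R_def\<close>)
    have RS: "u \<in> R \<Longrightarrow> u \<in> S" for u by (auto simp: R_def)
    show False
    proof (cases "\<exists>l\<in>R. nbhd E S l = {x}")
      case True
      then obtain l where l: "l \<in> R" "nbhd E S l = {x}" by blast
      \<comment> \<open>Another component beside the leaf \<open>l\<close> would be a second leaf,
        hence a twin of \<open>l\<close>, or would close a triangle with \<open>x\<close>, which
        makes \<open>l\<close> removable by \<open>nmis_leaf_triangle\<close>.\<close>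
      have "d = l" if d: "d \<in> R" for d
      proof (rule ccontr)
        assume dl: "d \<noteq> l"
        from shapeR[OF d] show False
        proof (elim disjE conjE exE)
          assume "nbhd E S d = {x}"
          moreover have "conn E (S - {d})" using noncut d unfolding R_def by blast
          ultimately show False using notwin[OF RS[OF d] RS[OF l(1)] dl] l(2) by simp
        next
          fix q1 q2 assume q: "q1 \<noteq> q2" "component E (S - {x}) d = {q1, q2}" "nbhd E S q1 = {q2, x}" "nbhd E S q2 = {q1, x}"
          then have "q1 \<in> S" "q2 \<in> S" using comp_sub[of "S - {x}" d] by blast+
          then have "nmis E S \<le> nmis E (S - {l})" using nmis_leaf_triangle[OF fin RS[OF l(1)] _ _ l(2) q(3,4)] by blast
          then show False using nored[of l] l RS noncut unfolding R_def by blast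
        qed
      qed
      then have "R = {l}" using l by blast
      then have "S - {l, x} = H" using H unfolding R_def by blast
      moreover have "l \<noteq> x" using l by (auto simp: R_def)
      ultimately show False using leaf[of l x] neg l RS x H by blast
    next
      case False
      \<comment> \<open>No leaf is left, so every component other than \<open>H\<close> closes to a
        triangle through \<open>x\<close>.\<close>
      define \<T> where "\<T> = (\<lambda>d. component E (S - {x}) d) ` R"
      have UT: "\<Union>\<T> = R"
      proof
        show "\<Union>\<T> \<subseteq> R" using compR by (auto simp: \<T>_def)
        show "R \<subseteq> \<Union>\<T>" using comp_self[of _ "S - {x}"] by (auto simp: \<T>_def R_def)
      qed
      have "pendants S x \<T> H"
        unfolding pendants_def
      proof (intro conjI ballI impI)
        show "x \<notin> \<Union>\<T> \<union> H" "S = insert x (\<Union>\<T> \<union> H)" "\<Union>\<T> \<inter> H = {}"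
          unfolding UT using H x by (auto simp: R_def)
        show "finite \<T>" "\<T> \<noteq> {}" using fin \<open>R \<noteq> {}\<close> by (auto simp: \<T>_def R_def)
        show "conn E H" by (rule H)
        show "T \<inter> U = {}" if "T \<in> \<T>" "U \<in> \<T>" "T \<noteq> U" for T U
        proof (rule ccontr)
          assume "T \<inter> U \<noteq> {}"
          then obtain w where "w \<in> T" "w \<in> U" by blast
          then show False using that comp_eq[of w "S - {x}"] by (auto simp: \<T>_def)
        qed
        show "\<exists>q1 q2. q1 \<noteq> q2 \<and> T = {q1, q2} \<and> nbhd E S q1 = {q2, x} \<and> nbhd E S q2 = {q1, x}" if T: "T \<in> \<T>" for T
        proof -
          from T obtain d where d: "d \<in> R" "T = component E (S - {x}) d" by (auto simp: \<T>_def)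
          then show ?thesis using shapeR[OF d(1)] False by blast
        qed
      qed
      then show False using neg pendants by blast
    qed
  qed
qed

end

section \<open>Weights\<close>

text \<open>Normalised so that \<open>weight 2 0 = 2\<close> and \<open>weight 3 1 = 3\<close>, the counts for \<open>K_2\<close> and \<open>K_3\<close>.\<close>

definition weight :: "nat \<Rightarrow> nat \<Rightarrow> real" where
  "weight n r = sqrt 2 ^ n * (3 * sqrt 2 / 4) ^ r"

lemma sqrt2_lb: "141421 / 100000 < sqrt 2"
  by (rule real_less_rsqrt) (simp add: power2_eq_square)

lemma sqrt2_ub: "sqrt 2 < 141422 / 100000"
  by (rule real_less_lsqrt) (simp_all add: power2_eq_square)

lemma weight_pos: "0 < weight n r"
  by (simp add: weight_def)

lemma weight_add: "weight (m + a) (s + b) = weight m s * weight a b"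
  by (simp add: weight_def power_add algebra_simps)

lemma weight_mono: 
  assumes "n \<le> n'" "r \<le> r'" shows "weight n r \<le> weight n' r'"
  unfolding weight_def
  by (intro mult_mono power_increasing assms) (use sqrt2_lb in auto)

lemma sqrt2_pow: "sqrt 2 ^ 2 = 2" "sqrt 2 ^ 3 = 2 * sqrt 2" "sqrt 2 ^ 4 = 4" "sqrt 2 ^ 5 = 4 * sqrt 2"
    "sqrt 2 ^ 6 = 8"
  by (simp_all add: eval_nat_numeral)

lemma weight_consts_aux: "weight 0 0 = 1" "weight 1 0 = sqrt 2" "weight 2 0 = 2" "weight 3 0 = 2 * sqrt 2" "weight 4 0 = 4"
  "weight 5 0 = 4 * sqrt 2"
  "weight 0 1 = 3 * sqrt 2 / 4" "weight 0 2 = 9 / 8" "weight 0 3 = 27 * sqrt 2 / 32" 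
  "weight 1 1 = 3 / 2" "weight 2 1 = 3 * sqrt 2 / 2" "weight 3 1 = 3" "weight 4 1 = 3 * sqrt 2" "weight 5 1 = 6" "weight 3 2 = 9 * sqrt 2 / 4"
  "weight 4 3 = 27 * sqrt 2 / 8" "weight 1 3 = 27 / 16" "weight 5 2 = 9 * sqrt 2 / 2"
  by (simp_all add: weight_def power_mult_distrib power_divide sqrt2_pow)

lemmas weight_consts = weight_consts_aux weight_consts_aux[unfolded One_nat_def]

lemma weight_small_cliques: "weight (2 * a + 3 * b) b = 2 ^ a * 3 ^ b"
proof -
  have "weight (3 * b) b = 3 ^ b"
  proof (induction b)
    case (Suc b)
    have "weight (3 * Suc b) (Suc b) = weight (3 * b + 3) (b + 1)" by (simp add: algebra_simps)
    also have "\<dots> = weight (3 * b) b * weight 3 1" by (rule weight_add)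
    finally show ?case using Suc by (simp add: weight_consts)
  qed (simp add: weight_def)
  moreover have "weight (2 * a) 0 = 2 ^ a"
    by (simp add: weight_def power_mult)
  ultimately show ?thesis using weight_add[of "2 * a" "3 * b" 0 b] by simp
qed

text \<open>Giving up one cycle costs the factor 2 sqrt 2 / 3, about 0.943. Its square is the 8/9 of
  \<open>weight_bounded\<close>.\<close>

lemma weight_pred:
  assumes "1 \<le> r" shows "weight n (r - 1) = 2 * sqrt 2 / 3 * weight n r"
proof -
  have "weight n r = weight n (r - 1) * weight 0 1" using weight_add[of n 0 "r - 1" 1] assms by simp
  then have weight: "weight n r = weight n (r - 1) * (3 * sqrt 2 / 4)" by (simp add: weight_consts)
  have "2 * t / 3 * (X * (3 * t / 4)) = t * t / 2 * X" for t X :: real by (simp add: field_simps)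
  then have "2 * sqrt 2 / 3 * weight n r = sqrt 2 * sqrt 2 / 2 * weight n (r - 1)" unfolding weight .
  then show ?thesis by simp
qed

context ugraph begin

section \<open>The weight bound for all graphs\<close>

lemma pendantsD:
  assumes "pendants S x \<T> H"
  shows "x \<notin> \<Union>\<T> \<union> H" "S = insert x (\<Union>\<T> \<union> H)" "finite \<T>" "\<T> \<noteq> {}" "\<Union>\<T> \<inter> H = {}" "conn E H"
    "\<forall>T\<in>\<T>. \<forall>U\<in>\<T>. T \<noteq> U \<longrightarrow> T \<inter> U = {}"
    "\<forall>T\<in>\<T>. \<exists>q1 q2. q1 \<noteq> q2 \<and> T = {q1, q2} \<and> nbhd E S q1 = {q2, x} \<and> nbhd E S q2 = {q1, x}"
  by (insert assms[unfolded pendants_def], (elim conjE, assumption)+)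

lemma pendants_pair:
  assumes "pendants S x \<T> H" "T \<in> \<T>"
  obtains q1 q2 where "T = {q1, q2}" "nbhd E S q1 = {q2, x}" "nbhd E S q2 = {q1, x}" "distinct [x, q1, q2]"
    "{x, q1, q2} \<subseteq> S" "E q1 q2" "E q2 q1" "E q1 x" "E q2 x" "E x q1" "E x q2" "card {x, q1, q2} = 3"
proof -
  note p = pendantsD[OF assms(1)]
  obtain q1 q2 where q: "q1 \<noteq> q2" "T = {q1, q2}" "nbhd E S q1 = {q2, x}" "nbhd E S q2 = {q1, x}"
    using bspec[OF p(8) assms(2)] by auto
  have x: "x \<noteq> q1" "x \<noteq> q2" and S: "{x, q1, q2} \<subseteq> S" using p(1,2) assms(2) q(2) by auto
  have "E q1 q2" "E q1 x" "E q2 x" using nbE[OF q(3), of q2] nbE[OF q(3), of x] nbE[OF q(4), of x] by auto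
  then show ?thesis using that[OF q(2-4) _ S] q(1) x sym by simp
qed

definition weight_bounded :: "'a set \<Rightarrow> nat \<Rightarrow> bool" where
  "weight_bounded S r \<longleftrightarrow> real (nmis E S) \<le> weight (card S) r \<and> (\<not> small_cliques E S \<longrightarrow> real (nmis E S) \<le> 8 / 9 * weight (card S) r)"

text \<open>Here \<open>b\<close> is the number of triangles. It has the parity of
  \<open>card S\<close>, since all other parts have two vertices.\<close>

lemma small_cliques_bound:
  assumes "small_cliques E S" "ncyc E S \<le> r" 
  shows "\<exists>b\<le>r. even (card S + b) \<and> real (nmis E S) = weight (card S) b \<and> b \<le> ncyc E S"
proof -
  obtain \<C> where c: "cliques E \<C> S" using assms by (auto simp: small_cliques_def)
  define a where "a = card {C \<in> \<C>. card C = 2}"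
  define b where "b = card {C \<in> \<C>. card C = 3}"
  note k = cliques_counts[OF c, folded a_def b_def]
  have "real (nmis E S) = weight (card S) b" using k weight_small_cliques[of a b] by simp
  moreover have "even (card S + b)" using k by simp
  ultimately show ?thesis using k assms by (intro exI[of _ b]) auto
qed

text \<open>If \<open>r\<close> has the wrong parity, a union of small cliques wastes at least one
  cycle. All other graphs lose the factor 8/9, which is below 2 sqrt 2 / 3.\<close>

lemma parity_bound:
  assumes "ncyc E S \<le> r" "weight_bounded S r" "odd (card S + r)"
  shows "real (nmis E S) \<le> 2 * sqrt 2 / 3 * weight (card S) r"
proof (cases "small_cliques E S")
  case True
  then obtain b where b: "b \<le> r" "even (card S + b)" "real (nmis E S) = weight (card S) b"
    using small_cliques_bound assms by blast
  then have "b \<noteq> r" using assms(3) by auto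
  then have "b \<le> r - 1" "1 \<le> r" using b by auto
  then have "weight (card S) b \<le> weight (card S) (r - 1)" by (intro weight_mono) auto
  then show ?thesis using b(3) weight_pred[OF \<open>1 \<le> r\<close>, of "card S"] by linarith
next
  case False
  then have "real (nmis E S) \<le> 8 / 9 * weight (card S) r" using assms(2) by (simp add: weight_bounded_def)
  also have "\<dots> \<le> 2 * sqrt 2 / 3 * weight (card S) r"
    by (rule mult_right_mono) (use weight_pos[of "card S" r] sqrt2_lb in auto)
  finally show ?thesis .
qed

lemma card_closed_nb:
  assumes "finite S" "x \<in> S"
  shows "card (S - insert x (nbhd E S x)) = card S - 1 - card (nbhd E S x)"
    "card (nbhd E S x) + 1 \<le> card S"
proof -
  have "insert x (nbhd E S x) \<subseteq> S" "x \<notin> nbhd E S x" using assms irr by (auto simp: nbhd_def)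
  then have "card (insert x (nbhd E S x)) = Suc (card (nbhd E S x))" "card (insert x (nbhd E S x)) \<le> card S"
    using assms by (auto intro!: card_mono card_insert_disjoint finite_subset[of "nbhd E S x" S])
  then show "card (S - insert x (nbhd E S x)) = card S - 1 - card (nbhd E S x)" "card (nbhd E S x) + 1 \<le> card S"
    using card_Diff_subset[of "insert x (nbhd E S x)" S] \<open>insert x (nbhd E S x) \<subseteq> S\<close> assms finite_subset by auto
qed

lemma choose2_ge3: "3 \<le> d \<Longrightarrow> 3 \<le> d choose 2"
proof -
  assume "3 \<le> d"
  then have "(3 choose 2) \<le> (d choose 2)" by (rule binomial_right_mono)
  then show ?thesis by (simp add: numeral_3_eq_3 numeral_2_eq_2)
qed

lemma choose2_ge1: "2 \<le> d \<Longrightarrow> 1 \<le> d choose 2"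
  by (metis One_nat_def Suc_leI zero_less_binomial)

lemma deg3_bounds:
  assumes "finite S" "v \<in> S" "conn E (S - {v})" "3 \<le> card (nbhd E S v)" "ncyc E S \<le> r"
  shows "3 \<le> r" "ncyc E (S - {v}) \<le> r - 3" "ncyc E (S - insert v (nbhd E S v)) \<le> r - 3"
    "card (S - insert v (nbhd E S v)) \<le> card S - 4" "4 \<le> card S" "card (S - {v}) = card S - 1"
proof -
  have "ncyc E (S - {v}) + 3 \<le> ncyc E S" using ncyc_noncut[OF assms(1-3)] choose2_ge3[OF assms(4)] by linarith
  moreover have "ncyc E (S - insert v (nbhd E S v)) \<le> ncyc E (S - {v})" by (rule ncyc_mono) (use assms in auto)
  ultimately show "3 \<le> r" "ncyc E (S - {v}) \<le> r - 3" "ncyc E (S - insert v (nbhd E S v)) \<le> r - 3"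
    using assms(5) by linarith+
  show "card (S - insert v (nbhd E S v)) \<le> card S - 4" "4 \<le> card S"
    using card_closed_nb[OF assms(1,2)] assms(4) by auto
qed (use assms in auto)

text \<open>All three branches avoid \<open>q2\<close>, which lies on a cycle. The third one loses
  \<open>x\<close> and the four \<open>q\<close>'s, five vertices even if \<open>p\<close> equals
  \<open>x\<close>.\<close>

lemma chain_bounds:
  assumes fin: "finite S" and ch: "chain S x q1 q2 q3 q4 p" and r: "ncyc E S \<le> r"
  defines "T \<equiv> S - insert q1 (insert q4 (nbhd E S q1 \<union> nbhd E S q4))"
  shows "1 \<le> r" "ncyc E (S - {q1, q2, q3}) \<le> r - 1" "ncyc E (S - {q2, q3, q4}) \<le> r - 1" "ncyc E T \<le> r - 1"
    "card (S - {q1, q2, q3}) = card S - 3" "card (S - {q2, q3, q4}) = card S - 3"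
    "card T \<le> card S - 5" "5 \<le> card S"
    "nmis E S \<le> nmis E (S - {q1, q2, q3}) + nmis E (S - {q2, q3, q4}) + nmis E T"
proof -
  note c = ch[unfolded chain_def]
  have q2: "q2 \<in> S" and "card (nbhd E S q2) = 2" using c by auto
  then have "ncyc E (S - {q2}) + 1 \<le> ncyc E S" using ncyc_noncut[OF fin q2] c by simp
  moreover have "ncyc E (S - {q1, q2, q3}) \<le> ncyc E (S - {q2})" "ncyc E (S - {q2, q3, q4}) \<le> ncyc E (S - {q2})"
    "ncyc E T \<le> ncyc E (S - {q2})"
    by (rule ncyc_mono; use fin c in \<open>auto simp: T_def\<close>)+
  ultimately show "1 \<le> r" "ncyc E (S - {q1, q2, q3}) \<le> r - 1" "ncyc E (S - {q2, q3, q4}) \<le> r - 1" "ncyc E T \<le> r - 1"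
    using r by linarith+
  have s: "{q1, q2, q3} \<subseteq> S" "{q2, q3, q4} \<subseteq> S" "{x, q1, q2, q3, q4} \<subseteq> S" using c by auto
  show "card (S - {q1, q2, q3}) = card S - 3" "card (S - {q2, q3, q4}) = card S - 3"
    using card_Diff_subset[OF _ s(1)] card_Diff_subset[OF _ s(2)] c by auto
  have c5: "card {x, q1, q2, q3, q4} = 5" using c by auto
  then show "5 \<le> card S" using card_mono[OF fin s(3)] by simp
  have "card T \<le> card (S - {x, q1, q2, q3, q4})" by (rule card_mono) (use fin c in \<open>auto simp: T_def\<close>)
  then show "card T \<le> card S - 5" using card_Diff_subset[OF _ s(3)] c5 by simp
  have "\<not> E q1 q4" using nbD[of S q1 "{x, q2}" q4] c by auto
  then show "nmis E S \<le> nmis E (S - {q1, q2, q3}) + nmis E (S - {q2, q3, q4}) + nmis E T"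
    unfolding T_def by (intro nmis_chain[OF fin]) (use c in auto)
qed

lemma leaf_bounds:
  assumes "finite S" "conn E S" "l \<in> S" "x \<in> S" "l \<noteq> x" "nbhd E S l = {x}" "S - {l, x} \<noteq> {}"
  shows "card (S - {l, x}) = card S - 2" "card (S - insert x (nbhd E S x)) \<le> card S - 3" "3 \<le> card S"
    "\<exists>y. y \<in> S - {l, x} \<and> E x y"
    "nmis E S \<le> nmis E (S - {l, x}) + nmis E (S - insert x (nbhd E S x))"
proof -
  \<comment> \<open>The edge leaving \<open>{l, x}\<close> starts at \<open>x\<close>, so
    \<open>x\<close> has a neighbour besides \<open>l\<close>.\<close>
  obtain a y where "a \<in> {l, x}" "y \<in> S - {l, x}" "E a y"
    using connD[OF assms(2), of "{l, x}"] assms(3,4,7) by blast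
  then have y: "y \<in> S - {l, x}" "E x y" using nbD[OF assms(6), of y] by auto
  then show "\<exists>y. y \<in> S - {l, x} \<and> E x y" by blast
  have "E x l" using nbE[OF assms(6), of x] sym by blast
  then have "{l, y} \<subseteq> nbhd E S x" using y assms by (auto simp: nbhd_def)
  moreover have "finite (nbhd E S x)" using assms by (auto simp: nbhd_def)
  ultimately have "card {l, y} \<le> card (nbhd E S x)" by (intro card_mono) auto
  then have d: "2 \<le> card (nbhd E S x)" using y by auto
  show "card (S - insert x (nbhd E S x)) \<le> card S - 3" "3 \<le> card S"
    using card_closed_nb[OF assms(1,4)] d by auto
  show "card (S - {l, x}) = card S - 2" using card_Diff_subset[of "{l, x}" S] assms by auto
  show "nmis E S \<le> nmis E (S - {l, x}) + nmis E (S - insert x (nbhd E S x))"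
    using nmis_leaf[OF assms(1,3,6)] by simp
qed

text \<open>In each outcome of \<open>conn_structure\<close> all weights are expressed by a common
  one, which leaves a numerical inequality between the coefficients.\<close>

lemma weight_bounded_conn:
  assumes IH: "\<And>T r. card T < card S \<Longrightarrow> finite T \<Longrightarrow> ncyc E T \<le> r \<Longrightarrow> weight_bounded T r"
    and fin: "finite S" and con: "conn E S" and n3: "3 \<le> card S" and r: "ncyc E S \<le> r" and ng: "\<not> small_cliques E S"
  shows "real (nmis E S) \<le> 8 / 9 * weight (card S) r"
proof -
  have IHW: "real (nmis E T) \<le> weight m s" if "card T < card S" "T \<subseteq> S" "ncyc E T \<le> s" "card T \<le> m" for T m s
  proof -
    have "weight_bounded T s" using IH that fin finite_subset by blast
    then show ?thesis using weight_mono[of "card T" m s s] that by (simp add: weight_bounded_def)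
  qed
  from fin con n3 show ?thesis
  proof (cases rule: conn_structure)
    case (deg3 v)
    note b = deg3_bounds[OF fin deg3(1,2,3) r]
    obtain m s where ms: "card S = m + 4" "r = s + 3" using b(1,5) by (metis le_add_diff_inverse2)
    have "real (nmis E (S - {v})) \<le> weight (m + 3) s" by (rule IHW) (use b ms in auto)
    moreover have "real (nmis E (S - insert v (nbhd E S v))) \<le> weight m s" by (rule IHW) (use b ms in auto)
    ultimately have "real (nmis E S) \<le> weight (m + 3) s + weight m s" using nmis_branch[OF fin deg3(1)] by simp
    also have "\<dots> = (2 * sqrt 2 + 1) * weight m s" using weight_add[of m 3 s 0] by (simp add: weight_consts algebra_simps)
    \<comment> \<open>The coefficient on the right is 8/9 times \<open>weight 4 3\<close>.\<close>
    also have "\<dots> \<le> (3 * sqrt 2) * weight m s" by (rule mult_right_mono) (use sqrt2_lb weight_pos[of m s] in auto)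
    also have "\<dots> = 8 / 9 * weight (card S) r" by (simp add: ms weight_add weight_consts algebra_simps)
    finally show ?thesis .
  next
    case (reduce u)
    obtain m where m: "card S = m + 1" using n3 by (metis add.commute le_Suc_ex numeral_3_eq_3 plus_1_eq_Suc add_Suc)
    have "ncyc E (S - {u}) \<le> r" using ncyc_mono[OF fin, of "S - {u}"] r by auto
    then have "real (nmis E (S - {u})) \<le> weight m r" by (intro IHW) (use m reduce fin in auto)
    then have "real (nmis E S) \<le> 1 * weight m r" using reduce by simp
    also have "\<dots> \<le> (8 / 9 * sqrt 2) * weight m r" by (rule mult_right_mono) (use sqrt2_lb weight_pos[of m r] in auto)
    also have "\<dots> = 8 / 9 * weight (card S) r" using weight_add[of m 1 r 0] by (simp add: m weight_consts algebra_simps)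
    finally show ?thesis .
  next
    case (chain x q1 q2 q3 q4 p)
    note b = chain_bounds[OF fin chain r]
    let ?T = "S - insert q1 (insert q4 (nbhd E S q1 \<union> nbhd E S q4))"
    obtain m s where ms: "card S = m + 5" "r = s + 1" using b(1,8) by (metis le_add_diff_inverse2)
    have "real (nmis E (S - {q1, q2, q3})) \<le> weight (m + 2) s" by (rule IHW) (use b ms in auto)
    moreover have "real (nmis E (S - {q2, q3, q4})) \<le> weight (m + 2) s" by (rule IHW) (use b ms in auto)
    moreover have "real (nmis E ?T) \<le> weight m s"
    proof (rule IHW)
      show "card ?T < card S" "ncyc E ?T \<le> s" "card ?T \<le> m" using b(4,7,8) ms by linarith+
    qed blast
    ultimately have "real (nmis E S) \<le> 2 * weight (m + 2) s + weight m s" using b(9) by simp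
    also have "\<dots> = 5 * weight m s" using weight_add[of m 2 s 0] by (simp add: weight_consts)
    also have "\<dots> \<le> 16 / 3 * weight m s" using weight_pos[of m s] by simp
    also have "\<dots> = 8 / 9 * weight (card S) r" using weight_add[of m 5 s 1] by (simp add: ms weight_consts)
    finally show ?thesis .
  next
    case (leaf l x)
    note b = leaf_bounds[OF fin con leaf(1-4,6)]
    obtain m where m: "card S = m + 3" using b(3) by (metis le_add_diff_inverse2)
    have mono: "T \<subseteq> S \<Longrightarrow> ncyc E T \<le> r" for T using ncyc_mono[OF fin, of T] r by auto
    have "real (nmis E (S - {l, x})) \<le> weight (m + 1) r" by (rule IHW) (use b m mono in auto)
    moreover have "real (nmis E (S - insert x (nbhd E S x))) \<le> weight m r" by (rule IHW) (use b m mono in auto)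
    ultimately have "real (nmis E S) \<le> weight (m + 1) r + weight m r" using b(5) by simp
    also have "\<dots> = (sqrt 2 + 1) * weight m r" using weight_add[of m 1 r 0] by (simp add: weight_consts algebra_simps)
    also have "\<dots> \<le> (8 / 9 * 2 * sqrt 2) * weight m r" by (rule mult_right_mono) (use sqrt2_lb weight_pos[of m r] in auto)
    also have "\<dots> = 8 / 9 * weight (card S) r" using weight_add[of m 3 r 0] by (simp add: m weight_consts algebra_simps)
    finally show ?thesis .
  next
    case (pendants x \<T> H)
    obtain T where T: "T \<in> \<T>" using pendantsD(4)[OF pendants] by auto
    obtain q1 q2 where q: "nbhd E S q1 = {q2, x}" "nbhd E S q2 = {q1, x}" "distinct [x, q1, q2]" "{x, q1, q2} \<subseteq> S"
      and Es: "E q1 q2" "E q2 q1" "E q1 x" "E q2 x" "E x q1" "E x q2" and c3: "card {x, q1, q2} = 3"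
      by (rule pendants_pair[OF pendants T]) blast
    have qS: "q1 \<in> S" "q2 \<in> S" "x \<in> S" "q1 \<noteq> x" "q2 \<noteq> x" "q1 \<noteq> q2" using q by auto
    let ?K = "{x, q1, q2}" and ?A = "S - {x, q1, q2}" and ?B = "S - insert x (nbhd E S x)"
    have K: "u \<in> ?K \<Longrightarrow> v \<in> ?K \<Longrightarrow> u \<noteq> v \<Longrightarrow> E u v" for u v using Es by auto
    note K3 = c3
    \<comment> \<open>Since \<open>S\<close> is more than the triangle, some edge leaves it,
      necessarily from \<open>x\<close>; so \<open>x\<close> has degree at least 3.\<close>
    have "S \<noteq> ?K" using small_cliques_clique[of ?K] K K3 ng by auto
    then obtain a z where "a \<in> ?K" "z \<in> ?A" "E a z"
      using connD[OF con, of ?K] qS by blast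
    then have z: "z \<in> ?A" "E x z" using nbD[OF q(1), of z] nbD[OF q(2), of z] by auto
    have "{q1, q2, z} \<subseteq> nbhd E S x" using z qS Es by (auto simp: nbhd_def)
    moreover have "finite (nbhd E S x)" using fin by (auto simp: nbhd_def)
    ultimately have "card {q1, q2, z} \<le> card (nbhd E S x)" by (intro card_mono) auto
    then have d: "3 \<le> card (nbhd E S x)" using z qS by auto
    have cB: "card ?B \<le> card S - 4" "4 \<le> card S" using card_closed_nb[OF fin qS(3)] d by auto
    have cA: "card ?A = card S - 3" using card_Diff_subset[of ?K S] K3 qS by auto
    have "ncyc E ?A + ncyc E ?K \<le> ncyc E (?A \<union> ?K)" by (rule ncyc_union) (use fin in auto)
    moreover have "?A \<union> ?K = S" using qS by auto
    moreover have "1 \<le> ncyc E ?K" using ncyc_triangle[OF K3] K by auto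
    ultimately have ncA: "ncyc E ?A + 1 \<le> r" using r by simp
    have "?B \<subseteq> ?A" using qS Es by (auto simp: nbhd_def)
    then have ncB: "ncyc E ?B \<le> ncyc E ?A" by (intro ncyc_mono) (use fin in auto)
    obtain m s where ms: "card S = m + 4" "r = s + 1" using cB(2) ncA by (metis add.commute le_Suc_ex le_add_diff_inverse2 plus_1_eq_Suc add_leD2)
    have MA: "weight_bounded ?A s" by (rule IH) (use fin ms cA ncA in auto)
    have MB: "weight_bounded ?B s" by (rule IH) (use fin ms cB ncA ncB in auto)
    have A1: "real (nmis E ?A) \<le> sqrt 2 * weight m s"
      using MA cA ms weight_add[of m 1 s 0] by (simp add: weight_bounded_def weight_consts mult.commute)
    have main: "real (nmis E S) \<le> 2 * real (nmis E ?A) + real (nmis E ?B)"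
      using nmis_triangle[OF fin qS(1,2) q(1,2)] by (simp add: insert_commute)
    have w: "0 < weight m s" by (rule weight_pos)
    have sq: "141421 / 100000 * weight m s \<le> sqrt 2 * weight m s" "sqrt 2 * weight m s \<le> 141422 / 100000 * weight m s"
      by (rule mult_right_mono; use w sqrt2_lb sqrt2_ub in simp)+
    have target: "8 / 9 * weight (card S) r = 8 / 3 * (sqrt 2 * weight m s)"
      using weight_add[of m 4 s 1] by (simp add: ms weight_consts)
    \<comment> \<open>With \<open>w = weight m s\<close>, the direct estimate 2 sqrt 2 w + w
      slightly exceeds the target 8/3 sqrt 2 w. If \<open>?B\<close> has fewer than \<open>m\<close>
      vertices, there is room. Otherwise the sizes of \<open>?A\<close> and \<open>?B\<close> differ
      by one, so one of them has the wrong parity and \<open>parity_bound\<close> improves its term.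
      If that is \<open>?B\<close>, the estimate meets the target exactly.\<close>
    show ?thesis
    proof (cases "card ?B = m")
      case False
      then obtain k where k: "m = k + 1" "card ?B \<le> k" using cB ms
        by (metis add_diff_cancel_right' le_neq_implies_less less_imp_Suc_add less_Suc_eq_le Suc_eq_plus1)
      have "real (nmis E ?B) \<le> weight k s" using MB weight_mono[OF k(2), of s s] by (simp add: weight_bounded_def)
      moreover have "sqrt 2 * weight k s = weight m s" using weight_add[of k 1 s 0] by (simp add: k weight_consts mult.commute)
      moreover have "141421 / 100000 * weight k s \<le> sqrt 2 * weight k s"
        by (rule mult_right_mono) (use weight_pos[of k s] sqrt2_lb in auto)
      ultimately show ?thesis using main A1 target sq w by linarith
    next
      case True
      show ?thesis
      proof (cases "odd (m + s)")
        case True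
        then have "real (nmis E ?B) \<le> 2 * sqrt 2 / 3 * weight m s"
          using parity_bound[OF _ MB] ncA ncB ms \<open>card ?B = m\<close> by simp
        moreover have "2 * sqrt 2 / 3 * weight m s = 2 / 3 * (sqrt 2 * weight m s)" by simp
        ultimately show ?thesis using main A1 target by linarith
      next
        case False
        then have "real (nmis E ?A) \<le> 2 * sqrt 2 / 3 * (sqrt 2 * weight m s)"
          using parity_bound[OF _ MA] ncA ms cA weight_add[of m 1 s 0] by (simp add: weight_consts mult.commute)
        then have "real (nmis E ?A) \<le> 4 / 3 * weight m s" by (simp add: algebra_simps)
        moreover have "real (nmis E ?B) \<le> weight m s" using MB \<open>card ?B = m\<close> by (simp add: weight_bounded_def)
        ultimately show ?thesis using main target sq w by linarith
      qed
    qed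
  qed
qed

theorem weight_bounded: "finite S \<Longrightarrow> ncyc E S \<le> r \<Longrightarrow> weight_bounded S r"
proof (induction "card S" arbitrary: S r rule: less_induct)
  case less
  show ?case
  proof (cases "small_cliques E S")
    case True
    then obtain b where "b \<le> r" "real (nmis E S) = weight (card S) b" using small_cliques_bound less.prems by blast
    then show ?thesis using weight_mono[of "card S" "card S" b r] True by (simp add: weight_bounded_def)
  next
    case False
    have "real (nmis E S) \<le> 8 / 9 * weight (card S) r"
    proof (cases "conn E S")
      case True
      have "S \<noteq> {}" using False small_cliques_empty by auto
      then have "card S \<noteq> 0" using less.prems by simp
      then consider "card S = 1" | "card S = 2" | "3 \<le> card S" by linarith
      then show ?thesis
      proof cases
        case 1
        then obtain v where v: "S = {v}" by (auto simp: card_1_singleton_iff)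
        have "nmis E S = 1" using nmis_clique[of S] v by simp
        moreover have "weight 1 0 \<le> weight (card S) r" using 1 by (intro weight_mono) auto
        ultimately show ?thesis using sqrt2_lb by (simp add: weight_consts)
      next
        case 2
        then obtain u v where uv: "S = {u, v}" "u \<noteq> v" by (metis card_2_iff)
        have "E u v" using connD[OF True, of "{u}"] uv by auto
        then have "small_cliques E S" by (intro small_cliques_clique) (use 2 uv sym in auto)
        then show ?thesis using False by simp
      next
        case 3
        show ?thesis by (rule weight_bounded_conn[OF _ less.prems(1) True 3 less.prems(2) False]) (rule less.hyps)
      qed
    next
      case nc: False
      then obtain A where A: "A \<subseteq> S" "A \<noteq> {}" "A \<noteq> S" "\<And>a b. a \<in> A \<Longrightarrow> b \<in> S - A \<Longrightarrow> \<not> E a b"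
        unfolding conn_def by blast
      let ?B = "S - A"
      have S: "S = A \<union> ?B" using A by auto
      have fin: "finite A" "finite ?B" using less.prems finite_subset[OF A(1)] by auto
      have cS: "card S = card A + card ?B" using card_Un_disjoint[OF fin] A(1) S by (metis Diff_disjoint)
      have "card A \<noteq> 0" "card ?B \<noteq> 0" using fin A by auto
      then have lt: "card A < card S" "card ?B < card S" using cS by auto
      have "ncyc E A + ncyc E ?B \<le> ncyc E (A \<union> ?B)" by (rule ncyc_union) (use fin in auto)
      then have r: "ncyc E A + ncyc E ?B \<le> r" using S less.prems by simp
      have IA: "weight_bounded A (ncyc E A)" and IB: "weight_bounded ?B (ncyc E ?B)"
        using less.hyps lt fin by auto
      \<comment> \<open>One of the two sides is not a union of small cliques, and its factor 8/9
        survives in the product.\<close>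
      have "\<not> (small_cliques E A \<and> small_cliques E ?B)" using small_cliques_union[of A ?B] A False S by auto
      moreover have "8 / 9 * weight (card A) (ncyc E A) \<le> weight (card A) (ncyc E A)"
        "8 / 9 * weight (card ?B) (ncyc E ?B) \<le> weight (card ?B) (ncyc E ?B)"
        using weight_pos[of "card A" "ncyc E A"] weight_pos[of "card ?B" "ncyc E ?B"] by auto
      ultimately have "real (nmis E A) * real (nmis E ?B) \<le> 8 / 9 * (weight (card A) (ncyc E A) * weight (card ?B) (ncyc E ?B))"
        using mult_mono[of "real (nmis E A)" "8 / 9 * weight (card A) (ncyc E A)" "real (nmis E ?B)" "weight (card ?B) (ncyc E ?B)"]
          mult_mono[of "real (nmis E A)" "weight (card A) (ncyc E A)" "real (nmis E ?B)" "8 / 9 * weight (card ?B) (ncyc E ?B)"]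
          IA IB weight_pos[of "card A" "ncyc E A"] weight_pos[of "card ?B" "ncyc E ?B"]
        unfolding weight_bounded_def by auto
      also have "\<dots> = 8 / 9 * weight (card S) (ncyc E A + ncyc E ?B)" by (simp add: weight_add cS)
      also have "\<dots> \<le> 8 / 9 * weight (card S) r" using weight_mono[OF order_refl r, of "card S"] by simp
      finally show ?thesis using nmis_union[OF fin] A S by (metis Diff_disjoint of_nat_mult)
    qed
    then show ?thesis using False weight_pos[of "card S" r] by (simp add: weight_bounded_def)
  qed
qed

end

section \<open>Arithmetic of the connected bound\<close>

text \<open>For \<open>n \<ge> 3 r\<close> and \<open>r \<ge> 1\<close> this is \<open>c(n, r)\<close>. The induction also visits \<open>n < 3 r\<close>, where the bound need not be
  sharp; \<open>17/25\<close> leaves just enough room above the \<open>2/3\<close> that the recursion reproduces.\<close>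

definition conn_bound :: "nat \<Rightarrow> nat \<Rightarrow> real" where
  "conn_bound n r = (if n < 3 * r then 17 / 25 * weight n r + 2 ^ r / 4
             else if even (n + r) then 2 / 3 * weight n r + 2 ^ r / 2 else weight n r / sqrt 2)"

section \<open>Numerical estimates for the weights\<close>

lemma sqrt2_times:
  assumes "0 \<le> (w::real)"
  shows "141421 / 100000 * w \<le> sqrt 2 * w" "sqrt 2 * w \<le> 141422 / 100000 * w"
  by (rule mult_right_mono; use assms sqrt2_lb sqrt2_ub in simp)+

lemma weight_shift1: "weight n r = sqrt 2 * weight (n - 1) r" if "1 \<le> n"
  using weight_add[of "n - 1" 1 r 0] that by (simp add: weight_consts)

lemma weight_3r: "weight (3 * r) r = 3 ^ r"
  using weight_small_cliques[of 0 r] by simp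

lemma weight_3r1: "weight (3 * r + 1) r = sqrt 2 * 3 ^ r"
  using weight_add[of "3 * r" 1 r 0] weight_3r[of r] by (simp add: weight_consts)

lemma div_sqrt2: "x / sqrt 2 = sqrt 2 * x / 2"
  by (simp add: field_simps)

lemma pow32: "k \<le> r \<Longrightarrow> (3 / 2) ^ k * 2 ^ r \<le> (3::real) ^ r"
proof -
  assume "k \<le> r"
  then have "(3 / 2 :: real) ^ k \<le> (3 / 2) ^ r" by (intro power_increasing) auto
  then have "(3 / 2) ^ k * 2 ^ r \<le> (3 / 2 :: real) ^ r * 2 ^ r" by (intro mult_right_mono) auto
  then show ?thesis by (simp add: power_mult_distrib[symmetric])
qed

text \<open>This and the next three lemmas control the additive power of 2 in
  \<open>conn_bound\<close>. For \<open>2 \<le> r\<close> the factor 9/4 = (3/2)^2 comes from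
  comparing \<open>3 ^ r\<close> with \<open>2 ^ r\<close>; for smaller \<open>r\<close> the weight
  is at least that of a graph on five vertices.\<close>

lemma weight_growth:
  assumes "3 * r \<le> n" "5 \<le> n" shows "9 / 4 * 2 ^ r \<le> weight n r"
proof -
  consider "r = 0" | "r = 1" | "2 \<le> r" by linarith
  then show ?thesis
  proof cases
    case 1
    have "weight 5 0 \<le> weight n r" by (rule weight_mono) (use assms in auto)
    then show ?thesis using 1 sqrt2_lb by (simp add: weight_consts)
  next
    case 2
    have "weight 5 1 \<le> weight n r" by (rule weight_mono) (use assms 2 in auto)
    then show ?thesis using 2 by (simp add: weight_consts)
  next
    case 3
    have "9 / 4 * 2 ^ r \<le> (3::real) ^ r" using pow32[OF 3] by (simp add: power2_eq_square)
    also have "\<dots> \<le> weight n r" using weight_mono[of "3 * r" n r r] assms by (simp add: weight_3r)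
    finally show ?thesis .
  qed
qed

lemma weight_growth1:
  assumes "3 * r + 1 \<le> n" "5 \<le> n" shows "3 * 2 ^ r \<le> weight n r"
proof -
  consider "r = 0" | "r = 1" | "2 \<le> r" by linarith
  then show ?thesis
  proof cases
    case 1
    have "weight 5 0 \<le> weight n r" by (rule weight_mono) (use assms in auto)
    then show ?thesis using 1 sqrt2_lb by (simp add: weight_consts)
  next
    case 2
    have "weight 5 1 \<le> weight n r" by (rule weight_mono) (use assms 2 in auto)
    then show ?thesis using 2 by (simp add: weight_consts)
  next
    case 3
    have "9 / 4 * 2 ^ r \<le> (3::real) ^ r" using pow32[OF 3] by (simp add: power2_eq_square)
    moreover have "sqrt 2 * 3 ^ r \<le> weight n r"
      unfolding weight_3r1[symmetric] using assms by (intro weight_mono) auto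
    moreover have "141421 / 100000 * 3 ^ r \<le> sqrt 2 * (3::real) ^ r" by (rule sqrt2_times) simp
    moreover have "0 < (2::real) ^ r" by simp
    ultimately show ?thesis by linarith
  qed
qed

lemma weight_growth3:
  assumes "3 * r + 1 \<le> n" "3 \<le> r" shows "4772 / 1000 * 2 ^ r \<le> weight n r"
proof -
  \<comment> \<open>27/8 is (3/2)^3, and its product with sqrt 2 is slightly above 4.772.\<close>
  have "27 / 8 * 2 ^ r \<le> (3::real) ^ r" using pow32[OF assms(2)] by (simp add: eval_nat_numeral)
  moreover have "sqrt 2 * 3 ^ r \<le> weight n r"
    unfolding weight_3r1[symmetric] using assms by (intro weight_mono) auto
  moreover have "141421 / 100000 * 3 ^ r \<le> sqrt 2 * (3::real) ^ r" by (rule sqrt2_times) simp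
  moreover have "0 < (2::real) ^ r" by simp
  ultimately show ?thesis by linarith
qed

text \<open>The hypotheses give \<open>2 * r + 1 \<le> n\<close>. Along this line each step in
  \<open>r\<close> multiplies the weight by \<open>weight 2 1\<close>, which exceeds 2; at
  \<open>r = 3\<close> the weight is 27/2, just above 1.67 times 8.\<close>

lemma weight_growth4:
  assumes "3 * r + 1 \<le> n + b" "b \<le> r" "3 \<le> r" shows "167 / 100 * 2 ^ r \<le> weight n r"
proof -
  have "167 / 100 * 2 ^ r \<le> weight (2 * r + 1) r"
    using assms(3)
  proof (induction r rule: dec_induct)
    case base
    have "weight 7 3 = weight 5 2 * weight 2 1" using weight_add[of 5 2 2 1] by simp
    also have "\<dots> = 27 / 2" by (simp add: weight_consts)
    finally show ?case by simp
  next
    case (step k)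
    have "weight (2 * Suc k + 1) (Suc k) = weight (2 * k + 1) k * weight 2 1"
      using weight_add[of "2 * k + 1" 2 k 1] by simp
    also have "\<dots> = 3 / 2 * (sqrt 2 * weight (2 * k + 1) k)" by (simp add: weight_consts)
    finally have eq: "weight (2 * Suc k + 1) (Suc k) = 3 / 2 * (sqrt 2 * weight (2 * k + 1) k)" .
    have "141421 / 100000 * weight (2 * k + 1) k \<le> sqrt 2 * weight (2 * k + 1) k"
      by (rule sqrt2_times) (use weight_pos[of "2 * k + 1" k] in simp)
    moreover have "(2::real) ^ Suc k = 2 * 2 ^ k" by simp
    ultimately show ?case unfolding eq using step.IH weight_pos[of "2 * k + 1" k] by linarith
  qed
  also have "\<dots> \<le> weight n r" by (rule weight_mono) (use assms in auto)
  finally show ?thesis .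
qed

text \<open>This lemma and the ones below compare the recursion in one outcome of
  \<open>conn_structure\<close> with \<open>conn_bound\<close>. In \<open>w\<close>,
  \<open>z = sqrt 2 * w\<close> and \<open>P\<close> everything is linear, and rational bounds on
  \<open>z\<close> decide the cases of parity and range. Strictness keeps further graphs from
  attaining the bound.\<close>

lemma conn_bound_deg3:
  assumes "1 \<le> m" shows "conn_bound (m + 3) s + weight m s < conn_bound (m + 4) (s + 3)"
proof -
  define w z P where "w = weight m s" and "z = sqrt 2 * w" and "P = (2::real) ^ s"
  have pos: "0 < w" "0 < P" by (auto simp: w_def P_def weight_pos)
  have z: "141421 / 100000 * w \<le> z" "z \<le> 141422 / 100000 * w"
    unfolding z_def by (rule sqrt2_times; use pos in simp)+
  have e: "weight m s = w" "weight (m + 3) s = 2 * z" "2 * z / sqrt 2 = 2 * w"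
      "weight (m + 4) (s + 3) = 27 / 8 * z" "27 / 8 * z / sqrt 2 = 27 / 8 * w"
      "(2::real) ^ s = P" "(2::real) ^ (s + 3) = 8 * P"
    using weight_add[of m 3 s 0] weight_add[of m 4 s 3]
    by (simp_all add: w_def z_def weight_consts P_def power_add)
  show ?thesis
    unfolding conn_bound_def e using pos z by (cases "even m"; cases "even s"; auto)
qed

text \<open>At \<open>m = 3\<close> and \<open>r = 1\<close> both sides would be 3. The growth
  estimates serve the change from even to odd parity, where the summand \<open>2 ^ r / 2\<close>
  disappears.\<close>

lemma conn_bound_reduce:
  assumes "4 \<le> m" shows "conn_bound m r < conn_bound (m + 1) r"
proof -
  define w z P where "w = weight m r" and "z = sqrt 2 * w" and "P = (2::real) ^ r"
  have pos: "0 < w" "0 < P" by (auto simp: w_def P_def weight_pos)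
  have z: "141421 / 100000 * w \<le> z" "z \<le> 141422 / 100000 * w"
    unfolding z_def by (rule sqrt2_times; use pos in simp)+
  have e: "weight m r = w" "w / sqrt 2 = z / 2" "weight (m + 1) r = z" "z / sqrt 2 = w" "(2::real) ^ r = P"
    using weight_add[of m 1 r 0] by (simp_all add: w_def z_def weight_consts P_def field_simps)
  have g: "3 * r \<le> m \<Longrightarrow> 3 * P \<le> z"
    using weight_growth1[of r "m + 1"] assms e by simp
  have g2: "3 * r \<le> m + 1 \<Longrightarrow> 9 / 4 * P \<le> z"
    using weight_growth[of r "m + 1"] assms e by simp
  show ?thesis
    unfolding conn_bound_def e using pos z g g2 by (cases "even m"; cases "even r"; auto)
qed

lemma conn_bound_chain:
  assumes "1 \<le> m" shows "2 * conn_bound (m + 2) s + weight m s < conn_bound (m + 5) (s + 1)"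
proof -
  define w z P where "w = weight m s" and "z = sqrt 2 * w" and "P = (2::real) ^ s"
  have pos: "0 < w" "0 < P" by (auto simp: w_def P_def weight_pos)
  have z: "141421 / 100000 * w \<le> z" "z \<le> 141422 / 100000 * w"
    unfolding z_def by (rule sqrt2_times; use pos in simp)+
  have e: "weight m s = w" "weight (m + 2) s = 2 * w" "2 * w / sqrt 2 = z"
      "weight (m + 5) (s + 1) = 6 * w" "6 * w / sqrt 2 = 3 * z"
      "(2::real) ^ s = P" "(2::real) ^ (s + 1) = 2 * P"
    using weight_add[of m 2 s 0] weight_add[of m 5 s 1]
    by (simp_all add: w_def z_def weight_consts P_def field_simps)
  show ?thesis
    unfolding conn_bound_def e using pos z by (cases "even m"; cases "even s"; auto)
qed

text \<open>The exception is the case \<open>(n, r) = (7, 2)\<close>, where rounding down both summands is essential.\<close>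

lemma conn_bound_leaf1:
  assumes "2 \<le> m" "\<not> (m = 4 \<and> r = 2)" shows "conn_bound (m + 1) r + 8 / 9 * weight m r < conn_bound (m + 3) r"
proof -
  define w z P where "w = weight m r" and "z = sqrt 2 * w" and "P = (2::real) ^ r"
  have pos: "0 < w" "0 < P" by (auto simp: w_def P_def weight_pos)
  have z: "141421 / 100000 * w \<le> z" "z \<le> 141422 / 100000 * w"
    unfolding z_def by (rule sqrt2_times; use pos in simp)+
  have e: "weight m r = w" "weight (m + 1) r = z" "z / sqrt 2 = w"
      "weight (m + 3) r = 2 * z" "2 * z / sqrt 2 = 2 * w" "(2::real) ^ r = P"
    using weight_add[of m 1 r 0] weight_add[of m 3 r 0]
    by (simp_all add: w_def z_def weight_consts P_def)
  \<comment> \<open>The tightest case: the smaller graph lies below \<open>3 * r\<close> and the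
    larger one does not. Parity then forces \<open>m + 3 = 3 * r + 1\<close>, and the hypotheses
    exclude \<open>r = 1\<close> and \<open>r = 2\<close>.\<close>
  have g: "4772 / 1000 * P \<le> 2 * z" if "3 * r \<le> m + 3" "m + 1 < 3 * r" "odd (m + 3 + r)"
  proof -
    have "m + 3 = 3 * r + 1" using that by presburger
    moreover have "3 \<le> r" using calculation assms by presburger
    ultimately show ?thesis using weight_growth3[of r "m + 3"] e by simp
  qed
  show ?thesis
    unfolding conn_bound_def e using pos z g by (cases "even m"; cases "even r"; auto)
qed

lemma conn_bound_leaf2:
  assumes "1 \<le> m" shows "conn_bound (m + 2) s + weight m s < conn_bound (m + 4) (s + 1)"
proof -
  define w z P where "w = weight m s" and "z = sqrt 2 * w" and "P = (2::real) ^ s"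
  have pos: "0 < w" "0 < P" by (auto simp: w_def P_def weight_pos)
  have z: "141421 / 100000 * w \<le> z" "z \<le> 141422 / 100000 * w"
    unfolding z_def by (rule sqrt2_times; use pos in simp)+
  have e: "weight m s = w" "weight (m + 2) s = 2 * w" "2 * w / sqrt 2 = z"
      "weight (m + 4) (s + 1) = 3 * z" "3 * z / sqrt 2 = 3 * w"
      "(2::real) ^ s = P" "(2::real) ^ (s + 1) = 2 * P"
    using weight_add[of m 2 s 0] weight_add[of m 4 s 1]
    by (simp_all add: w_def z_def weight_consts P_def field_simps)
  \<comment> \<open>With odd parity, equality in the range condition is impossible; this gains the
    one vertex that \<open>weight_growth1\<close> asks for.\<close>
  have g: "3 * (2 * P) \<le> 3 * z" if "3 * (s + 1) \<le> m + 4" "odd (m + 4 + (s + 1))"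
  proof -
    have "3 * (s + 1) + 1 \<le> m + 4" using that by presburger
    then show ?thesis using weight_growth1[of "s + 1" "m + 4"] assms e by simp
  qed
  show ?thesis
    unfolding conn_bound_def e using pos z g by (cases "even m"; cases "even s"; auto)
qed

text \<open>Both values of \<open>conn_bound\<close> are taken on the same side of
  \<open>n = 3 * r\<close> and with the same parity. With the full \<open>weight m s\<close> in
  place of 8/9 of it, the odd case would be an equality.\<close>

lemma conn_bound_tri1:
  assumes "2 \<le> m" shows "2 * conn_bound (m + 1) s + 8 / 9 * weight m s < conn_bound (m + 4) (s + 1)"
proof -
  define w z P where "w = weight m s" and "z = sqrt 2 * w" and "P = (2::real) ^ s"
  have pos: "0 < w" "0 < P" by (auto simp: w_def P_def weight_pos)
  have z: "141421 / 100000 * w \<le> z" "z \<le> 141422 / 100000 * w"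
    unfolding z_def by (rule sqrt2_times; use pos in simp)+
  have e: "weight m s = w" "weight (m + 1) s = z" "z / sqrt 2 = w"
      "weight (m + 4) (s + 1) = 3 * z" "3 * z / sqrt 2 = 3 * w"
      "(2::real) ^ s = P" "(2::real) ^ (s + 1) = 2 * P"
    using weight_add[of m 1 s 0] weight_add[of m 4 s 1]
    by (simp_all add: w_def z_def weight_consts P_def field_simps)
  show ?thesis
    unfolding conn_bound_def e using pos z by (cases "even m"; cases "even s"; auto)
qed

lemma conn_bound_tri2:
  assumes "1 \<le> m" shows "2 * conn_bound (m + 2) s + weight m s < conn_bound (m + 5) (s + 2)"
proof -
  define w z P where "w = weight m s" and "z = sqrt 2 * w" and "P = (2::real) ^ s"
  have pos: "0 < w" "0 < P" by (auto simp: w_def P_def weight_pos)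
  have z: "141421 / 100000 * w \<le> z" "z \<le> 141422 / 100000 * w"
    unfolding z_def by (rule sqrt2_times; use pos in simp)+
  have e: "weight m s = w" "weight (m + 2) s = 2 * w" "2 * w / sqrt 2 = z"
      "weight (m + 5) (s + 2) = 9 / 2 * z" "9 / 2 * z / sqrt 2 = 9 / 2 * w"
      "(2::real) ^ s = P" "(2::real) ^ (s + 2) = 4 * P"
    using weight_add[of m 2 s 0] weight_add[of m 5 s 2]
    by (simp_all add: w_def z_def weight_consts P_def field_simps)
  have g: "3 * (4 * P) \<le> 9 / 2 * z" if "3 * (s + 2) \<le> m + 5" "odd (m + 5 + (s + 2))"
  proof -
    have "3 * (s + 2) + 1 \<le> m + 5" using that by presburger
    then show ?thesis using weight_growth1[of "s + 2" "m + 5"] assms e by simp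
  qed
  show ?thesis
    unfolding conn_bound_def e using pos z g by (cases "even m"; cases "even s"; auto)
qed

text \<open>As \<open>b\<close> is arbitrary, the terms are measured by \<open>Y = 2 ^ b * w\<close>
  and by the weight \<open>X\<close> on the right. The main relations are
  \<open>4 * w \<le> Y\<close> and \<open>9 / 4 * Y \<le> X\<close>, both sharp at
  \<open>b = 2\<close>.\<close>

lemma conn_bound_multi:
  assumes "2 \<le> b" shows "2 ^ b * conn_bound (m + 1) s + weight m s < conn_bound (m + 2 + 2 * b) (s + b)"
proof -
  define w Y X Q where "w = weight m s" and "Y = 2 ^ b * w" and "X = weight (m + 2 + 2 * b) (s + b)"
    and "Q = (2::real) ^ (s + b)"
  define z where "z = sqrt 2 * Y"
  have pos: "0 < w" "0 < Y" "0 < Q" "0 < X" by (auto simp: w_def Y_def X_def Q_def weight_pos)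
  have z: "141421 / 100000 * Y \<le> z" "z \<le> 141422 / 100000 * Y"
    unfolding z_def by (rule sqrt2_times; use pos in simp)+
  have "(2::real) ^ 2 \<le> 2 ^ b" by (rule power_increasing) (use assms in auto)
  then have "4 * w \<le> 2 ^ b * w" using pos by (intro mult_right_mono) auto
  then have wY: "4 * w \<le> Y" by (simp add: Y_def)
  have "X = w * weight (2 + 2 * b) (0 + b)" using weight_add[of m "2 + 2 * b" s b] by (simp add: X_def w_def add.assoc)
  also have "weight (2 + 2 * b) (0 + b) = 2 * 2 ^ b * weight 0 b"
    by (simp add: weight_def power_add power_mult)
  finally have X: "X = 2 * Y * weight 0 b" by (simp add: Y_def)
  have "9 / 8 \<le> weight 0 b" using weight_mono[of 0 0 2 b] assms by (simp add: weight_consts)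
  then have "2 * Y * (9 / 8) \<le> X" unfolding X by (intro mult_left_mono) (use pos in auto)
  then have XY: "9 / 4 * Y \<le> X" by simp
  have Xd: "70710 / 100000 * X \<le> X / sqrt 2"
    unfolding div_sqrt2 using sqrt2_times(1)[of X] pos by linarith
  have e1: "2 ^ b * weight (m + 1) s = z" "weight (m + 1) s / sqrt 2 = w" "2 ^ b * (2::real) ^ s = Q"
    using weight_add[of m 1 s 0] by (simp_all add: w_def z_def Y_def weight_consts Q_def power_add)
  have sub: "2 ^ b * conn_bound (m + 1) s = (if m + 1 < 3 * s then 17 / 25 * z + Q / 4
      else if even (m + 1 + s) then 2 / 3 * z + Q / 2 else Y)"
    using e1 by (auto simp: conn_bound_def Y_def distrib_left mult.left_commute)
  have par: "even (m + 2 + 2 * b + (s + b)) = even (m + s + b)" by presburger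
  have tgt: "conn_bound (m + 2 + 2 * b) (s + b) = (if m + 2 + 2 * b < 3 * (s + b) then 17 / 25 * X + Q / 4
      else if even (m + s + b) then 2 / 3 * X + Q / 2 else X / sqrt 2)"
    unfolding conn_bound_def par X_def Q_def by (rule refl)
  have g1: "3 * Q \<le> X" if "3 * (s + b) \<le> m + 2 + 2 * b" "odd (m + s + b)"
  proof -
    have "3 * (s + b) + 1 \<le> m + 2 + 2 * b" using that by presburger
    then show ?thesis using weight_growth1[of "s + b" "m + 2 + 2 * b"] assms by (simp add: X_def Q_def)
  qed
  have g4: "167 / 100 * Q \<le> X" if "m + 2 + 2 * b < 3 * (s + b)" "3 * s \<le> m + 1"
  proof -
    have "3 \<le> s + b" using that assms by (cases "s = 0") auto
    then show ?thesis using weight_growth4[of "s + b" "m + 2 + 2 * b" b] that by (simp add: X_def Q_def)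
  qed
  show ?thesis
    unfolding sub tgt w_def[symmetric] using pos z wY XY Xd g1 g4 by (auto split: if_splits)
qed

section \<open>Graphs that become a union of cliques after deleting a vertex\<close>

context ugraph begin

text \<open>All graphs attaining the bound for connected graphs are of this kind, except \<open>P_4\<close> and \<open>C_5\<close>.\<close>

definition spider :: "'a set \<Rightarrow> bool" where
  "spider S \<longleftrightarrow> (\<exists>y\<in>S. small_cliques E (S - {y}))"

text \<open>Every part has a vertex not adjacent to \<open>y\<close>, so a maximal set containing
  \<open>y\<close> still meets every part. The neighbours of \<open>y\<close> are then dominated
  within their own parts, and \<open>nmis_reduce\<close> applies.\<close>

lemma star_center_free:
  assumes c: "cliques E \<C> (S - {y})" and y: "y \<in> S"
    and nf: "\<And>C. C \<in> \<C> \<Longrightarrow> \<not> C \<subseteq> nbhd E S y"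
  shows "nmis E S = nmis E (S - {y})"
proof (rule antisym)
  note k = cliquesD[OF c]
  have fin: "finite S" using cliques_counts(1)[OF c] by simp
  show "nmis E (S - {y}) \<le> nmis E S" by (rule nmis_mono) (use fin in auto)
  show "nmis E S \<le> nmis E (S - {y})"
  proof (rule nmis_reduce[OF fin y])
    fix I w assume I: "I \<in> mis E S" "y \<in> I" "w \<in> nbhd E S y"
    then have w: "w \<in> S - {y}" "E y w" using irr by (auto simp: nbhd_def)
    then obtain C where C: "C \<in> \<C>" "w \<in> C" using k(2) by blast
    obtain v where v: "v \<in> C" "v \<notin> nbhd E S y" using nf[OF C(1)] by blast
    have CS: "C \<subseteq> S - {y}" using C(1) k(2) by blast
    have "\<exists>u\<in>C. u \<in> I"
    proof (cases "v \<in> I")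
      case False
      then obtain u where u: "u \<in> I" "E v u" using mis_dom[OF I(1), of v] v CS by blast
      have "u \<noteq> y" using u v sym CS by (auto simp: nbhd_def)
      then have "u \<in> S - {y}" using u mis_sub[OF I(1)] by blast
      then obtain D where D: "D \<in> \<C>" "u \<in> D" using k(2) by blast
      then have "D = C" using k(8)[OF C(1) D(1) _ v(1) D(2)] u by blast
      then show ?thesis using D u by blast
    qed (use v in blast)
    then obtain u where u: "u \<in> C" "u \<in> I" by blast
    have "u \<noteq> w" using mis_indep[OF I(1,2) u(2)] w by blast
    then have "E w u" using k(6)[OF C(1,2) u(1)] by blast
    then show "\<exists>z\<in>I - {y}. E w z" using u CS by blast
  qed
qed

text \<open>A maximal independent set of \<open>S - {y}\<close> meets the part \<open>C\<close>, all
  of whose vertices are adjacent to \<open>y\<close>. So it is maximal in \<open>S\<close> too, and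
  the branching at \<open>y\<close> is exact.\<close>

lemma star_center_full:
  assumes c: "cliques E \<C> (S - {y})" and y: "y \<in> S" and C: "C \<in> \<C>" "C \<subseteq> nbhd E S y"
  shows "nmis E S = nmis E (S - {y}) + nmis E (S - insert y (nbhd E S y))"
proof -
  note k = cliquesD[OF c]
  have fin: "finite S" using cliques_counts(1)[OF c] by simp
  have CS: "C \<subseteq> S - {y}" using C(1) k(2) by blast
  have "{I \<in> mis E S. y \<notin> I} = mis E (S - {y})"
  proof
    show "{I \<in> mis E S. y \<notin> I} \<subseteq> mis E (S - {y})" by (auto simp: mis_def)
    show "mis E (S - {y}) \<subseteq> {I \<in> mis E S. y \<notin> I}"
    proof
      fix I assume I: "I \<in> mis E (S - {y})"
      obtain v where v: "v \<in> C" using k(5)[OF C(1)] by blast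
      have "\<exists>u\<in>C. u \<in> I"
      proof (cases "v \<in> I")
        case False
        then obtain u where u: "u \<in> I" "E v u" using mis_dom[OF I, of v] v CS by blast
        then have "u \<in> S - {y}" using mis_sub[OF I] by blast
        then obtain D where D: "D \<in> \<C>" "u \<in> D" using k(2) by blast
        then have "D = C" using k(8)[OF C(1) D(1) _ v(1) D(2)] u by blast
        then show ?thesis using D u by blast
      qed (use v in blast)
      then obtain u where u: "u \<in> C" "u \<in> I" by blast
      then have yu: "E y u" using C(2) by (auto simp: nbhd_def)
      have "I \<in> mis E S"
      proof (rule misI)
        show "I \<subseteq> S" using mis_sub[OF I] by blast
        show "\<And>u v. u \<in> I \<Longrightarrow> v \<in> I \<Longrightarrow> \<not> E u v" using mis_indep[OF I] by blast
        fix w assume w: "w \<in> S" "w \<notin> I"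
        show "\<exists>u\<in>I. E w u"
          using mis_dom[OF I, of w] w u yu by (cases "w = y") auto
      qed
      moreover have "y \<notin> I" using mis_sub[OF I] by blast
      ultimately show "I \<in> {I \<in> mis E S. y \<notin> I}" by blast
    qed
  qed
  then show ?thesis using mis_split[OF fin, of "\<lambda>I. y \<in> I"] mis_with[OF y] by simp
qed

text \<open>Outside the closed neighbourhood of \<open>y\<close>, each part not joined completely
  leaves a nonempty clique. No edges run between these cliques, so their sizes multiply.\<close>

lemma star_far:
  assumes c: "cliques E \<C> (S - {y})" and y: "y \<in> S"
  shows "nmis E (S - insert y (nbhd E S y)) = (\<Prod>C\<in>{C\<in>\<C>. \<not> C \<subseteq> nbhd E S y}. card (C - nbhd E S y))"
proof -
  note k = cliquesD[OF c]
  let ?F = "{C\<in>\<C>. \<not> C \<subseteq> nbhd E S y}" and ?f = "\<lambda>C. C - nbhd E S y"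
  have inj: "inj_on ?f ?F"
  proof (rule inj_onI)
    fix C D assume *: "C \<in> ?F" "D \<in> ?F" "?f C = ?f D"
    then obtain v where "v \<in> C" "v \<in> D" by blast
    then show "C = D" using k(7)[of C D] * by blast
  qed
  have "S - insert y (nbhd E S y) = (S - {y}) - nbhd E S y" by auto
  also have "\<dots> = \<Union>\<C> - nbhd E S y" using k(2) by simp
  also have "\<dots> = \<Union>(?f ` ?F)" by auto
  finally have "nmis E (S - insert y (nbhd E S y)) = nmis E (\<Union>(?f ` ?F))" by simp
  also have "\<dots> = (\<Prod>D\<in>?f ` ?F. nmis E D)"
  proof (rule nmis_Union)
    fix D D' assume *: "D \<in> ?f ` ?F" "D' \<in> ?f ` ?F" "D \<noteq> D'"
    then obtain C C' where C: "C \<in> \<C>" "C' \<in> \<C>" "D = ?f C" "D' = ?f C'" "C \<noteq> C'" by blast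
    show "D \<inter> D' = {}" using C k(7)[of C C'] by blast
    show "\<not> E u v" if "u \<in> D" "v \<in> D'" for u v using k(8)[OF C(1,2,5)] that C by blast
  qed (use k in auto)
  also have "\<dots> = (\<Prod>C\<in>?F. nmis E (?f C))" by (simp add: prod.reindex[OF inj])
  also have "\<dots> = (\<Prod>C\<in>?F. card (?f C))"
    by (rule prod.cong[OF refl], rule nmis_clique) (use k(6) in auto)
  finally show ?thesis .
qed

lemma star_cycles:
  assumes c: "cliques E \<C> (S - {y})" and y: "y \<in> S"
  shows "card {C \<in> \<C>. card C = 3} + (\<Sum>C\<in>\<C>. card (nbhd E C y) choose 2) \<le> ncyc E S"
proof -
  note k = cliquesD[OF c]
  have "ncyc E (\<Union>\<C>) + (\<Sum>C\<in>\<C>. card (nbhd E C y) choose 2) \<le> ncyc E (insert y (\<Union>\<C>))"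
    by (rule ncyc_family) (use k conn_clique in auto)
  moreover have "insert y (\<Union>\<C>) = S" using k(2) y by auto
  ultimately show ?thesis using cliques_counts(4)[OF c] k(2) by simp
qed

lemma star_nb_nonempty:
  assumes c: "cliques E \<C> (S - {y})" and y: "y \<in> S" and con: "conn E S" and C: "C \<in> \<C>"
  shows "1 \<le> card (nbhd E C y)"
proof -
  note k = cliquesD[OF c]
  have CS: "C \<subseteq> S - {y}" using C k(2) by blast
  then obtain a b where ab: "a \<in> C" "b \<in> S - C" "E a b"
    using connD[OF con, of C] k(5)[OF C] y by blast
  have "b = y"
  proof (rule ccontr)
    assume "b \<noteq> y"
    then obtain D where "D \<in> \<C>" "b \<in> D" using ab k(2) by blast
    then show False using k(8)[OF C, of D a b] ab by blast
  qed
  then have "a \<in> nbhd E C y" using ab sym by (auto simp: nbhd_def)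
  moreover have "finite (nbhd E C y)" using k(4)[OF C] by (auto simp: nbhd_def)
  ultimately show ?thesis by (metis card_0_eq empty_iff less_one not_le)
qed

text \<open>The parts of \<open>S - y\<close> are \<open>a\<close> copies of \<open>K_2\<close> and \<open>b\<close> copies of \<open>K_3\<close> joined to \<open>y\<close> by one edge, and
  \<open>f\<close> copies of \<open>K_2\<close> joined to \<open>y\<close> completely. The graphs \<open>C(n, r)\<close> have \<open>f \<le> 1\<close>, the graph \<open>E\<close> has \<open>f = 2\<close>.\<close>

definition star :: "'a set \<Rightarrow> 'a \<Rightarrow> 'a set set \<Rightarrow> nat \<Rightarrow> nat \<Rightarrow> nat \<Rightarrow> bool" where
  "star S y \<C> a f b \<longleftrightarrow> y \<in> S \<and> cliques E \<C> (S - {y}) \<and>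
     (\<forall>C\<in>\<C>. card (nbhd E C y) = 1 \<or> (card C = 2 \<and> C \<subseteq> nbhd E S y)) \<and>
     a = card {C\<in>\<C>. card C = 2 \<and> \<not> C \<subseteq> nbhd E S y} \<and> f = card {C\<in>\<C>. card C = 2 \<and> C \<subseteq> nbhd E S y} \<and>
     b = card {C\<in>\<C>. card C = 3}"

lemma star_nm:
  assumes "star S y \<C> a f b"
  shows "nmis E S = 2 ^ (a + f) * 3 ^ b + (if f = 0 then 0 else 2 ^ b)" "card S = 1 + 2 * (a + f) + 3 * b"
proof -
  have y: "y \<in> S" and c: "cliques E \<C> (S - {y})"
    and d: "\<And>C. C \<in> \<C> \<Longrightarrow> card (nbhd E C y) = 1 \<or> (card C = 2 \<and> C \<subseteq> nbhd E S y)"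
    and ab: "a = card {C\<in>\<C>. card C = 2 \<and> \<not> C \<subseteq> nbhd E S y}" "f = card {C\<in>\<C>. card C = 2 \<and> C \<subseteq> nbhd E S y}"
     "b = card {C\<in>\<C>. card C = 3}"
    using assms by (auto simp: star_def)
  note k = cliquesD[OF c]
  have CS: "C \<in> \<C> \<Longrightarrow> C \<subseteq> S - {y}" for C using k(2) by blast
  have "{C\<in>\<C>. card C = 2} = {C\<in>\<C>. card C = 2 \<and> \<not> C \<subseteq> nbhd E S y} \<union> {C\<in>\<C>. card C = 2 \<and> C \<subseteq> nbhd E S y}" by blast
  then have af: "card {C\<in>\<C>. card C = 2} = a + f"
    unfolding ab by (subst card_Un_disjoint[symmetric]) (use k(1) in auto)
  note cc = cliques_counts[OF c, unfolded af, folded ab(3)]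
  have nbC: "nbhd E C y = C \<inter> nbhd E S y" if "C \<in> \<C>" for C using CS[OF that] by (auto simp: nbhd_def)
  have full3: "\<not> C \<subseteq> nbhd E S y" if "C \<in> \<C>" "card C = 3" for C
  proof
    assume "C \<subseteq> nbhd E S y"
    then have "nbhd E C y = C" using nbC[OF that(1)] by blast
    then show False using d[OF that(1)] that(2) by simp
  qed
  have fin: "finite S" using cc(1) by simp
  have "card S = Suc (card (S - {y}))" using card.remove[OF fin y] .
  then show "card S = 1 + 2 * (a + f) + 3 * b" using cc(3) by simp
  show "nmis E S = 2 ^ (a + f) * 3 ^ b + (if f = 0 then 0 else 2 ^ b)"
  proof (cases "f = 0")
    case True
    then have "{C\<in>\<C>. card C = 2 \<and> C \<subseteq> nbhd E S y} = {}" using ab(2) k(1) by auto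
    then have "\<not> C \<subseteq> nbhd E S y" if "C \<in> \<C>" for C using that k(3)[OF that] full3 by blast
    then show ?thesis using star_center_free[OF c y] True cc by simp
  next
    case False
    then have "{C\<in>\<C>. card C = 2 \<and> C \<subseteq> nbhd E S y} \<noteq> {}" unfolding ab(2) by (metis card.empty)
    then obtain C where C: "C \<in> \<C>" "C \<subseteq> nbhd E S y" by blast
    let ?F = "{C\<in>\<C>. \<not> C \<subseteq> nbhd E S y}" and ?G = "{C\<in>\<C>. card C = 3}"
    have cardd: "card (C - nbhd E S y) = card C - 1" if "C \<in> ?F" for C
    proof -
      have "C - nbhd E S y = C - nbhd E C y" using nbC[of C] that by auto
      moreover have "card (nbhd E C y) = 1" using d[of C] that by auto
      moreover have "nbhd E C y \<subseteq> C" by (auto simp: nbhd_def)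
      ultimately show ?thesis using card_Diff_subset[of "nbhd E C y" C] k(4)[of C] that finite_subset by auto
    qed
    have "nmis E (S - insert y (nbhd E S y)) = (\<Prod>C\<in>?F. card (C - nbhd E S y))" by (rule star_far[OF c y])
    \<comment> \<open>Each part not joined completely loses exactly one vertex.\<close>
    also have "\<dots> = (\<Prod>C\<in>?F. if card C = 3 then 2 else 1)"
      by (rule prod.cong[OF refl]) (use cardd k(3) in fastforce)
    also have "\<dots> = (\<Prod>C\<in>?G. 2)"
      by (rule prod.mono_neutral_cong_right) (use k(1) full3 in auto)
    also have "\<dots> = 2 ^ b" by (simp add: ab)
    finally show ?thesis using star_center_full[OF c y C] cc False by simp
  qed
qed

lemma sum_choose_ge:
  fixes d :: "'a set \<Rightarrow> nat"
  assumes "finite \<C>" "\<F> \<subseteq> \<C>" "\<And>C. C \<in> \<F> \<Longrightarrow> j \<le> (d C choose 2)"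
  shows "j * card \<F> \<le> (\<Sum>C\<in>\<C>. d C choose 2)"
proof -
  have "j * card \<F> = (\<Sum>C\<in>\<F>. j)" by simp
  also have "\<dots> \<le> (\<Sum>C\<in>\<F>. d C choose 2)" by (rule sum_mono) (rule assms)
  also have "\<dots> \<le> (\<Sum>C\<in>\<C>. d C choose 2)" by (rule sum_mono2) (use assms in auto)
  finally show ?thesis .
qed

text \<open>Each completely joined \<open>K_2\<close> already contributes 1 to the sum. The
  hypothesis \<open>few\<close> thus forbids any other part to contribute, so that every other part
  has exactly one neighbour of \<open>y\<close>.\<close>

lemma starI:
  assumes c: "cliques E \<C> (S - {y})" and y: "y \<in> S" and con: "conn E S"
    and few: "(\<Sum>C\<in>\<C>. card (nbhd E C y) choose 2) \<le> card {C\<in>\<C>. card C = 2 \<and> C \<subseteq> nbhd E S y}"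
  shows "star S y \<C> (card {C\<in>\<C>. card C = 2 \<and> \<not> C \<subseteq> nbhd E S y})
     (card {C\<in>\<C>. card C = 2 \<and> C \<subseteq> nbhd E S y}) (card {C\<in>\<C>. card C = 3})"
proof -
  note k = cliquesD[OF c]
  have "card (nbhd E C y) = 1" if C: "C \<in> \<C>" "\<not> (card C = 2 \<and> C \<subseteq> nbhd E S y)" for C
  proof (rule ccontr)
    assume "card (nbhd E C y) \<noteq> 1"
    then have "2 \<le> card (nbhd E C y)" using star_nb_nonempty[OF c y con C(1)] by linarith
    then have C1: "1 \<le> (card (nbhd E C y) choose 2)" by (rule choose2_ge1)
    let ?F = "{C\<in>\<C>. card C = 2 \<and> C \<subseteq> nbhd E S y}"
    have "1 * card (insert C ?F) \<le> (\<Sum>C\<in>\<C>. card (nbhd E C y) choose 2)"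
    proof (rule sum_choose_ge[OF k(1)])
      fix D assume D: "D \<in> insert C ?F"
      show "1 \<le> (card (nbhd E D y) choose 2)"
      proof (cases "D = C")
        case False
        then have D: "card D = 2" "D \<subseteq> nbhd E S y" using D by auto
        then have "nbhd E D y = D" by (auto simp: nbhd_def)
        then show ?thesis using D by simp
      qed (use C1 in simp)
    qed (use C in auto)
    moreover have "card (insert C ?F) = Suc (card ?F)" by (rule card_insert_disjoint) (use C k(1) in auto)
    ultimately show False using few by simp
  qed
  then show ?thesis unfolding star_def using c y by blast
qed

lemma spider_free_arith:
  assumes n: "n = 1 + 2 * a + 3 * b" and b: "b \<le> r"
  shows "2 ^ a * 3 ^ b \<le> conn_bound n r" "3 * r \<le> n \<Longrightarrow> 2 ^ a * 3 ^ b = conn_bound n r \<Longrightarrow> b = r \<and> odd (n + r)"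
proof -
  have w: "2 ^ a * 3 ^ b = weight (n - 1) b" using weight_small_cliques[of a b] n by simp
  have wn: "weight n r = sqrt 2 * weight (n - 1) r" by (rule weight_shift1) (use n in simp)
  have W2: "weight n r / sqrt 2 = weight (n - 1) r" unfolding wn by simp
  have pos: "0 < weight n r" "0 < weight (n - 1) r" by (rule weight_pos)+
  have less: "weight (n - 1) b \<le> 2 / 3 * weight n r" if "b < r"
  proof -
    have "weight (n - 1) b \<le> weight (n - 1) (r - 1)" using that by (intro weight_mono) auto
    also have "\<dots> = 2 / 3 * weight n r" using weight_pred[of r "n - 1"] that wn by simp
    finally show ?thesis .
  qed
  have ltd: "2 / 3 * weight n r < weight n r / sqrt 2" unfolding div_sqrt2 using sqrt2_times(1)[of "weight n r"] pos by linarith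
  have *: "b = r \<and> odd (n + r) \<and> \<not> n < 3 * r \<or> b < r \<and> 2 / 3 * weight n r < conn_bound n r"
  proof (cases "b = r")
    case True then show ?thesis using n by simp
  next
    case False
    then have "b < r" using b by simp
    moreover have "2 / 3 * weight n r < conn_bound n r"
    proof -
      define p where "p = (2::real) ^ r"
      have "0 < p" by (simp add: p_def)
      then show ?thesis using ltd pos unfolding conn_bound_def p_def[symmetric] by auto
    qed
    ultimately show ?thesis by blast
  qed
  have "weight (n - 1) b \<le> conn_bound n r" if "b < r" using less[OF that] * that by linarith
  moreover have "weight (n - 1) b \<le> conn_bound n r" if "b = r" using * that W2 by (auto simp: conn_bound_def)
  ultimately show "2 ^ a * 3 ^ b \<le> conn_bound n r" unfolding w using b by linarith
  show "3 * r \<le> n \<Longrightarrow> 2 ^ a * 3 ^ b = conn_bound n r \<Longrightarrow> b = r \<and> odd (n + r)" unfolding w using * less by auto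
qed

text \<open>Here \<open>a\<close> and \<open>b\<close> count all copies of \<open>K_2\<close> and \<open>K_3\<close>, and \<open>f\<close> and \<open>g\<close> those joined to the centre completely;
  each of the latter forces one, respectively three, additional cycles.\<close>

lemma spider_full_arith:
  assumes n: "n = 1 + 2 * a + 3 * b" and b: "b + f + 3 * g \<le> r" and fg: "1 \<le> f + g" "1 \<le> g \<or> 1 \<le> a"
  shows "2 ^ a * 3 ^ b + 2 ^ b \<le> conn_bound n r"
    "3 * r \<le> n \<Longrightarrow> 2 ^ a * 3 ^ b + 2 ^ b = conn_bound n r \<Longrightarrow>
      (even (n + r) \<and> b + 1 = r \<and> f = 1 \<and> g = 0) \<or> (n = 7 \<and> r = 2 \<and> b = 0 \<and> g = 0)"
proof -
  have w: "2 ^ a * 3 ^ b = weight (n - 1) b" using weight_small_cliques[of a b] n by simp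
  have wn: "weight n r = sqrt 2 * weight (n - 1) r" by (rule weight_shift1) (use n in simp)
  have W2: "weight n r / sqrt 2 = weight (n - 1) r" unfolding wn by simp
  have pos: "0 < weight n r" "0 < weight (n - 1) r" by (rule weight_pos)+
  have p1: "weight (n - 1) (r - 1) = 2 / 3 * weight n r" using weight_pred[of r "n - 1"] wn b fg by simp
  have p2: "weight (n - 1) (r - 2) = 8 / 9 * (weight n r / sqrt 2)" if "2 \<le> r"
  proof -
    have "r - 2 + 2 = r" using that by simp
    then have "weight (n - 1) r = weight (n - 1) (r - 2) * weight 0 2"
      using weight_add[of "n - 1" 0 "r - 2" 2] by (metis add_0_right)
    then show ?thesis unfolding W2 by (simp add: weight_consts)
  qed
  \<comment> \<open>If two cycles are not spent on parts \<open>K_3\<close>, the first summand loses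
    the factor 8/9 and the second is at most a quarter of \<open>2 ^ r\<close>.\<close>
  have two: "weight (n - 1) b + 2 ^ b \<le> 8 / 9 * (weight n r / sqrt 2) + 2 ^ r / 4" if "b + 2 \<le> r"
  proof -
    have "weight (n - 1) b \<le> weight (n - 1) (r - 2)" "(2::real) ^ b \<le> 2 ^ (r - 2)"
      using that by (auto intro!: weight_mono)
    moreover have "(2::real) ^ (r - 2) = 2 ^ r / 4" using that by (simp add: power_diff)
    ultimately show ?thesis using p2 that by simp
  qed
  have sq: "70710 / 100000 * weight n r \<le> weight n r / sqrt 2" "weight n r / sqrt 2 \<le> 70711 / 100000 * weight n r"
    unfolding div_sqrt2 using sqrt2_times[of "weight n r"] pos by linarith+
  have P: "0 < (2::real) ^ r" by simp
  consider (A) "b + 1 = r" "f = 1" "g = 0" | (B) "b + 2 \<le> r" using b fg by linarith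
  then have "2 ^ a * 3 ^ b + 2 ^ b \<le> conn_bound n r \<and> (3 * r \<le> n \<longrightarrow> 2 ^ a * 3 ^ b + 2 ^ b = conn_bound n r \<longrightarrow>
      (even (n + r) \<and> b + 1 = r \<and> f = 1 \<and> g = 0) \<or> (n = 7 \<and> r = 2 \<and> b = 0 \<and> g = 0))"
  proof cases
    case A
    \<comment> \<open>As \<open>g = 0\<close> leaves \<open>1 \<le> a\<close>, the size
      \<open>n = 2 * a + 3 * r - 2\<close> is in range and has the parity of \<open>r\<close>. The
      count then equals the bound.\<close>
    then have "\<not> n < 3 * r" "even (n + r)" using n fg by auto
    moreover have "(2::real) ^ b = 2 ^ r / 2" using A(1) by auto
    moreover have "weight (n - 1) b = 2 / 3 * weight n r" using p1 A(1) by auto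
    ultimately show ?thesis unfolding w using A by (simp add: conn_bound_def)
  next
    case B
    show ?thesis
    proof (cases "3 * r \<le> n \<and> odd (n + r)")
      case False
      then have "2 ^ a * 3 ^ b + 2 ^ b < conn_bound n r"
      proof -
        define p where "p = (2::real) ^ r"
        have "0 < p" by (simp add: p_def)
        moreover have "weight (n - 1) b + 2 ^ b < 66 / 100 * weight n r + p / 4"
          unfolding p_def using two[OF B] sq pos by linarith
        ultimately show ?thesis using False pos unfolding w conn_bound_def p_def[symmetric] by auto
      qed
      then show ?thesis by simp
    next
      case True
      then have n1: "3 * r + 1 \<le> n" by presburger
      have "weight (3 * r + 1) r \<le> weight n r" by (rule weight_mono) (use n1 in auto)
      \<comment> \<open>With \<open>W = weight n r / sqrt 2\<close>, the inequality
        \<open>8 / 9 * W + 2 ^ r / 4 \<le> W\<close> amounts to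
        \<open>9 / 4 * 2 ^ r \<le> W\<close>. This follows from \<open>3 ^ r \<le> W\<close>, and
        equality throughout forces \<open>r = 2\<close> and \<open>n = 7\<close>.\<close>
      then have w3: "3 ^ r \<le> weight n r / sqrt 2" unfolding weight_3r1 by (simp add: field_simps)
      have r4: "9 / 4 * 2 ^ r \<le> (3::real) ^ r" using pow32[of 2 r] B by (simp add: power2_eq_square)
      have cb: "conn_bound n r = weight n r / sqrt 2" using True by (simp add: conn_bound_def)
      have le: "2 ^ a * 3 ^ b + 2 ^ b \<le> conn_bound n r" unfolding w cb using two[OF B] w3 r4 by linarith
      moreover have "n = 7 \<and> r = 2 \<and> b = 0 \<and> g = 0" if eq: "2 ^ a * 3 ^ b + 2 ^ b = conn_bound n r"
      proof -
        have r49: "(3::real) ^ r \<le> 9 / 4 * 2 ^ r" and w9: "weight n r / sqrt 2 \<le> 9 / 4 * 2 ^ r"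
          using two[OF B] w3 r4 eq unfolding w cb by linarith+
        have "r = 2"
        proof (rule ccontr)
          assume "r \<noteq> 2"
          then have "3 \<le> r" using B by simp
          then have "27 / 8 * 2 ^ r \<le> (3::real) ^ r" using pow32[of 3 r] by (simp add: eval_nat_numeral)
          then show False using r49 P by linarith
        qed
        moreover have "n = 7"
        proof (rule ccontr)
          assume "n \<noteq> 7"
          then have "8 \<le> n" using n1 \<open>r = 2\<close> by simp
          then have "weight 8 2 \<le> weight n 2" by (intro weight_mono) auto
          moreover have "weight 8 2 = weight 5 1 * weight 3 1" using weight_add[of 5 3 1 1] by (simp add: numeral_2_eq_2)
          then have "weight 8 2 = 18" by (simp add: weight_consts)
          moreover have "(2::real) ^ r = 4" "weight n 2 = weight n r" using \<open>r = 2\<close> by simp_all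
          ultimately show False using w9 sq by linarith
        qed
        ultimately show ?thesis using B b by auto
      qed
      ultimately show ?thesis by blast
    qed
  qed
  then show "2 ^ a * 3 ^ b + 2 ^ b \<le> conn_bound n r"
    "3 * r \<le> n \<Longrightarrow> 2 ^ a * 3 ^ b + 2 ^ b = conn_bound n r \<Longrightarrow>
      (even (n + r) \<and> b + 1 = r \<and> f = 1 \<and> g = 0) \<or> (n = 7 \<and> r = 2 \<and> b = 0 \<and> g = 0)"
    by blast+
qed

text \<open>The first two cases are \<open>C(n, r)\<close> for odd and for even
  \<open>n + r\<close>; in the second, the centre and the completely joined \<open>K_2\<close> form
  the core \<open>K_3\<close>. At \<open>(7, 2)\<close> the parameters \<open>2 1 0\<close> give
  \<open>C(7, 1)\<close> and \<open>1 2 0\<close> give \<open>E\<close>.\<close>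

definition extremal :: "'a set \<Rightarrow> nat \<Rightarrow> bool" where
  "extremal S r \<longleftrightarrow> (\<exists>y \<C> a. star S y \<C> a 0 r) \<or> (\<exists>y \<C> a. star S y \<C> a 1 (r - 1) \<and> 1 \<le> r) \<or>
     (card S = 7 \<and> r = 2 \<and> (\<exists>y \<C>. star S y \<C> 2 1 0 \<or> star S y \<C> 1 2 0))"

text \<open>At the centre a completely joined \<open>K_2\<close> closes one cycle and a completely
  joined \<open>K_3\<close> three. The arithmetic lemmas turn this into the bound. In the equality
  cases no cycles are left for other attachments, so by \<open>starI\<close> all other parts hang on
  a single edge.\<close>

theorem spider_bound:
  assumes sp: "spider S" and con: "conn E S" and r: "ncyc E S \<le> r"
  shows "real (nmis E S) \<le> conn_bound (card S) r"
    "3 * r \<le> card S \<Longrightarrow> real (nmis E S) = conn_bound (card S) r \<Longrightarrow> extremal S r"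
proof -
  obtain y \<C> where y: "y \<in> S" and c: "cliques E \<C> (S - {y})" using sp by (auto simp: spider_def small_cliques_def)
  note k = cliquesD[OF c]
  let ?F2 = "{C\<in>\<C>. card C = 2 \<and> C \<subseteq> nbhd E S y}" and ?F3 = "{C\<in>\<C>. card C = 3 \<and> C \<subseteq> nbhd E S y}"
  let ?A = "{C\<in>\<C>. card C = 2 \<and> \<not> C \<subseteq> nbhd E S y}"
  define a b f g where "a = card {C\<in>\<C>. card C = 2}" and "b = card {C\<in>\<C>. card C = 3}"
    and "f = card ?F2" and "g = card ?F3"
  note cc = cliques_counts[OF c, folded a_def b_def]
  have fin: "finite S" using cc(1) by simp
  have n: "card S = 1 + 2 * a + 3 * b" using card.remove[OF fin y] cc(3) by simp
  have "{C\<in>\<C>. card C = 2} = ?A \<union> ?F2" by blast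
  then have af: "a = card ?A + f" unfolding a_def f_def by (subst card_Un_disjoint[symmetric]) (use k(1) in auto)
  have nbC: "nbhd E C y = C" if "C \<in> \<C>" "C \<subseteq> nbhd E S y" for C using that by (auto simp: nbhd_def)
  let ?s = "\<Sum>C\<in>\<C>. card (nbhd E C y) choose 2"
  have cyc: "b + ?s \<le> r" using star_cycles[OF c y] r by (simp add: b_def)
  have s: "f + 3 * g \<le> ?s"
  proof -
    have "f = (\<Sum>C\<in>?F2. card (nbhd E C y) choose 2)" using nbC by (simp add: f_def)
    moreover have "3 * g = (\<Sum>C\<in>?F3. card (nbhd E C y) choose 2)"
      using nbC by (simp add: g_def numeral_3_eq_3 numeral_2_eq_2)
    moreover have "(\<Sum>C\<in>?F2. card (nbhd E C y) choose 2) + (\<Sum>C\<in>?F3. card (nbhd E C y) choose 2)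
       = (\<Sum>C\<in>?F2 \<union> ?F3. card (nbhd E C y) choose 2)"
      by (rule sum.union_disjoint[symmetric]) (use k(1) in auto)
    moreover have "\<dots> \<le> ?s" by (rule sum_mono2) (use k(1) in auto)
    ultimately show ?thesis by linarith
  qed
  have full_iff: "(\<exists>C\<in>\<C>. C \<subseteq> nbhd E S y) \<longleftrightarrow> 1 \<le> f + g"
  proof
    assume "\<exists>C\<in>\<C>. C \<subseteq> nbhd E S y"
    then obtain C where C: "C \<in> \<C>" "C \<subseteq> nbhd E S y" by blast
    then have "C \<in> ?F2 \<or> C \<in> ?F3" using k(3) by blast
    then have "card ?F2 \<noteq> 0 \<or> card ?F3 \<noteq> 0" using k(1) by auto
    then show "1 \<le> f + g" by (auto simp: f_def g_def)
  next
    assume "1 \<le> f + g"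
    then have "?F2 \<noteq> {} \<or> ?F3 \<noteq> {}" unfolding f_def g_def by (metis add_0 card.empty not_one_le_zero)
    then show "\<exists>C\<in>\<C>. C \<subseteq> nbhd E S y" by blast
  qed
  have star: "?s \<le> f \<Longrightarrow> star S y \<C> (a - f) f b"
    using starI[OF c y con] af by (simp add: f_def b_def)
  have "real (nmis E S) \<le> conn_bound (card S) r \<and> (3 * r \<le> card S \<longrightarrow> real (nmis E S) = conn_bound (card S) r \<longrightarrow> extremal S r)" (is "_ \<and> ?eq")
  proof (cases "1 \<le> f + g")
    case False
    then have "nmis E S = 2 ^ a * 3 ^ b" using star_center_free[OF c y] full_iff cc by auto
    then have nmr: "real (nmis E S) = 2 ^ a * 3 ^ b" by simp
    have br: "b \<le> r" using cyc by simp
    have ?eq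
    proof (intro impI)
      assume "3 * r \<le> card S" "real (nmis E S) = conn_bound (card S) r"
      then have "b = r" using spider_free_arith(2)[OF n br] nmr by simp
      moreover have "f = 0" using False by simp
      ultimately have "star S y \<C> a 0 r" using star cyc by simp
      then show "extremal S r" unfolding extremal_def by blast
    qed
    then show ?thesis using spider_free_arith(1)[OF n br] nmr by simp
  next
    case True
    then obtain C where C: "C \<in> \<C>" "C \<subseteq> nbhd E S y" using full_iff by blast
    let ?F = "{C\<in>\<C>. \<not> C \<subseteq> nbhd E S y}" and ?G = "{C\<in>\<C>. card C = 3}"
    have "nmis E (S - insert y (nbhd E S y)) = (\<Prod>C\<in>?F. card (C - nbhd E S y))" by (rule star_far[OF c y])
    \<comment> \<open>By connectedness each part contains a neighbour of \<open>y\<close>, so at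
      most two vertices of a \<open>K_3\<close> and one of a \<open>K_2\<close> survive.\<close>
    also have "\<dots> \<le> (\<Prod>C\<in>?F. if card C = 3 then 2 else 1)"
    proof (rule prod_mono, intro conjI)
      fix D assume D: "D \<in> ?F"
      have "card (nbhd E D y) \<ge> 1" by (rule star_nb_nonempty[OF c y con]) (use D in auto)
      then obtain z where "z \<in> nbhd E D y" by fastforce
      then have "z \<in> D" "z \<in> nbhd E S y" using D k(2) by (auto simp: nbhd_def)
      then have "D - nbhd E S y \<subset> D" by blast
      then have "card (D - nbhd E S y) < card D" using k(4) D by (intro psubset_card_mono) auto
      then show "card (D - nbhd E S y) \<le> (if card D = 3 then 2 else 1)" using k(3)[of D] D by auto
    qed simp
    also have "\<dots> = (\<Prod>C\<in>?F \<inter> ?G. 2)"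
      by (rule prod.mono_neutral_cong_right) (use k(1) in auto)
    also have "\<dots> = 2 ^ card (?F \<inter> ?G)" by simp
    also have "\<dots> \<le> 2 ^ b"
      unfolding b_def by (rule power_increasing) (use k(1) in \<open>auto intro: card_mono\<close>)
    finally have "nmis E S \<le> 2 ^ a * 3 ^ b + 2 ^ b" using star_center_full[OF c y C] cc by simp
    then have "real (nmis E S) \<le> real (2 ^ a * 3 ^ b + 2 ^ b)" by (simp only: of_nat_le_iff)
    then have nmr: "real (nmis E S) \<le> 2 ^ a * 3 ^ b + 2 ^ b" by simp
    have bfg: "b + f + 3 * g \<le> r" using cyc s by simp
    have ga: "1 \<le> g \<or> 1 \<le> a" using True af by auto
    note ar = spider_full_arith[OF n bfg True ga]
    have ?eq
    proof (intro impI)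
      assume h: "3 * r \<le> card S" "real (nmis E S) = conn_bound (card S) r"
      then have "2 ^ a * 3 ^ b + 2 ^ b = conn_bound (card S) r" using ar(1) nmr by simp
      from ar(2)[OF h(1) this]
      show "extremal S r"
      proof (elim disjE conjE)
        assume x: "b + 1 = r" "f = 1" "g = 0"
        then have "star S y \<C> (a - 1) 1 (r - 1)" "1 \<le> r" using star cyc by auto
        then show ?thesis unfolding extremal_def by blast
      next
        assume x: "card S = 7" "r = 2" "b = 0" "g = 0"
        then have a3: "a = 3" using n by simp
        have "f = 1 \<or> f = 2" using x True bfg by linarith
        then show ?thesis
        proof
          assume f: "f = 2"
          then have "star S y \<C> 1 2 0" using star cyc x a3 by simp
          then show ?thesis unfolding extremal_def using x by blast
        next
          assume f: "f = 1"
          show ?thesis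
          proof (cases "?s \<le> 1")
            case True
            then have "star S y \<C> 2 1 0" using star x a3 f by simp
            then show ?thesis unfolding extremal_def using x by blast
          next
            case False
            \<comment> \<open>As \<open>b = 0\<close>, all parts are \<open>K_2\<close>. One that is
              not joined completely has at most one neighbour of \<open>y\<close> and contributes
              nothing, so \<open>?s\<close> is at most \<open>f = 1\<close> after all.\<close>
            have "card C = 2" if "C \<in> \<C>" for C
              using k(3)[OF that] x(3) k(1) that unfolding b_def by auto
            have le: "card (nbhd E C y) choose 2 \<le> (if C \<in> ?F2 then 1 else 0)" if "C \<in> \<C>" for C
            proof (cases "C \<in> ?F2")
              case True then show ?thesis using nbC by simp
            next
              case False
              then have "\<not> C \<subseteq> nbhd E S y" using that \<open>\<And>C. C \<in> \<C> \<Longrightarrow> card C = 2\<close> by blast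
              then have "nbhd E C y \<subset> C" using that k(2) by (auto simp: nbhd_def)
              then have "card (nbhd E C y) < 2" using psubset_card_mono[OF k(4)[OF that]] \<open>\<And>C. C \<in> \<C> \<Longrightarrow> card C = 2\<close>[OF that] by metis
              then show ?thesis using False by (simp add: binomial_eq_0)
            qed
            have "?s \<le> (\<Sum>C\<in>\<C>. if C \<in> ?F2 then 1 else 0)" by (rule sum_mono) (rule le)
            also have "\<dots> = card ?F2"
              using k(1) by (simp add: sum.If_cases Int_def conj_commute)
            finally show ?thesis using False f by (simp add: f_def)
          qed
        qed
      qed
    qed
    moreover have "real (nmis E S) \<le> conn_bound (card S) r" using ar(1) nmr by linarith
    ultimately show ?thesis by (intro conjI)
  qed
  then show "real (nmis E S) \<le> conn_bound (card S) r"
    and "3 * r \<le> card S \<Longrightarrow> real (nmis E S) = conn_bound (card S) r \<Longrightarrow> extremal S r" by blast+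
qed

end

section \<open>Connected graphs\<close>

context ugraph begin

definition path4 :: "'a set \<Rightarrow> bool" where
  "path4 S \<longleftrightarrow> (\<exists>a b c d. distinct [a, b, c, d] \<and> S = {a, b, c, d} \<and>
     nbhd E S a = {b} \<and> nbhd E S b = {a, c} \<and> nbhd E S c = {b, d} \<and> nbhd E S d = {c})"

definition cycle5 :: "'a set \<Rightarrow> bool" where
  "cycle5 S \<longleftrightarrow> (\<exists>a b c d e. distinct [a, b, c, d, e] \<and> S = {a, b, c, d, e} \<and>
     nbhd E S a = {e, b} \<and> nbhd E S b = {a, c} \<and> nbhd E S c = {b, d} \<and> nbhd E S d = {c, e} \<and> nbhd E S e = {d, a})"

section \<open>Small graphs and small values of \<open>conn_bound\<close>\<close>

lemma nmis_le1: "finite T \<Longrightarrow> card T \<le> 1 \<Longrightarrow> nmis E T = 1"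
proof -
  assume T: "finite T" "card T \<le> 1"
  then consider "T = {}" | v where "T = {v}" by (metis card_0_eq card_1_singletonE le_neq_implies_less less_one)
  then show "nmis E T = 1"
  proof cases
    case 2 then show ?thesis using nmis_clique[of T] by simp
  qed simp
qed

lemma nmis_le2: "finite T \<Longrightarrow> card T \<le> 2 \<Longrightarrow> nmis E T \<le> 2"
proof (cases "T = {}")
  case False
  assume T: "finite T" "card T \<le> 2"
  obtain v where v: "v \<in> T" using False by blast
  have "card (T - insert v (nbhd E T v)) \<le> card (T - {v})" by (rule card_mono) (use T in auto)
  moreover have "card (T - {v}) \<le> 1" using T v by simp
  ultimately show ?thesis
    using nmis_branch[OF T(1) v] nmis_le1[of "T - {v}"] nmis_le1[of "T - insert v (nbhd E T v)"] T by simp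
qed simp

lemma nmis_le3: assumes "finite T" "card T \<le> 3" shows "nmis E T \<le> 3"
proof (cases "\<exists>v\<in>T. nbhd E T v \<noteq> {}")
  case True
  then obtain v where v: "v \<in> T" "nbhd E T v \<noteq> {}" by blast
  have "finite (nbhd E T v)" using assms by (auto simp: nbhd_def)
  then have "1 \<le> card (nbhd E T v)" using v by (metis card_0_eq less_one not_le)
  then have "card (T - insert v (nbhd E T v)) \<le> 1" using card_closed_nb[OF assms(1) v(1)] assms(2) by simp
  moreover have "card (T - {v}) \<le> 2" using assms v by simp
  ultimately show ?thesis
    using nmis_branch[OF assms(1) v(1)] nmis_le2[of "T - {v}"] nmis_le1[of "T - insert v (nbhd E T v)"] assms(1) by simp
next
  case False
  show ?thesis
  proof (cases "T = {}")
    case nonempty: False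
    then obtain v where v: "v \<in> T" by blast
    have "nmis E ({v} \<union> (T - {v})) = nmis E {v} * nmis E (T - {v})"
      by (rule nmis_union) (use assms False v in \<open>auto simp: nbhd_def\<close>)
    then have "nmis E T = nmis E (T - {v})" using nmis_le1[of "{v}"] v by (simp add: insert_absorb)
    moreover have "nmis E (T - {v}) \<le> 2" by (rule nmis_le2) (use assms v in auto)
    ultimately show ?thesis by simp
  qed simp
qed

lemma conn2_clique:
  assumes "conn E T" "card T = 2" "u \<in> T" "v \<in> T" "u \<noteq> v" shows "E u v"
proof -
  have "T = {u, v}" using assms by (metis card_2_iff doubleton_eq_iff insert_iff singletonD)
  then show ?thesis using connD[OF assms(1), of "{u}"] assms by auto
qed

text \<open>The weight bound gives only 4, as \<open>8 / 9 * weight 4 2 = 4\<close>. The improvement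
  to 3 is made for \<open>(n, r) = (7, 2)\<close>, where 5 + 4 would meet the bound 9.\<close>

lemma nmis_four:
  assumes fin: "finite T" and n: "card T = 4" and nc: "ncyc E T \<le> 2" and ng: "\<not> small_cliques E T"
  shows "nmis E T \<le> 3"
proof (cases "conn E T")
  case True
  have "3 \<le> card T" using n by simp
  from fin True this show ?thesis
  proof (cases rule: conn_structure)
    case (deg3 v)
    then show ?thesis using deg3_bounds(1)[OF fin deg3 nc] by simp
  next
    case (reduce u)
    then show ?thesis using nmis_le3[of "T - {u}"] fin n by simp
  next
    case (chain x q1 q2 q3 q4 p)
    then show ?thesis using chain_bounds(8)[OF fin chain nc] n by simp
  next
    case (leaf l x)
    note b = leaf_bounds[OF fin True leaf(1-4,6)]
    show ?thesis using b(5) nmis_le2[of "T - {l, x}"] nmis_le1[of "T - insert x (nbhd E T x)"] b(1,2) fin n by simp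
  next
    case (pendants x \<T> H)
    obtain P where P: "P \<in> \<T>" using pendantsD(4)[OF pendants] by auto
    obtain q1 q2 where q: "nbhd E T q1 = {q2, x}" "nbhd E T q2 = {q1, x}" "distinct [x, q1, q2]" "{x, q1, q2} \<subseteq> T"
      and es: "E q1 q2" "E x q1" "E x q2" and c3: "card {x, q1, q2} = 3"
      by (rule pendants_pair[OF pendants P]) blast
    have qT: "q1 \<in> T" "q2 \<in> T" "x \<in> T" "q1 \<noteq> x" "q2 \<noteq> x" "q1 \<noteq> q2" using q by auto
    have "card (T - {x, q1, q2}) = 1" using card_Diff_subset[of "{x, q1, q2}" T] qT n c3 by simp
    then obtain h where h: "T - {x, q1, q2} = {h}" by (auto simp: card_1_singleton_iff)
    have hT: "h \<in> T" "h \<noteq> x" "h \<noteq> q1" "h \<noteq> q2" using h by auto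
    have "\<exists>a\<in>{h}. \<exists>b\<in>T - {h}. E a b" by (rule connD[OF True]) (use hT qT in auto)
    then obtain b where b: "b \<in> T" "b \<noteq> h" "E h b" by blast
    have "b \<noteq> q1" "b \<noteq> q2" using nbD[OF q(1) hT(1)] nbD[OF q(2) hT(1)] b sym hT by blast+
    then have hx: "E x h" using b h sym by blast
    have "q1 \<in> nbhd E T x" "q2 \<in> nbhd E T x" "h \<in> nbhd E T x" using es hx hT(1) qT(1,2) by (simp_all add: nbhd_def)
    moreover have "w \<in> {x, q1, q2, h}" if "w \<in> T" for w using h that by blast
    ultimately have "T - insert x (nbhd E T x) = {}" by auto
    then have "nmis E (T - insert x (nbhd E T x)) = 1" by (simp only: mis_empty) simp
    moreover have "nmis E (T - {x}) \<le> 2"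
    proof -
      have "nmis E ({h} \<union> {q1, q2}) = nmis E {h} * nmis E {q1, q2}"
        by (rule nmis_union) (use hT nbD[OF q(1) hT(1)] nbD[OF q(2) hT(1)] sym in auto)
      moreover have "T - {x} = {h} \<union> {q1, q2}" using h qT by auto
      ultimately show ?thesis using nmis_le1[of "{h}"] nmis_le2[of "{q1, q2}"] qT by simp
    qed
    ultimately show ?thesis using nmis_branch[OF fin qT(3)] by simp
  qed
next
  case False
  then obtain A where A: "A \<subseteq> T" "A \<noteq> {}" "A \<noteq> T" "\<And>a b. a \<in> A \<Longrightarrow> b \<in> T - A \<Longrightarrow> \<not> E a b"
    unfolding conn_def by blast
  let ?B = "T - A"
  have S: "A \<union> ?B = T" using A by auto
  have finA: "finite A" "finite ?B" using fin finite_subset[OF A(1)] by auto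
  have cS: "card A + card ?B = 4" using card_Un_disjoint[OF finA] S n by (metis Diff_disjoint)
  have "card A \<noteq> 0" "card ?B \<noteq> 0" using finA A by auto
  have nmT: "nmis E T = nmis E A * nmis E ?B" using nmis_union[OF finA] A(4) S by (metis Diff_disjoint)
  consider "card A = 1" "card ?B = 3" | "card A = 3" "card ?B = 1" | "card A = 2" "card ?B = 2"
    using cS \<open>card A \<noteq> 0\<close> \<open>card ?B \<noteq> 0\<close> by linarith
  then show ?thesis
  proof cases
    case 3
    have two: "nmis E X = 1" if X: "card X = 2" "\<not> small_cliques E X" for X
    proof -
      obtain u v where uv: "X = {u, v}" "u \<noteq> v" using X(1) by (metis card_2_iff)
      have "\<not> E u v" using small_cliques_clique[of X] X uv sym by auto
      then have "nmis E ({u} \<union> {v}) = nmis E {u} * nmis E {v}" by (intro nmis_union) (use uv in auto)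
      moreover have "X = {u} \<union> {v}" using uv by auto
      ultimately show ?thesis using nmis_le1[of "{u}"] nmis_le1[of "{v}"] by simp
    qed
    have "\<not> small_cliques E A \<or> \<not> small_cliques E ?B" using small_cliques_union[of A ?B] A(4) S ng by auto
    then show ?thesis using nmT two[of A] two[of ?B] 3 nmis_le2[OF finA(1)] nmis_le2[OF finA(2)] by auto
  qed (use nmT nmis_le1[OF finA(1)] nmis_le1[OF finA(2)] nmis_le3[OF finA(1)] nmis_le3[OF finA(2)] in auto)
qed

lemma small_cliques_extend_clique:
  assumes "small_cliques E A" "card C = 2 \<or> card C = 3" "\<And>u v. u \<in> C \<Longrightarrow> v \<in> C \<Longrightarrow> u \<noteq> v \<Longrightarrow> E u v"
    "A \<inter> C = {}" "\<And>a b. a \<in> C \<Longrightarrow> b \<in> A \<Longrightarrow> \<not> E a b" "T = A \<union> C"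
  shows "small_cliques E T"
  unfolding assms(6) by (rule small_cliques_union[OF assms(1) small_cliques_clique]) (use assms sym in blast)+

text \<open>Each further cycle multiplies the left side by 3 sqrt 2 / 4, which is less than
  2.\<close>

lemma weight_le_pow: "2 \<le> r \<Longrightarrow> weight 4 r \<le> 9 / 8 * 2 ^ r"
proof (induction r rule: dec_induct)
  case base
  show ?case by (simp add: weight_def power_mult_distrib power_divide sqrt2_pow)
next
  case (step k)
  have "weight 4 (Suc k) = weight 4 k * weight 0 1" using weight_add[of 4 0 k 1] by simp
  also have "\<dots> \<le> weight 4 k * 2" by (rule mult_left_mono) (use weight_pos[of 4 k] sqrt2_ub in \<open>auto simp: weight_consts\<close>)
  finally show ?case using step.IH by simp
qed

lemma four_le_pow: "2 \<le> r \<Longrightarrow> (4::real) \<le> 2 ^ r"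
  using power_increasing[of 2 r "2::real"] by simp

text \<open>The last two values serve the case \<open>(7, 2)\<close>: a count below 6 is at most 5,
  and 5 + 3 is below 9.\<close>

lemma conn_bound_small:
  "1 \<le> conn_bound 1 r" "2 \<le> conn_bound 3 0" "3 \<le> r \<or> r = 2 \<or> r = 1 \<Longrightarrow> 3 \<le> conn_bound 3 r" "3 \<le> conn_bound 4 r" "1 \<le> r \<Longrightarrow> 5 \<le> conn_bound 5 r"
  "conn_bound 5 2 < 6" "conn_bound 7 2 = 9"
proof -
  show "1 \<le> conn_bound 1 r"
  proof (cases "r = 0")
    case True then show ?thesis by (simp add: conn_bound_def weight_consts)
  next
    case False
    then have "weight 1 1 \<le> weight 1 r" by (intro weight_mono) auto
    moreover have "(2::real) \<le> 2 ^ r" using power_increasing[of 1 r "2::real"] False by simp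
    ultimately show ?thesis using False by (simp add: conn_bound_def weight_consts)
  qed
  show "2 \<le> conn_bound 3 0" by (simp add: conn_bound_def weight_consts)
  show "3 \<le> conn_bound 3 r" if "3 \<le> r \<or> r = 2 \<or> r = 1"
  proof (cases "r = 1")
    case True then show ?thesis by (simp add: conn_bound_def weight_consts)
  next
    case False
    then have "weight 3 2 \<le> weight 3 r" "(4::real) \<le> 2 ^ r" using that by (auto intro!: weight_mono four_le_pow)
    then show ?thesis using False that sqrt2_lb by (auto simp: conn_bound_def weight_consts)
  qed
  have w41: "weight 4 1 / sqrt 2 = 3" by (simp add: weight_consts)
  show "3 \<le> conn_bound 4 r"
  proof -
    consider "r = 0" | "r = 1" | "2 \<le> r" by linarith
    then show ?thesis
    proof cases
      case 3
      then have "weight 4 1 \<le> weight 4 r" "(4::real) \<le> 2 ^ r" by (auto intro!: weight_mono four_le_pow)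
      then show ?thesis using 3 sqrt2_lb by (simp add: conn_bound_def weight_consts)
    qed (use w41 in \<open>auto simp: conn_bound_def weight_consts\<close>)
  qed
  have w52: "weight 5 2 = 9 * sqrt 2 / 2" by (simp add: weight_consts)
  show "5 \<le> conn_bound 5 r" if "1 \<le> r"
  proof (cases "r = 1")
    case True then show ?thesis by (simp add: conn_bound_def weight_consts)
  next
    case False
    then have "weight 5 2 \<le> weight 5 r" "(4::real) \<le> 2 ^ r" using that by (auto intro!: weight_mono four_le_pow)
    then show ?thesis using False that sqrt2_lb w52 by (simp add: conn_bound_def)
  qed
  show "conn_bound 5 2 < 6" using sqrt2_ub by (simp add: conn_bound_def w52)
  have "weight 7 2 = weight 4 1 * weight 3 1" using weight_add[of 4 3 1 1] by (simp add: numeral_2_eq_2)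
  then show "conn_bound 7 2 = 9" by (simp add: conn_bound_def weight_consts)
qed

text \<open>Two-vertex graphs are excluded wherever this is proved, because
  \<open>conn_bound 2 0 = 11 / 6\<close> is below the count 2 of \<open>K_2\<close>.\<close>

definition conn_bounded :: "'a set \<Rightarrow> nat \<Rightarrow> bool" where
  "conn_bounded S r \<longleftrightarrow> real (nmis E S) \<le> conn_bound (card S) r \<and>
     (4 \<le> card S \<longrightarrow> real (nmis E S) < conn_bound (card S) r \<or> spider S \<or> path4 S \<or> cycle5 S)"

lemma nmis_W: "finite T \<Longrightarrow> ncyc E T \<le> s \<Longrightarrow> card T \<le> m \<Longrightarrow> real (nmis E T) \<le> weight m s"
  using weight_bounded[of T s] weight_mono[of "card T" m s s] by (simp add: weight_bounded_def)

lemma nmis_W_bad: "finite T \<Longrightarrow> ncyc E T \<le> s \<Longrightarrow> card T = m \<Longrightarrow> \<not> small_cliques E T \<Longrightarrow> real (nmis E T) \<le> 8 / 9 * weight m s"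
  using weight_bounded[of T s] by (simp add: weight_bounded_def)

lemma conn_bounded_small:
  assumes "finite S" "S \<noteq> {}" "card S \<le> 3" "card S \<noteq> 2" "ncyc E S \<le> r"
  shows "conn_bounded S r"
proof -
  have "card S \<noteq> 0" using assms by simp
  then consider "card S = 1" | "card S = 3" using assms by linarith
  then show ?thesis
  proof cases
    case 1
    then show ?thesis using nmis_le1[OF assms(1)] conn_bound_small(1) by (simp add: conn_bounded_def)
  next
    case 2
    have "real (nmis E S) \<le> conn_bound 3 r"
    proof (cases "r = 0")
      case True
      \<comment> \<open>With three vertices and no triangle, parity rules out a union of copies of
        \<open>K_2\<close>.\<close>
      have "\<not> small_cliques E S"
      proof
        assume "small_cliques E S"
        from small_cliques_bound[OF this assms(5)] show False using True 2 by auto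
      qed
      then have "real (nmis E S) \<le> 8 / 9 * weight 3 0" using nmis_W_bad assms 2 True by simp
      then have "real (nmis E S) < 3" using sqrt2_ub by (simp add: weight_consts)
      then have "nmis E S \<le> 2" by simp
      then show ?thesis using conn_bound_small(2) True by simp
    next
      case False
      then have "3 \<le> conn_bound 3 r" by (intro conn_bound_small(3)) linarith
      moreover have "nmis E S \<le> 3" by (rule nmis_le3) (use assms in auto)
      ultimately show ?thesis by linarith
    qed
    then show ?thesis using 2 by (simp add: conn_bounded_def)
  qed
qed

lemma leaf_deg:
  assumes "finite S" "l \<in> S" "x \<in> S" "l \<noteq> x" "nbhd E S l = {x}"
  shows "nbhd E S x = insert l (nbhd E (S - {l, x}) x)" "card (nbhd E S x) = Suc (card (nbhd E (S - {l, x}) x))"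
proof -
  have "E x l" using nbE[OF assms(5), of x] sym by blast
  then show *: "nbhd E S x = insert l (nbhd E (S - {l, x}) x)" using assms irr by (auto simp: nbhd_def)
  show "card (nbhd E S x) = Suc (card (nbhd E (S - {l, x}) x))"
    unfolding * by (rule card_insert_disjoint) (use assms in \<open>auto simp: nbhd_def\<close>)
qed

text \<open>For \<open>2 \<le> r\<close> four vertices lie below \<open>3 * r\<close>, where the
  factor 8/9 is enough. For \<open>r \<le> 1\<close> the structure lemma leaves only spiders,
  \<open>P_4\<close> and graphs with a count of at most 2.\<close>

lemma conn_bounded_four:
  assumes fin: "finite S" and con: "conn E S" and n: "card S = 4" and r: "ncyc E S \<le> r"
  shows "conn_bounded S r"
proof (cases "2 \<le> r")
  case True
  have "\<not> small_cliques E S" using small_cliques_conn[OF _ con] n by fastforce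
  then have "real (nmis E S) \<le> 8 / 9 * weight 4 r" using nmis_W_bad[OF fin r n] by blast
  also have "\<dots> < 17 / 25 * weight 4 r + 2 ^ r / 4"
    using weight_le_pow[OF True] zero_less_power[of "2::real" r] by linarith
  also have "\<dots> = conn_bound 4 r" using True by (simp add: conn_bound_def)
  finally show ?thesis using n by (simp add: conn_bounded_def)
next
  case False
  have sp: "conn_bounded S r" if "spider S"
    using spider_bound(1)[OF that con r] that by (simp add: conn_bounded_def)
  have lt: "conn_bounded S r" if "nmis E S \<le> 2" using that conn_bound_small(4)[of r] n by (simp add: conn_bounded_def)
  have "3 \<le> card S" using n by simp
  from fin con this show ?thesis
  proof (cases rule: conn_structure)
    case (deg3 v)
    then show ?thesis using deg3_bounds(1)[OF fin deg3 r] False by simp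
  next
    case (reduce u)
    show ?thesis
    proof (cases "small_cliques E (S - {u})")
      case True
      then show ?thesis using sp reduce by (auto simp: spider_def)
    next
      case ng: False
      have "ncyc E (S - {u}) \<le> 1" using ncyc_mono[OF fin, of "S - {u}"] r False by auto
      then have "real (nmis E (S - {u})) \<le> 8 / 9 * weight 3 1" using nmis_W_bad[of "S - {u}" 1 3] fin ng n reduce by simp
      then show ?thesis using lt reduce by (simp add: weight_consts)
    qed
  next
    case (chain x q1 q2 q3 q4 p)
    then show ?thesis using chain_bounds(8)[OF fin chain r] n by simp
  next
    case (leaf l x)
    note b = leaf_bounds[OF fin con leaf(1-4,6)]
    note d = leaf_deg[OF fin leaf(1-4)]
    let ?T = "S - {l, x}"
    have c2: "card ?T = 2" using b(1) n by simp
    obtain y where y: "y \<in> ?T" "E x y" using b(4) by blast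
    obtain z where z: "z \<noteq> y" "?T = {y, z}" using card2_other[OF c2 y(1)] by blast
    have yz: "E y z" by (rule conn2_clique[OF leaf(5) c2]) (use z in auto)
    have S: "S = {l, x, y, z}" "distinct [l, x, y, z]" using z leaf by auto
    have Exl: "E x l" using nbE[OF leaf(4), of x] sym by blast
    have nl: "\<not> E y l" "\<not> E z l" "\<not> E l y" "\<not> E l z"
      using nbD[OF leaf(4), of y] nbD[OF leaf(4), of z] S sym by auto
    show ?thesis
    proof (cases "E x z")
      case True
      have "small_cliques E (S - {l})"
        by (rule small_cliques_clique) (use S y z True yz sym in auto)
      then show ?thesis using sp leaf by (auto simp: spider_def)
    next
      case nxz: False
      then have nzx: "\<not> E z x" using sym by blast
      have "nbhd E S l = {x}" "nbhd E S x = {l, y}" "nbhd E S y = {x, z}" "nbhd E S z = {y}"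
        using S nxz nzx yz y(2) nl sym[OF yz] sym[OF y(2)] Exl leaf(4) irr by (auto simp: nbhd_def)
      then have "path4 S" unfolding path4_def using S by blast
      moreover have "nmis E S \<le> 3"
        using b(5) nmis_le2[of ?T] nmis_le1[of "S - insert x (nbhd E S x)"] b(2) c2 fin n by simp
      ultimately show ?thesis using conn_bound_small(4)[of r] n by (simp add: conn_bounded_def)
    qed
  next
    case (pendants x \<T> H)
    obtain P where P: "P \<in> \<T>" using pendantsD(4)[OF pendants] by auto
    obtain q1 q2 where q: "nbhd E S q1 = {q2, x}" "nbhd E S q2 = {q1, x}" "distinct [x, q1, q2]" "{x, q1, q2} \<subseteq> S"
      and es: "E q1 q2" "E x q1" "E x q2" and c3: "card {x, q1, q2} = 3"
      by (rule pendants_pair[OF pendants P]) blast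
    have qS: "q1 \<in> S" "q2 \<in> S" "x \<in> S" "q1 \<noteq> x" "q2 \<noteq> x" "q1 \<noteq> q2" using q by auto
    have "card (S - {x, q1, q2}) = 1" using card_Diff_subset[of "{x, q1, q2}" S] qS n c3 by simp
    then obtain h where h: "S - {x, q1, q2} = {h}" by (auto simp: card_1_singleton_iff)
    have Sh: "S - {h} = {x, q1, q2}" "h \<in> S" using h qS by auto
    have "small_cliques E (S - {h})" unfolding Sh
      by (rule small_cliques_clique) (use c3 es es[THEN sym] in auto)
    then have "spider S" unfolding spider_def using Sh(2) by blast
    then show ?thesis by (rule sp)
  qed
qed

text \<open>The branches known to be connected are bounded by induction, the others by their weight.
  Where the plain weight is too large, a union of small cliques in that branch would make
  \<open>S\<close> a spider; as this is excluded, the factor 8/9 is available.\<close>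

lemma conn_bounded_step:
  assumes IH: "\<And>T s. card T < card S \<Longrightarrow> finite T \<Longrightarrow> conn E T \<Longrightarrow> T \<noteq> {} \<Longrightarrow> card T \<noteq> 2 \<Longrightarrow> ncyc E T \<le> s \<Longrightarrow> conn_bounded T s"
    and fin: "finite S" and con: "conn E S" and n5: "5 \<le> card S" and r: "ncyc E S \<le> r"
  shows "conn_bounded S r"
proof (cases "spider S")
  case True
  then show ?thesis using spider_bound(1)[OF True con r] by (simp add: conn_bounded_def)
next
  case nsp: False
  have IHC: "real (nmis E T) \<le> conn_bound k s"
    if "card T = k" "k < card S" "T \<subseteq> S" "conn E T" "3 \<le> k \<or> k = 1" "ncyc E T \<le> s" for T k s
  proof -
    have "T \<noteq> {}" "card T \<noteq> 2" "finite T" using that fin finite_subset by auto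
    then show ?thesis using IH[of T s] that by (simp add: conn_bounded_def)
  qed
  have lt: "conn_bounded S r" if "real (nmis E S) < conn_bound (card S) r" using that by (simp add: conn_bounded_def)
  have sub: "ncyc E T \<le> r" if "T \<subseteq> S" for T using ncyc_mono[OF fin that] r by simp
  have "3 \<le> card S" using n5 by simp
  from fin con this show ?thesis
  proof (cases rule: conn_structure)
    case (deg3 v)
    note b = deg3_bounds[OF fin deg3 r]
    obtain m s where ms: "card S = m + 4" "r = s + 3" using b(1,5) by (metis le_add_diff_inverse2)
    have "real (nmis E (S - {v})) \<le> conn_bound (m + 3) s" by (rule IHC) (use b ms deg3 n5 in auto)
    moreover have "real (nmis E (S - insert v (nbhd E S v))) \<le> weight m s" by (rule nmis_W) (use b ms fin in auto)
    ultimately have "real (nmis E S) \<le> conn_bound (m + 3) s + weight m s" using nmis_branch[OF fin deg3(1)] by simp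
    also have "\<dots> < conn_bound (m + 4) (s + 3)" by (rule conn_bound_deg3) (use ms n5 in simp)
    finally show ?thesis using lt ms by simp
  next
    case (reduce u)
    obtain m where m: "card S = m + 1" using n5 by (metis Suc_eq_plus1 Suc_le_D numeral_eq_Suc)
    have "real (nmis E (S - {u})) \<le> conn_bound m r" by (rule IHC) (use m reduce fin n5 sub in auto)
    then have "real (nmis E S) \<le> conn_bound m r" using reduce by simp
    also have "\<dots> < conn_bound (m + 1) r" by (rule conn_bound_reduce) (use m n5 in simp)
    finally show ?thesis using lt m by simp
  next
    case (chain x q1 q2 q3 q4 p)
    note b = chain_bounds[OF fin chain r]
    note c = chain[unfolded chain_def]
    let ?T = "S - insert q1 (insert q4 (nbhd E S q1 \<union> nbhd E S q4))"
    obtain m s where ms: "card S = m + 5" "r = s + 1" using b(1,8) by (metis le_add_diff_inverse2)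
    show ?thesis
    proof (cases "m = 0")
      case False
      have "real (nmis E (S - {q1, q2, q3})) \<le> conn_bound (m + 2) s" by (rule IHC) (use b ms c False in auto)
      moreover have "real (nmis E (S - {q2, q3, q4})) \<le> conn_bound (m + 2) s" by (rule IHC) (use b ms c False in auto)
      moreover have "real (nmis E ?T) \<le> weight m s" by (rule nmis_W[OF _ _ _]) (use b(4,7) ms fin in auto)
      ultimately have "real (nmis E S) \<le> 2 * conn_bound (m + 2) s + weight m s" using b(9) by simp
      also have "\<dots> < conn_bound (m + 5) (s + 1)" by (rule conn_bound_chain) (use False in simp)
      finally show ?thesis using lt ms by simp
    next
      \<comment> \<open>Only \<open>x\<close> and the four \<open>q\<close>'s remain, so
        \<open>p = x\<close> and the graph is a 5-cycle.\<close>
      case True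
      have sS: "{x, q1, q2, q3, q4} \<subseteq> S" "card {x, q1, q2, q3, q4} = 5" using c by auto
      then have S: "S = {x, q1, q2, q3, q4}" using card_subset_eq[OF fin sS(1)] ms True by simp
      then have px: "p = x" using c by auto
      have e: "E x q1" "E x q4" "\<not> E x q2" "\<not> E x q3"
        using nbE[of S q1 "{x, q2}" x] nbE[of S q4 "{q3, p}" p] nbD[of S q2 "{q1, q3}" x] nbD[of S q3 "{q2, q4}" x] c px sym by auto
      then have "nbhd E S x = {q4, q1}" unfolding nbhd_def S using irr by auto
      moreover have "nbhd E S q1 = {x, q2}" "nbhd E S q2 = {q1, q3}" "nbhd E S q3 = {q2, q4}" "nbhd E S q4 = {q3, x}"
        "distinct [x, q1, q2, q3, q4]" using c px by simp_all
      ultimately have "cycle5 S" unfolding cycle5_def using S by blast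
      moreover have "nmis E S \<le> 5"
      proof -
        have "nmis E (S - {q1, q2, q3}) \<le> 2" "nmis E (S - {q2, q3, q4}) \<le> 2"
          by (rule nmis_le2; use b(5,6) fin ms True in simp)+
        moreover have "card ?T \<le> 1" using b(7) ms(1) True by linarith
        then have "nmis E ?T = 1" using nmis_le1[of ?T] fin by blast
        ultimately show ?thesis using b(9) by linarith
      qed
      ultimately show ?thesis using conn_bound_small(5)[OF b(1)] ms True by (simp add: conn_bounded_def)
    qed
  next
    case (leaf l x)
    note b = leaf_bounds[OF fin con leaf(1-4,6)]
    note d = leaf_deg[OF fin leaf(1-4)]
    let ?T = "S - {l, x}"
    obtain y where y: "y \<in> ?T" "E x y" using b(4) by blast
    have fT: "finite ?T" using fin by simp
    have fnb: "finite (nbhd E ?T x)" using fin by (auto simp: nbhd_def)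
    show ?thesis
    proof (cases "card (nbhd E ?T x) = 1")
      case True
      have "y \<in> nbhd E ?T x" using y by (simp add: nbhd_def)
      then have nT: "nbhd E ?T x = {y}" using card_1_singletonE[OF True] by (metis singletonD)
      then have nx: "nbhd E S x = {l, y}" using d(1) by simp
      have far: "S - insert x (nbhd E S x) = ?T - {y}" using nx by auto
      have Exl: "E x l" using nbE[OF leaf(4), of x] sym by blast
      \<comment> \<open>Otherwise \<open>{l, x}\<close> would complete the parts of
        \<open>?T - {y}\<close> to those of \<open>S - {y}\<close>, and \<open>S\<close> would be a
        spider.\<close>
      have ng: "\<not> small_cliques E (?T - {y})"
      proof
        assume g: "small_cliques E (?T - {y})"
        have "small_cliques E (S - {y})"
        proof (rule small_cliques_extend_clique[OF g])
          show "S - {y} = ?T - {y} \<union> {l, x}" using leaf(1,2) y(1) by blast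
          show "\<not> E a b'" if "a \<in> {l, x}" "b' \<in> ?T - {y}" for a b'
            using nbD[OF leaf(4), of b'] nbD[OF nx, of b'] that by blast
        qed (use leaf Exl sym[OF Exl] in auto)
        then show False using nsp y by (auto simp: spider_def)
      qed
      obtain m where m: "card S = m + 3" using b(3) by (metis le_add_diff_inverse2)
      have cT: "card ?T = m + 1" "card (?T - {y}) = m" using b(1) m y by simp_all
      have T1: "real (nmis E ?T) \<le> conn_bound (m + 1) r" by (rule IHC) (use cT m n5 leaf sub in auto)
      have T2: "real (nmis E (?T - {y})) \<le> 8 / 9 * weight m r" 
        by (rule nmis_W_bad[OF _ _ cT(2) ng]) (use fin in simp, rule sub, blast)
      have main: "real (nmis E S) \<le> real (nmis E ?T) + real (nmis E (?T - {y}))" using b(5) far by simp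
      show ?thesis
      proof (cases "m = 4 \<and> r = 2")
        case False
        have "real (nmis E S) \<le> conn_bound (m + 1) r + 8 / 9 * weight m r" using main T1 T2 by linarith
        also have "\<dots> < conn_bound (m + 3) r" by (rule conn_bound_leaf1) (use False m n5 in auto)
        finally show ?thesis using lt m by simp
      next
        \<comment> \<open>The real estimates exceed the bound 9 here. Rounding the first summand
          down to 5 and using \<open>nmis_four\<close> for the second gives 8.\<close>
        case True
        have "nmis E (?T - {y}) \<le> 3" by (rule nmis_four) (use fin cT True sub[of "?T - {y}"] ng in auto)
        moreover have "real (nmis E ?T) < 6" using T1 conn_bound_small(6) True by simp
        then have "nmis E ?T \<le> 5" by simp
        ultimately have "nmis E S \<le> 8" using b(5) far by simp
        then show ?thesis using lt conn_bound_small(7) m True by simp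
      qed
    next
      case False
      have "1 \<le> card (nbhd E ?T x)" using y fnb by (metis (mono_tags, lifting) card_0_eq empty_iff less_one mem_Collect_eq nbhd_def not_le)
      then have d2: "2 \<le> card (nbhd E ?T x)" using False by linarith
      \<comment> \<open>Two neighbours of \<open>x\<close> in the connected set \<open>?T\<close>
        close a further cycle.\<close>
      have "ncyc E (\<Union>{?T}) + (\<Sum>C\<in>{?T}. card (nbhd E C x) choose 2) \<le> ncyc E (insert x (\<Union>{?T}))"
        by (rule ncyc_family) (use fin leaf in auto)
      moreover have "ncyc E (insert x ?T) \<le> ncyc E S" by (rule ncyc_mono[OF fin]) (use leaf in auto)
      ultimately have cyc: "ncyc E ?T + 1 \<le> r" using choose2_ge1[OF d2] r by simp
      have c4: "card (S - insert x (nbhd E S x)) \<le> card S - 4" "4 \<le> card S"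
        using card_closed_nb[OF fin leaf(2)] d(2) d2 by auto
      obtain m s where ms: "card S = m + 4" "r = s + 1" using c4(2) cyc by (metis add.commute le_Suc_ex le_add_diff_inverse2 plus_1_eq_Suc add_leD2)
      have "S - insert x (nbhd E S x) \<subseteq> ?T" using d(1) by auto
      then have "ncyc E (S - insert x (nbhd E S x)) \<le> ncyc E ?T" by (rule ncyc_mono[OF fT])
      then have "real (nmis E (S - insert x (nbhd E S x))) \<le> weight m s" by (intro nmis_W) (use fin cyc ms c4 in auto)
      moreover have "real (nmis E ?T) \<le> conn_bound (m + 2) s" by (rule IHC) (use b ms n5 leaf cyc in auto)
      ultimately have "real (nmis E S) \<le> conn_bound (m + 2) s + weight m s" using b(5) by simp
      also have "\<dots> < conn_bound (m + 4) (s + 1)" by (rule conn_bound_leaf2) (use ms n5 in simp)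
      finally show ?thesis using lt ms by simp
    qed
  next
    case (pendants x \<T> H)
    note p = pendantsD[OF pendants]
    have xS: "x \<in> S" using p(2) by blast
    have Tsh: "card T = 2" "T \<subseteq> nbhd E S x" "T \<subseteq> S" "\<And>u v. u \<in> T \<Longrightarrow> v \<in> T \<Longrightarrow> u \<noteq> v \<Longrightarrow> E u v"
       "\<And>u v. u \<in> T \<Longrightarrow> v \<in> S \<Longrightarrow> E u v \<Longrightarrow> v \<in> T \<or> v = x" if T: "T \<in> \<T>" for T
    proof -
      obtain q1 q2 where q: "q1 \<noteq> q2" "T = {q1, q2}" "nbhd E S q1 = {q2, x}" "nbhd E S q2 = {q1, x}"
        using bspec[OF p(8) T] by auto
      show "card T = 2" "T \<subseteq> S" using q p(2) T by auto
      then show "T \<subseteq> nbhd E S x" using nbE[OF q(3), of x] nbE[OF q(4), of x] sym q by (auto simp: nbhd_def)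
      show "\<And>u v. u \<in> T \<Longrightarrow> v \<in> T \<Longrightarrow> u \<noteq> v \<Longrightarrow> E u v" using nbE[OF q(3), of q2] nbE[OF q(4), of q1] q(2) by auto
      show "\<And>u v. u \<in> T \<Longrightarrow> v \<in> S \<Longrightarrow> E u v \<Longrightarrow> v \<in> T \<or> v = x"
        using nbD[OF q(3)] nbD[OF q(4)] q(2) by blast
    qed
    have xnot: "x \<notin> \<Union>\<T>" "x \<notin> H" using p(1) by auto
    have HS: "H \<subseteq> S" using p(2) by auto
    have fH: "finite H" using fin HS finite_subset by blast
    have noTH: "\<not> E u v" if uv: "u \<in> \<Union>\<T>" "v \<in> H" for u v
    proof
      assume E: "E u v"
      obtain T where T: "T \<in> \<T>" "u \<in> T" using uv(1) by blast
      then show False using Tsh(5)[OF T(1,2) _ E] HS uv(2) p(5) xnot by blast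
    qed
    have clqT: "cliques E \<T> (\<Union>\<T>)"
      unfolding cliques_def
    proof (intro conjI ballI impI)
      show "\<not> E u v" if "C \<in> \<T>" "D \<in> \<T>" "C \<noteq> D" "u \<in> C" "v \<in> D" for C D u v
        using Tsh(3)[OF that(2)] Tsh(5)[OF that(1,4), of v] that p(7) xnot by blast
    qed (use p Tsh in auto)
    then have goodT: "small_cliques E (\<Union>\<T>)" by (auto simp: small_cliques_def)
    have Sx: "S - {x} = \<Union>\<T> \<union> H" using p(2) xnot by auto
    \<comment> \<open>Deleting \<open>x\<close> leaves \<open>H\<close> and one edge of each
      triangle. If \<open>H\<close> were a union of small cliques, \<open>S\<close> would be a
      spider. In particular \<open>H\<close> is neither empty nor a \<open>K_2\<close>, as the
      induction requires.\<close>
    have ngH: "\<not> small_cliques E H"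
    proof
      assume "small_cliques E H"
      then have "small_cliques E (\<Union>\<T> \<union> H)" by (intro small_cliques_union[OF goodT]) (use p(5) noTH in auto)
      then show False using nsp xS Sx by (auto simp: spider_def)
    qed
    then have Hne: "H \<noteq> {}" using small_cliques_empty by auto
    have H2: "card H \<noteq> 2"
    proof
      assume h: "card H = 2"
      have "small_cliques E H" by (rule small_cliques_clique) (use h conn2_clique[OF p(6) h] in auto)
      then show False using ngH by simp
    qed
    define b where "b = card \<T>"
    have b1: "1 \<le> b" using p(3,4) unfolding b_def by (metis card_0_eq less_one not_le)
    have filt: "{C \<in> \<T>. card C = 2} = \<T>" "{C \<in> \<T>. card C = 3} = {}" using Tsh(1) by auto
    have nmT: "nmis E (\<Union>\<T>) = 2 ^ b" "card (\<Union>\<T>) = 2 * b" "finite (\<Union>\<T>)"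
      using cliques_counts[OF clqT] filt by (simp_all add: b_def)
    have nmSx: "nmis E (S - {x}) = 2 ^ b * nmis E H"
      unfolding Sx using nmis_union[OF nmT(3) fH p(5)] noTH nmT(1) by simp
    define h where "h = card H"
    have cS: "card S = h + 1 + 2 * b"
      using card.remove[OF fin xS] Sx card_Un_disjoint[OF nmT(3) fH p(5)] nmT(2) by (simp add: h_def)
    have "h \<noteq> 0" "h \<noteq> 2" using Hne H2 fH by (simp_all add: h_def)
    then have h1: "h = 1 \<or> 3 \<le> h" by linarith
    have farH: "S - insert x (nbhd E S x) = H - nbhd E H x"
      using p(1,2) Tsh(2) HS by (auto simp: nbhd_def)
    have main: "real (nmis E S) \<le> 2 ^ b * real (nmis E H) + real (nmis E (H - nbhd E H x))"
    proof -
      have "nmis E S \<le> 2 ^ b * nmis E H + nmis E (H - nbhd E H x)" using nmis_branch[OF fin xS] nmSx farH by simp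
      then have "real (nmis E S) \<le> real (2 ^ b * nmis E H + nmis E (H - nbhd E H x))" by (simp only: of_nat_le_iff)
      then show ?thesis by simp
    qed
    have "\<exists>a\<in>H. \<exists>c\<in>S - H. E a c" by (rule connD[OF con]) (use HS Hne xS xnot in auto)
    then obtain y c where yc: "y \<in> H" "c \<in> S - H" "E y c" by blast
    have "c = x" using yc noTH[of c y] sym p(2) by auto
    then have y: "y \<in> nbhd E H x" using yc sym by (auto simp: nbhd_def)
    define d where "d = card (nbhd E H x)"
    have fnb: "finite (nbhd E H x)" using fH by (auto simp: nbhd_def)
    have d1: "1 \<le> d" using y fnb unfolding d_def by (metis card_0_eq empty_iff less_one not_le)
    have cfar: "card (H - nbhd E H x) = h - d" unfolding h_def d_def
      by (rule card_Diff_subset[OF fnb]) (auto simp: nbhd_def)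
    \<comment> \<open>By \<open>ncyc_family\<close>, each triangle accounts for one cycle through
      \<open>x\<close>, and \<open>H\<close> for one cycle per pair of neighbours of
      \<open>x\<close> in it.\<close>
    have cyc: "ncyc E H + b + (d choose 2) \<le> r"
    proof -
      have HT: "H \<notin> \<T>" using H2 Tsh(1) by auto
      have "ncyc E (\<Union>(insert H \<T>)) + (\<Sum>C\<in>insert H \<T>. card (nbhd E C x) choose 2) \<le> ncyc E (insert x (\<Union>(insert H \<T>)))"
      proof (rule ncyc_family)
        show "C \<inter> D = {}" if "C \<in> insert H \<T>" "D \<in> insert H \<T>" "C \<noteq> D" for C D
          using that p(5,7) by blast
        show "conn E C" if "C \<in> insert H \<T>" for C
        proof (cases "C = H")
          case False
          then have "C \<in> \<T>" using that by simp
          then show ?thesis by (intro conn_clique) (use Tsh(4) in blast)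
        qed (use p(6) in simp)
        show "finite C" if "C \<in> insert H \<T>" for C using that fH nmT(3) finite_subset[of C "\<Union>\<T>"] by blast
      qed (use p xnot in auto)
      moreover have "insert x (\<Union>(insert H \<T>)) = S" using p(2) by auto
      moreover have "ncyc E H \<le> ncyc E (\<Union>(insert H \<T>))" by (rule ncyc_mono) (use fH nmT(3) in auto)
      moreover have "(\<Sum>C\<in>\<T>. card (nbhd E C x) choose 2) = b"
      proof -
        have "card (nbhd E C x) choose 2 = 1" if "C \<in> \<T>" for C
        proof -
          have "nbhd E C x = C" using Tsh(2)[OF that] by (auto simp: nbhd_def)
          then show ?thesis using Tsh(1)[OF that] by simp
        qed
        then show ?thesis by (simp add: b_def)
      qed
      ultimately show ?thesis using HT p(3) r by (simp add: d_def)
    qed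
    have ncfar: "ncyc E (H - nbhd E H x) \<le> ncyc E H" by (rule ncyc_mono) (use fH in auto)
    have ffar: "finite (H - nbhd E H x)" using fH by simp
    have hlt: "h < card S" using cS by simp
    \<comment> \<open>With several triangles, or with two edges from \<open>x\<close> into
      \<open>H\<close>, the plain weight of the far graph is small enough. One triangle and a single
      edge into \<open>H\<close> need the factor 8/9.\<close>
    have "2 \<le> b \<or> b = 1 \<and> d = 1 \<or> b = 1 \<and> 2 \<le> d" using b1 d1 by linarith
    then show ?thesis
    proof (elim disjE conjE)
      assume b2: "2 \<le> b"
      define m where "m = h - 1"
      define s where "s = r - b"
      have hm: "h = m + 1" "card S = m + 2 + 2 * b" "r = s + b" using h1 cS cyc by (auto simp: m_def s_def)
      have "real (nmis E H) \<le> conn_bound (m + 1) s" by (rule IHC) (use hm hlt h1 p(6) HS cyc h_def in auto)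
      then have "2 ^ b * real (nmis E H) \<le> 2 ^ b * conn_bound (m + 1) s" by simp
      moreover have "real (nmis E (H - nbhd E H x)) \<le> weight m s" by (rule nmis_W[OF ffar]) (use cfar d1 hm ncfar cyc in auto)
      ultimately have "real (nmis E S) \<le> 2 ^ b * conn_bound (m + 1) s + weight m s" using main by linarith
      also have "\<dots> < conn_bound (m + 2 + 2 * b) (s + b)" by (rule conn_bound_multi[OF b2])
      finally show ?thesis using lt hm by simp
    next
      assume bd: "b = 1" "d = 1"
      have h3: "3 \<le> h" using h1 cS n5 bd by auto
      have ny: "nbhd E H x = {y}" using card_1_singletonE[OF bd(2)[unfolded d_def]] y by (metis singletonD)
      obtain T where T: "\<T> = {T}" using bd(1) unfolding b_def by (auto simp: card_1_singleton_iff)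
      have TT: "T \<in> \<T>" using T by simp
      \<comment> \<open>If \<open>H - {y}\<close> were a union of small cliques, the triangle on
        \<open>insert x T\<close> would extend it to one on \<open>S - {y}\<close>.\<close>
      have ng: "\<not> small_cliques E (H - {y})"
      proof
        assume g: "small_cliques E (H - {y})"
        have xT: "x \<notin> T" using xnot T by simp
        have "small_cliques E (S - {y})"
        proof (rule small_cliques_extend_clique[OF g])
          show "card (insert x T) = 2 \<or> card (insert x T) = 3" using Tsh(1)[OF TT] xT
            by (metis card.infinite card_insert_disjoint numeral_2_eq_2 numeral_3_eq_3 zero_neq_numeral)
          show "E u v" if "u \<in> insert x T" "v \<in> insert x T" "u \<noteq> v" for u v
          proof -
            have "E x w" if "w \<in> T" for w using Tsh(2)[OF TT] that by (auto simp: nbhd_def)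
            then show ?thesis using that Tsh(4)[OF TT, of u v] sym by blast
          qed
          show "(H - {y}) \<inter> insert x T = {}" using xnot p(5) T by auto
          show "S - {y} = H - {y} \<union> insert x T" using p(2,5) T yc(1) xnot by auto
          show "\<not> E a b'" if "a \<in> insert x T" "b' \<in> H - {y}" for a b'
            using that ny noTH[of a b'] T by (auto simp: nbhd_def)
        qed
        then show False using nsp yc(1) HS by (auto simp: spider_def)
      qed
      define m where "m = h - 1"
      define s where "s = r - 1"
      have hm: "h = m + 1" "card S = m + 4" "r = s + 1" using h3 cS cyc bd by (auto simp: m_def s_def)
      have "real (nmis E H) \<le> conn_bound (m + 1) s" by (rule IHC) (use hm hlt h1 p(6) HS cyc h_def bd in auto)
      moreover have "real (nmis E (H - nbhd E H x)) \<le> 8 / 9 * weight m s"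
        by (rule nmis_W_bad[OF ffar]) (use cfar hm ncfar cyc bd ng ny in auto)
      ultimately have "real (nmis E S) \<le> 2 * conn_bound (m + 1) s + 8 / 9 * weight m s" using main bd by simp
      also have "\<dots> < conn_bound (m + 4) (s + 1)" by (rule conn_bound_tri1) (use hm h3 in simp)
      finally show ?thesis using lt hm by simp
    next
      assume bd: "b = 1" "2 \<le> d"
      have h3: "3 \<le> h" using h1 cS n5 bd by auto
      have c2: "1 \<le> d choose 2" by (rule choose2_ge1[OF bd(2)])
      define m where "m = h - 2"
      define s where "s = r - 2"
      have hm: "h = m + 2" "card S = m + 5" "r = s + 2" using h3 cS cyc bd c2 by (auto simp: m_def s_def)
      have "real (nmis E H) \<le> conn_bound (m + 2) s" by (rule IHC) (use hm hlt h1 p(6) HS cyc c2 h_def bd in auto)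
      moreover have "real (nmis E (H - nbhd E H x)) \<le> weight m s"
        by (rule nmis_W[OF ffar]) (use cfar hm ncfar cyc bd c2 in auto)
      ultimately have "real (nmis E S) \<le> 2 * conn_bound (m + 2) s + weight m s" using main bd by simp
      also have "\<dots> < conn_bound (m + 5) (s + 2)" by (rule conn_bound_tri2) (use hm h3 in simp)
      finally show ?thesis using lt hm by simp
    qed
  qed
qed

theorem conn_bounded: "finite S \<Longrightarrow> conn E S \<Longrightarrow> S \<noteq> {} \<Longrightarrow> card S \<noteq> 2 \<Longrightarrow> ncyc E S \<le> r \<Longrightarrow> conn_bounded S r"
proof (induction "card S" arbitrary: S r rule: less_induct)
  case less
  consider "card S \<le> 3" | "card S = 4" | "5 \<le> card S" by linarith
  then show ?case
  proof cases
    case 1 then show ?thesis using conn_bounded_small less.prems by blast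
  next
    case 2 then show ?thesis using conn_bounded_four less.prems by blast
  next
    case 3 show ?thesis by (rule conn_bounded_step[OF less.hyps less.prems(1,2) 3 less.prems(5)])
  qed
qed

end

section \<open>Isomorphisms\<close>

definition adj :: "'a sgraph \<Rightarrow> 'a \<Rightarrow> 'a \<Rightarrow> bool" where
  "adj G u v \<longleftrightarrow> {u, v} \<in> edges G"

lemma ugraph_adj: "(\<And>v. {v} \<notin> edges G) \<Longrightarrow> ugraph (adj G)"
  by unfold_locales (auto simp: adj_def insert_commute)

lemma simple_no_loop: "finite_simple_graph G \<Longrightarrow> {v} \<notin> edges G"
  by (auto simp: finite_simple_graph_def)

text \<open>For an independent set, maximality under inclusion amounts to domination of all other
  vertices.\<close>

lemma num_mis_eq:
  assumes "\<And>v. {v} \<notin> edges G"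
  shows "num_mis G = nmis (adj G) (verts G)"
proof -
  have "maximal_independent_set G I \<longleftrightarrow> I \<in> mis (adj G) (verts G)" for I
  proof
    assume m: "maximal_independent_set G I"
    then have ind: "I \<subseteq> verts G" "\<forall>u\<in>I. \<forall>v\<in>I. {u, v} \<notin> edges G"
      by (auto simp: maximal_independent_set_def independent_set_def)
    have "\<exists>u\<in>I. {v, u} \<in> edges G" if v: "v \<in> verts G - I" for v
    proof (rule ccontr)
      assume n: "\<not> ?thesis"
      then have "\<forall>u\<in>I. {u, v} \<notin> edges G" by (simp add: insert_commute)
      then have "independent_set G (insert v I)"
        using n v ind assms[of v] by (auto simp: independent_set_def)
      moreover have "I \<subset> insert v I" using v by blast
      ultimately show False using m by (auto simp: maximal_independent_set_def)
    qed
    then show "I \<in> mis (adj G) (verts G)" using ind by (auto simp: mis_def adj_def)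
  next
    assume m: "I \<in> mis (adj G) (verts G)"
    then have "independent_set G I" by (auto simp: mis_def adj_def independent_set_def)
    moreover have "\<not> I \<subset> J" if J: "independent_set G J" for J
    proof
      assume "I \<subset> J"
      then obtain v where v: "v \<in> J" "v \<notin> I" by blast
      then have "v \<in> verts G - I" using J by (auto simp: independent_set_def)
      then obtain u where "u \<in> I" "{v, u} \<in> edges G" using m unfolding mis_def adj_def by blast
      then show False using J v \<open>I \<subset> J\<close> by (auto simp: independent_set_def)
    qed
    ultimately show "maximal_independent_set G I" by (auto simp: maximal_independent_set_def)
  qed
  then show ?thesis by (simp add: num_mis_def)
qed

lemma connected_conn:
  assumes "\<And>v. {v} \<notin> edges G" "connected_graph G" shows "conn (adj G) (verts G)"
proof -
  interpret ugraph "adj G" by (rule ugraph_adj) (rule assms)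
  have "adj_rel G = {(a, b). a \<in> verts G \<and> b \<in> verts G \<and> adj G a b}" by (auto simp: adj_rel_def adj_def)
  then show ?thesis
    using assms(2) by (intro reach_conn) (auto simp: reach_def connected_graph_def)
qed

text \<open>A vertex list labels each vertex by its position; in this way cycles,
  \<open>path_graph 4\<close> and \<open>cycle_graph 5\<close> are recognised.\<close>

lemma iso_list:
  assumes "distinct xs" "verts G = set xs" "verts H = {..<length xs}"
    and "\<And>i j. i < length xs \<Longrightarrow> j < length xs \<Longrightarrow> {xs ! i, xs ! j} \<in> edges G \<longleftrightarrow> {i, j} \<in> edges H"
  shows "G \<cong>\<^sub>G H"
proof -
  let ?f = "the_inv_into {..<length xs} (\<lambda>i. xs ! i)"
  have b: "bij_betw (\<lambda>i. xs ! i) {..<length xs} (set xs)" by (rule bij_betw_nth[OF assms(1)]) auto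
  have inj: "inj_on (\<lambda>i. xs ! i) {..<length xs}" using b by (rule bij_betw_imp_inj_on)
  have "bij_betw ?f (verts G) (verts H)"
    unfolding assms(2,3) by (rule bij_betw_the_inv_into[OF b])
  moreover have "{u, v} \<in> edges G \<longleftrightarrow> {?f u, ?f v} \<in> edges H" if uv: "u \<in> verts G" "v \<in> verts G" for u v
  proof -
    obtain i j where ij: "i < length xs" "u = xs ! i" "j < length xs" "v = xs ! j"
      using uv unfolding assms(2) by (metis in_set_conv_nth)
    then have "?f u = i" "?f v = j" by (auto intro: the_inv_into_f_f[OF inj])
    then show ?thesis using assms(4) ij by simp
  qed
  ultimately show ?thesis unfolding graph_iso_def by blast
qed

text \<open>The edge set \<open>F\<close> of a cycle gives the subgraph on \<open>\<Union>F\<close>,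
  so \<open>cycs\<close> injects into the counted subgraphs. The inequality transfers the hypothesis
  \<open>num_cycles G \<le> r\<close>.\<close>

lemma ncyc_le_num_cycles:
  assumes "finite_simple_graph G" shows "ncyc (adj G) (verts G) \<le> num_cycles G"
proof -
  interpret ugraph "adj G" by (rule ugraph_adj) (rule simple_no_loop[OF assms])
  let ?C = "{H. subgraph H G \<and> (\<exists>k\<ge>3. H \<cong>\<^sub>G cycle_graph k)}"
  let ?f = "\<lambda>F. \<lparr>verts = \<Union>F, edges = F\<rparr>"
  have V: "finite (verts G)" "edges G \<subseteq> Pow (verts G)" using assms by (auto simp: finite_simple_graph_def)
  \<comment> \<open>Finiteness matters here because \<open>card\<close> of an infinite set is
    0.\<close>
  have "?C \<subseteq> (\<lambda>(a, b). \<lparr>verts = a, edges = b\<rparr>) ` (Pow (verts G) \<times> Pow (Pow (verts G)))"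
  proof
    fix H assume "H \<in> ?C"
    then have "verts H \<subseteq> verts G" "edges H \<subseteq> Pow (verts G)"
      using V by (auto simp: subgraph_def)
    moreover have "H = (\<lambda>(a, b). \<lparr>verts = a, edges = b\<rparr>) (verts H, edges H)" by simp
    ultimately show "H \<in> (\<lambda>(a, b). \<lparr>verts = a, edges = b\<rparr>) ` (Pow (verts G) \<times> Pow (Pow (verts G)))"
      by (metis (mono_tags, lifting) PowI SigmaI image_eqI)
  qed
  then have fin: "finite ?C" by (rule finite_subset) (use V in auto)
  show ?thesis
    unfolding num_cycles_def
  proof (rule card_inj_on_le[of ?f])
    show "inj_on ?f (cycs (adj G) (verts G))" by (rule inj_onI) simp
    show "?f ` cycs (adj G) (verts G) \<subseteq> ?C"
    proof
      fix H assume "H \<in> ?f ` cycs (adj G) (verts G)"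
      then obtain F where F: "F \<in> cycs (adj G) (verts G)" "H = ?f F" by blast
      then obtain xs where xs: "3 \<le> length xs" "distinct xs" "set xs \<subseteq> verts G"
         "\<forall>i<length xs. adj G (xs ! i) (xs ! (Suc i mod length xs))"
         "F = {{xs ! i, xs ! (Suc i mod length xs)} |i. i < length xs}" unfolding cycs_def by auto
      have m: "Suc i mod length xs < length xs" for i using xs(1) by (intro mod_less_divisor) auto
      have U: "\<Union>F = set xs"
      proof
        show "\<Union>F \<subseteq> set xs" unfolding xs(5) using m by (auto intro: nth_mem)
        show "set xs \<subseteq> \<Union>F"
        proof
          fix u assume "u \<in> set xs"
          then obtain i where i: "i < length xs" "u = xs ! i" by (metis in_set_conv_nth)
          then have "{xs ! i, xs ! (Suc i mod length xs)} \<in> F" unfolding xs(5) by blast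
          then show "u \<in> \<Union>F" using i(2) by blast
        qed
      qed
      have ne: "xs ! i \<noteq> xs ! (Suc i mod length xs)" if "i < length xs" for i
        using xs(4) that irr by metis
      have "subgraph H G"
        unfolding subgraph_def finite_simple_graph_def F(2) using U xs(3,4) ne m
        by (auto simp: xs(5) adj_def card_insert_if)
      moreover have "H \<cong>\<^sub>G cycle_graph (length xs)"
      proof (rule iso_list[OF xs(2)])
        show "verts H = set xs" using F U by simp
        show "verts (cycle_graph (length xs)) = {..<length xs}" by (simp add: cycle_graph_def)
        fix i j assume ij: "i < length xs" "j < length xs"
        have nq: "xs ! i = xs ! l \<longleftrightarrow> i = l" "xs ! j = xs ! l \<longleftrightarrow> j = l" if "l < length xs" for l
          using nth_eq_iff_index_eq[OF xs(2)] ij that by auto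
        have "{xs ! i, xs ! j} = {xs ! l, xs ! (Suc l mod length xs)} \<longleftrightarrow> {i, j} = {l, Suc l mod length xs}"
          if "l < length xs" for l using nq[OF that] nq[OF m[of l]] by (auto simp: doubleton_eq_iff)
        then show "{xs ! i, xs ! j} \<in> edges H \<longleftrightarrow> {i, j} \<in> edges (cycle_graph (length xs))"
          unfolding F(2) cycle_graph_def by (auto simp: xs(5))
      qed
      ultimately show "H \<in> ?C" using xs(1) by blast
    qed
  qed (rule fin)
qed

lemma nmis_iso:
  assumes b: "bij_betw f A B" and e: "\<And>u v. u \<in> A \<Longrightarrow> v \<in> A \<Longrightarrow> E u v \<longleftrightarrow> E' (f u) (f v)"
  shows "nmis E A = nmis E' B"
proof -
  have inj: "inj_on f A" and im: "f ` A = B" using b by (auto simp: bij_betw_def)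
  have iff: "f ` I \<in> mis E' B \<longleftrightarrow> I \<in> mis E A" if I: "I \<subseteq> A" for I
  proof -
    have "f ` I \<subseteq> B" using I im by blast
    moreover have "(\<forall>u\<in>f ` I. \<forall>v\<in>f ` I. \<not> E' u v) \<longleftrightarrow> (\<forall>u\<in>I. \<forall>v\<in>I. \<not> E u v)"
    proof -
      have "E u v \<longleftrightarrow> E' (f u) (f v)" if "u \<in> I" "v \<in> I" for u v using e[of u v] I that by blast
      then show ?thesis by simp
    qed
    moreover have "B - f ` I = f ` (A - I)" using inj_on_image_set_diff[OF inj, of A I] I im by auto
    moreover have "(\<forall>v\<in>f ` (A - I). \<exists>u\<in>f ` I. E' v u) \<longleftrightarrow> (\<forall>v\<in>A - I. \<exists>u\<in>I. E v u)"
    proof -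
      have "E v u \<longleftrightarrow> E' (f v) (f u)" if "v \<in> A - I" "u \<in> I" for u v
        using e[of v u] I that by blast
      then show ?thesis by simp
    qed
    ultimately show ?thesis using I by (simp add: mis_def)
  qed
  have "mis E' B = (`) f ` mis E A"
  proof
    show "(`) f ` mis E A \<subseteq> mis E' B"
    proof
      fix J assume "J \<in> (`) f ` mis E A"
      then obtain I where I: "I \<in> mis E A" "J = f ` I" by blast
      then have "I \<subseteq> A" by (simp add: mis_def)
      then show "J \<in> mis E' B" using iff I by blast
    qed
    show "mis E' B \<subseteq> (`) f ` mis E A"
    proof
      fix J assume J: "J \<in> mis E' B"
      then have "J \<subseteq> f ` A" using im by (auto simp: mis_def)
      then obtain I where "I \<subseteq> A" "J = f ` I" by (meson subset_imageE)
      then show "J \<in> (`) f ` mis E A" using iff J by blast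
    qed
  qed
  moreover have "inj_on ((`) f) (mis E A)"
    by (rule inj_onI) (use inj_on_image_eq_iff[OF inj] in \<open>auto simp: mis_def\<close>)
  ultimately show ?thesis by (simp add: card_image)
qed

lemma num_mis_iso:
  assumes "G \<cong>\<^sub>G H" "\<And>v. {v} \<notin> edges G" "\<And>v. {v} \<notin> edges H"
  shows "num_mis G = num_mis H"
  using assms nmis_iso[of _ "verts G" "verts H" "adj G" "adj H"]
  by (auto simp: num_mis_eq graph_iso_def adj_def)

text \<open>Bijections between the classes of equal key are glued together.\<close>

lemma key_bij:
  fixes \<kappa> :: "'a \<Rightarrow> 'k" and \<kappa>' :: "'b \<Rightarrow> 'k"
  assumes fin: "finite A" "finite B" and eq: "\<And>k. card {x\<in>A. \<kappa> x = k} = card {x\<in>B. \<kappa>' x = k}"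
  shows "\<exists>\<phi>. bij_betw \<phi> A B \<and> (\<forall>x\<in>A. \<kappa>' (\<phi> x) = \<kappa> x)"
proof -
  have "\<exists>h. bij_betw h {x\<in>A. \<kappa> x = k} {x\<in>B. \<kappa>' x = k}" for k
    by (rule finite_same_card_bij) (use fin eq in auto)
  then obtain h where h: "\<And>k. bij_betw (h k) {x\<in>A. \<kappa> x = k} {x\<in>B. \<kappa>' x = k}" by metis
  let ?p = "\<lambda>x. h (\<kappa> x) x"
  have p: "?p x \<in> B \<and> \<kappa>' (?p x) = \<kappa> x" if "x \<in> A" for x
    using bij_betwE[OF h[of "\<kappa> x"]] that by auto
  have "bij_betw ?p A B"
  proof (rule bij_betw_imageI)
    show "inj_on ?p A"
    proof (rule inj_onI)
      fix x y assume *: "x \<in> A" "y \<in> A" "?p x = ?p y"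
      then have "\<kappa> x = \<kappa> y" using p by metis
      then show "x = y" using * bij_betw_imp_inj_on[OF h[of "\<kappa> x"]] by (auto simp: inj_on_def)
    qed
    show "?p ` A = B"
    proof
      show "?p ` A \<subseteq> B" using p by auto
      show "B \<subseteq> ?p ` A"
      proof
        fix y assume "y \<in> B"
        then have "y \<in> h (\<kappa>' y) ` {x\<in>A. \<kappa> x = \<kappa>' y}" using bij_betw_imp_surj_on[OF h[of "\<kappa>' y"]] by auto
        then obtain x where x: "x \<in> A" "\<kappa> x = \<kappa>' y" "y = h (\<kappa>' y) x" by blast
        then have "y = ?p x" by simp
        then show "y \<in> ?p ` A" using x(1) by blast
      qed
    qed
  qed
  then show ?thesis using p by blast
qed

text \<open>The sets \<open>M\<close> and \<open>N\<close> mark vertices, later the neighbours of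
  the centre of a star. A marked clique is determined by its size and its number of marked vertices,
  so equal multiplicities of these pairs suffice. With empty marks only the sizes are
  compared.\<close>

lemma cliques_iso:
  fixes E :: "'a \<Rightarrow> 'a \<Rightarrow> bool" and E' :: "'b \<Rightarrow> 'b \<Rightarrow> bool"
  assumes u: "ugraph E" "ugraph E'" and c: "cliques E \<C> A" "cliques E' \<D> B"
    and eq: "\<And>k. card {C\<in>\<C>. (card C, card (C \<inter> M)) = k} = card {D\<in>\<D>. (card D, card (D \<inter> N)) = k}"
  shows "\<exists>f. bij_betw f A B \<and> (\<forall>u\<in>A. \<forall>v\<in>A. E u v \<longleftrightarrow> E' (f u) (f v)) \<and> (\<forall>u\<in>A. u \<in> M \<longleftrightarrow> f u \<in> N)"
proof -
  note k = ugraph.cliquesD[OF u(1) c(1)] and l = ugraph.cliquesD[OF u(2) c(2)]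
  obtain \<phi> where phi: "bij_betw \<phi> \<C> \<D>" and key: "\<And>C. C \<in> \<C> \<Longrightarrow> card (\<phi> C) = card C \<and> card (\<phi> C \<inter> N) = card (C \<inter> M)"
    using key_bij[OF k(1) l(1), of "\<lambda>C. (card C, card (C \<inter> M))" "\<lambda>D. (card D, card (D \<inter> N))"] eq by auto
  have phiD: "\<phi> C \<in> \<D>" if "C \<in> \<C>" for C using bij_betwE[OF phi] that by blast
  have "\<exists>g. bij_betw g C (\<phi> C) \<and> (\<forall>u\<in>C. u \<in> M \<longleftrightarrow> g u \<in> N)" if C: "C \<in> \<C>" for C
  proof -
    have fin: "finite C" "finite (\<phi> C)" using k(4)[OF C] l(4)[OF phiD[OF C]] by auto
    obtain g1 where g1: "bij_betw g1 (C \<inter> M) (\<phi> C \<inter> N)"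
      using finite_same_card_bij[of "C \<inter> M" "\<phi> C \<inter> N"] fin key[OF C] by auto
    have "card (C - M) = card (\<phi> C - N)"
      using card_Diff_subset_Int[of C M] card_Diff_subset_Int[of "\<phi> C" N] fin key[OF C] by simp
    then obtain g2 where g2: "bij_betw g2 (C - M) (\<phi> C - N)"
      using finite_same_card_bij[of "C - M" "\<phi> C - N"] fin by auto
    \<comment> \<open>Marked vertices go to marked ones and unmarked to unmarked; inside a clique
      every bijection preserves adjacency.\<close>
    let ?g = "\<lambda>u. if u \<in> M then g1 u else g2 u"
    have "bij_betw ?g (C \<inter> M) (\<phi> C \<inter> N)" using g1 by (rule bij_betw_cong[THEN iffD1, rotated]) auto
    moreover have "bij_betw ?g (C - M) (\<phi> C - N)" using g2 by (rule bij_betw_cong[THEN iffD1, rotated]) auto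
    ultimately have "bij_betw ?g (C \<inter> M \<union> (C - M)) (\<phi> C \<inter> N \<union> (\<phi> C - N))"
      by (rule bij_betw_combine) auto
    moreover have "C \<inter> M \<union> (C - M) = C" "\<phi> C \<inter> N \<union> (\<phi> C - N) = \<phi> C" by auto
    ultimately have "bij_betw ?g C (\<phi> C)" by simp
    moreover have "\<forall>u\<in>C. u \<in> M \<longleftrightarrow> ?g u \<in> N" using bij_betwE[OF g1] bij_betwE[OF g2] by auto
    ultimately show ?thesis by blast
  qed
  then obtain g where g: "\<And>C. C \<in> \<C> \<Longrightarrow> bij_betw (g C) C (\<phi> C)" "\<And>C u. C \<in> \<C> \<Longrightarrow> u \<in> C \<Longrightarrow> u \<in> M \<longleftrightarrow> g C u \<in> N"
    by metis
  have "\<exists>C. \<forall>u\<in>A. C u \<in> \<C> \<and> u \<in> C u"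
    using k(2) by (intro bchoice) blast
  then obtain cl where cl: "\<And>u. u \<in> A \<Longrightarrow> cl u \<in> \<C>" "\<And>u. u \<in> A \<Longrightarrow> u \<in> cl u" by blast
  have cl_eq: "cl u = C" if "u \<in> C" "C \<in> \<C>" for u C
  proof (rule ccontr)
    assume "cl u \<noteq> C"
    moreover have "u \<in> A" using that k(2) by blast
    ultimately show False using k(7)[of "cl u" C] cl[of u] that by blast
  qed
  define f where "f u = g (cl u) u" for u
  have fD: "f u \<in> \<phi> (cl u)" if "u \<in> A" for u
    using bij_betwE[OF g(1)[OF cl(1)[OF that]]] cl(2)[OF that] by (auto simp: f_def)
  have same: "f u \<in> \<phi> C \<longleftrightarrow> cl u = C" if "u \<in> A" "C \<in> \<C>" for u C
  proof
    assume "f u \<in> \<phi> C"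
    then have "\<phi> C = \<phi> (cl u)" using fD[OF that(1)] l(7)[OF phiD[OF that(2)] phiD[OF cl(1)[OF that(1)]]] by blast
    then show "cl u = C" using bij_betw_imp_inj_on[OF phi] cl(1)[OF that(1)] that by (auto simp: inj_on_def)
  qed (use fD that in auto)
  have inj: "f u = f v \<longleftrightarrow> u = v" if "u \<in> A" "v \<in> A" for u v
  proof
    assume fe: "f u = f v"
    then have "cl u = cl v" using same[OF that(1) cl(1)[OF that(2)]] fD[OF that(2)] by simp
    then show "u = v" using fe bij_betw_imp_inj_on[OF g(1)[OF cl(1)[OF that(1)]]] cl(2)[OF that(1)] cl(2)[OF that(2)]
      by (auto simp: f_def inj_on_def)
  qed simp
  have "bij_betw f A B"
  proof (rule bij_betw_imageI)
    show "inj_on f A" using inj by (auto simp: inj_on_def)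
    show "f ` A = B"
    proof
      show "f ` A \<subseteq> B" using fD phiD cl(1) l(2) by blast
      show "B \<subseteq> f ` A"
      proof
        fix w assume "w \<in> B"
        then obtain D where D: "D \<in> \<D>" "w \<in> D" using l(2) by blast
        then obtain C where C: "C \<in> \<C>" "D = \<phi> C" using bij_betw_imp_surj_on[OF phi] by blast
        then obtain u where u: "u \<in> C" "w = g C u" using bij_betw_imp_surj_on[OF g(1)[OF C(1)]] D by blast
        then have "w = f u" "u \<in> A" using cl_eq[OF u(1) C(1)] C k(2) by (auto simp: f_def)
        then show "w \<in> f ` A" by blast
      qed
    qed
  qed
  moreover have "E u v \<longleftrightarrow> E' (f u) (f v)" if uv: "u \<in> A" "v \<in> A" for u v
  proof (cases "cl u = cl v")
    case True
    have "E u v \<longleftrightarrow> u \<noteq> v" using k(6)[OF cl(1)[OF uv(1)] cl(2)[OF uv(1)], of v] cl(2)[OF uv(2)] True ugraph.irr[OF u(1)] by auto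
    moreover have "E' (f u) (f v) \<longleftrightarrow> f u \<noteq> f v"
      using l(6)[OF phiD[OF cl(1)[OF uv(1)]] fD[OF uv(1)], of "f v"] fD[OF uv(2)] True ugraph.irr[OF u(2)] by auto
    ultimately show ?thesis using inj[OF uv] by simp
  next
    case False
    then have "\<phi> (cl u) \<noteq> \<phi> (cl v)" using bij_betw_imp_inj_on[OF phi] cl(1)[OF uv(1)] cl(1)[OF uv(2)] by (auto simp: inj_on_def)
    then show ?thesis
      using False k(8)[OF cl(1)[OF uv(1)] cl(1)[OF uv(2)] _ cl(2)[OF uv(1)] cl(2)[OF uv(2)]]
        l(8)[OF phiD[OF cl(1)[OF uv(1)]] phiD[OF cl(1)[OF uv(2)]] _ fD[OF uv(1)] fD[OF uv(2)]] by blast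
  qed
  moreover have "\<forall>u\<in>A. u \<in> M \<longleftrightarrow> f u \<in> N" using g(2) cl by (auto simp: f_def)
  ultimately show ?thesis by blast
qed

lemma cliques_key:
  assumes "ugraph E" "cliques E \<C> S"
  shows "{C\<in>\<C>. (card C, card (C \<inter> {})) = k} =
    (if k = (2, 0) then {C\<in>\<C>. card C = 2} else if k = (3, 0) then {C\<in>\<C>. card C = 3} else {})"
  using ugraph.cliquesD(3)[OF assms] by (cases k) auto

lemma cliques_graph_iso:
  assumes ug: "ugraph (adj G)" "ugraph (adj H)" and c: "cliques (adj G) \<C> (verts G)" "cliques (adj H) \<D> (verts H)"
    and eq: "card {C\<in>\<C>. card C = 2} = card {D\<in>\<D>. card D = 2}" "card {C\<in>\<C>. card C = 3} = card {D\<in>\<D>. card D = 3}"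
  shows "G \<cong>\<^sub>G H"
proof -
  have "card {C\<in>\<C>. (card C, card (C \<inter> {})) = k} = card {D\<in>\<D>. (card D, card (D \<inter> {})) = k}" for k
    unfolding cliques_key[OF ug(1) c(1)] cliques_key[OF ug(2) c(2)] using eq by simp
  from cliques_iso[OF ug c this]
  show ?thesis unfolding graph_iso_def adj_def by blast
qed

text \<open>The pairs (2, 1), (2, 2), (3, 1) of size and number of neighbours of the centre belong
  to \<open>a\<close>, \<open>f\<close>, \<open>b\<close>. Hence the three parameters determine a
  star up to isomorphism.\<close>

lemma star_key:
  fixes K :: "'a sgraph"
  assumes u: "ugraph (adj K)" and s: "ugraph.star (adj K) (verts K) w \<X> a f b"
  shows "card {C\<in>\<X>. (card C, card (C \<inter> nbhd (adj K) (verts K) w)) = k} =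
      (if k = (2, 1) then a else if k = (2, 2) then f else if k = (3, 1) then b else 0)"
proof -
  have w: "w \<in> verts K" and c: "cliques (adj K) \<X> (verts K - {w})"
    and d: "\<And>C. C \<in> \<X> \<Longrightarrow> card (nbhd (adj K) C w) = 1 \<or> (card C = 2 \<and> C \<subseteq> nbhd (adj K) (verts K) w)"
    and abf: "a = card {C\<in>\<X>. card C = 2 \<and> \<not> C \<subseteq> nbhd (adj K) (verts K) w}"
      "f = card {C\<in>\<X>. card C = 2 \<and> C \<subseteq> nbhd (adj K) (verts K) w}" "b = card {C\<in>\<X>. card C = 3}"
    using s unfolding ugraph.star_def[OF u] by blast+
  note kk = ugraph.cliquesD[OF u c]
  let ?N = "nbhd (adj K) (verts K) w"
  have nbC: "nbhd (adj K) C w = C \<inter> ?N" if "C \<in> \<X>" for C using kk(2) that by (auto simp: nbhd_def)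
  have one: "card (C \<inter> ?N) = 1" if "C \<in> \<X>" "\<not> (card C = 2 \<and> C \<subseteq> ?N)" for C
    using d[OF that(1)] that(2) nbC[OF that(1)] by auto
  have two: "card (C \<inter> ?N) = 2" if "C \<in> \<X>" "card C = 2" "C \<subseteq> ?N" for C
    using that by (simp add: inf.absorb1)
  have "{C\<in>\<X>. (card C, card (C \<inter> ?N)) = k} = (if k = (2, 1) then {C\<in>\<X>. card C = 2 \<and> \<not> C \<subseteq> ?N}
     else if k = (2, 2) then {C\<in>\<X>. card C = 2 \<and> C \<subseteq> ?N} else if k = (3, 1) then {C\<in>\<X>. card C = 3} else {})"
  proof (cases k)
    case (Pair i j)
    have "(card C, card (C \<inter> ?N)) = k \<longleftrightarrow> (if k = (2, 1) then card C = 2 \<and> \<not> C \<subseteq> ?N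
     else if k = (2, 2) then card C = 2 \<and> C \<subseteq> ?N else if k = (3, 1) then card C = 3 else False)" if C: "C \<in> \<X>" for C
    proof -
      define p where "p \<longleftrightarrow> C \<subseteq> ?N"
      show ?thesis
        unfolding p_def[symmetric] using kk(3)[OF C] one[OF C, folded p_def] two[OF C, folded p_def] Pair by (cases p) auto
    qed
    then have "{C\<in>\<X>. (card C, card (C \<inter> ?N)) = k} = {C\<in>\<X>. if k = (2, 1) then card C = 2 \<and> \<not> C \<subseteq> ?N
     else if k = (2, 2) then card C = 2 \<and> C \<subseteq> ?N else if k = (3, 1) then card C = 3 else False}"
      by (intro Collect_cong conj_cong refl)
    then show ?thesis by (cases "k = (2, 1)"; cases "k = (2, 2)"; cases "k = (3, 1)"; simp)
  qed
  then show ?thesis using abf by simp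
qed

lemma star_graph_iso:
  assumes ug: "ugraph (adj G)" "ugraph (adj H)"
    and s: "ugraph.star (adj G) (verts G) y \<C> a f b" "ugraph.star (adj H) (verts H) z \<D> a f b"
  shows "G \<cong>\<^sub>G H"
proof -
  have st: "y \<in> verts G" "cliques (adj G) \<C> (verts G - {y})" "z \<in> verts H" "cliques (adj H) \<D> (verts H - {z})"
    using s unfolding ugraph.star_def[OF ug(1)] ugraph.star_def[OF ug(2)] by blast+
  obtain h where h: "bij_betw h (verts G - {y}) (verts H - {z})"
    "\<And>u v. u \<in> verts G - {y} \<Longrightarrow> v \<in> verts G - {y} \<Longrightarrow> adj G u v \<longleftrightarrow> adj H (h u) (h v)"
    "\<And>u. u \<in> verts G - {y} \<Longrightarrow> u \<in> nbhd (adj G) (verts G) y \<longleftrightarrow> h u \<in> nbhd (adj H) (verts H) z"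
    using cliques_iso[OF ug st(2,4), of "nbhd (adj G) (verts G) y" "nbhd (adj H) (verts H) z"]
    unfolding star_key[OF ug(1) s(1)] star_key[OF ug(2) s(2)] by blast
  let ?g = "\<lambda>u. if u = y then z else h u"
  have "bij_betw ?g (verts G - {y}) (verts H - {z})" using h(1) by (rule bij_betw_cong[THEN iffD1, rotated]) auto
  moreover have "bij_betw ?g {y} {z}" by (simp add: bij_betw_def)
  ultimately have "bij_betw ?g ((verts G - {y}) \<union> {y}) ((verts H - {z}) \<union> {z})"
    by (rule bij_betw_combine) auto
  then have bij: "bij_betw ?g (verts G) (verts H)" using st by (simp add: insert_absorb)
  have hz: "h u \<in> verts H - {z}" if "u \<in> verts G - {y}" for u using bij_betwE[OF h(1)] that by blast
  have cen: "adj G y u \<longleftrightarrow> adj H z (h u)" if "u \<in> verts G - {y}" for u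
    using h(3)[OF that] hz[OF that] that by (auto simp: nbhd_def)
  have "adj G u v \<longleftrightarrow> adj H (?g u) (?g v)" if "u \<in> verts G" "v \<in> verts G" for u v
  proof -
    have sG: "adj G u v \<longleftrightarrow> adj G v u" and sH: "adj H u' v' \<longleftrightarrow> adj H v' u'" for u' v'
      using ugraph.sym[OF ug(1)] ugraph.sym[OF ug(2)] by blast+
    show ?thesis
      using that cen[of u] cen[of v] h(2)[of u v] sG sH[of z "h u"] ugraph.irr[OF ug(1)] ugraph.irr[OF ug(2)]
      by (cases "u = y"; cases "v = y") auto
  qed
  then show ?thesis using bij unfolding graph_iso_def adj_def by blast
qed

section \<open>The extremal graphs\<close>

lemma adj_complete: "adj (complete_graph m) i j \<longleftrightarrow> i < m \<and> j < m \<and> i \<noteq> j"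
  by (auto simp: adj_def complete_graph_def doubleton_eq_iff)

lemma no_loop_complete: "{v} \<notin> edges (complete_graph m)"
  by (auto simp: complete_graph_def)

lemma pair_image: "{(i, x), (j, y)} = Pair k ` e \<longleftrightarrow> i = k \<and> j = k \<and> e = {x, y}"
proof
  assume eq: "{(i, x), (j, y)} = Pair k ` e"
  then have "(i, x) \<in> Pair k ` e" "(j, y) \<in> Pair k ` e" by (metis insertI1, metis insertI1 insertI2)
  then have k: "i = k" "j = k" by auto
  then have "Pair k ` {x, y} = Pair k ` e" using eq by simp
  moreover have "inj (Pair k)" by (simp add: inj_on_def)
  ultimately show "i = k \<and> j = k \<and> e = {x, y}" using k by (metis inj_image_eq_iff)
qed simp

lemma adj_copies: "adj (copies t G) (i, x) (j, y) \<longleftrightarrow> i = j \<and> i < t \<and> adj G x y"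
  unfolding adj_def copies_def by (auto simp: pair_image)

lemma no_loop_copies:
  assumes "\<And>v. {v} \<notin> edges G" shows "{v} \<notin> edges (copies t G)"
proof -
  obtain j x where v: "v = (j, x)" by (cases v)
  have "e = {x}" if "{(j, x)} = Pair k ` e" for k e
    using pair_image[of j x j x k e] that by (metis insert_absorb2)
  then show ?thesis unfolding v copies_def using assms by auto
qed

lemma not_Inr_image: "Inl u \<in> A \<Longrightarrow> A \<noteq> Inr ` e" and not_Inl_image: "Inr v \<in> A \<Longrightarrow> A \<noteq> Inl ` e'"
  by auto

lemma inl_pair: "{Inl u, Inl v} = Inl ` e \<longleftrightarrow> {u, v} = e"
  using inj_image_eq_iff[OF inj_Inl, of "{u, v}" e] by simp

lemma inr_pair: "{Inr u, Inr v} = Inr ` e \<longleftrightarrow> {u, v} = e"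
  using inj_image_eq_iff[OF inj_Inr, of "{u, v}" e] by simp

lemma edges_union:
  "x \<in> edges (G \<uplus>\<^sub>G H) \<longleftrightarrow> (\<exists>e\<in>edges G. x = Inl ` e) \<or> (\<exists>e\<in>edges H. x = Inr ` e)"
  by (auto simp: disjoint_union_def)

lemma adj_union:
  "adj (G \<uplus>\<^sub>G H) (Inl u) (Inl v) \<longleftrightarrow> adj G u v"
  "adj (G \<uplus>\<^sub>G H) (Inr u') (Inr v') \<longleftrightarrow> adj H u' v'"
  "\<not> adj (G \<uplus>\<^sub>G H) (Inl u) (Inr v')" "\<not> adj (G \<uplus>\<^sub>G H) (Inr u') (Inl v)"
proof -
  have 2: "{Inl u, Inl v} \<noteq> Inr ` e'" "{Inr u', Inr v'} \<noteq> Inl ` e"  "{Inl u, Inr v'} \<noteq> Inr ` e'"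
    "{Inl u, Inr v'} \<noteq> Inl ` e" "{Inr u', Inl v} \<noteq> Inr ` e'" "{Inr u', Inl v} \<noteq> Inl ` e" for e e'
    by (rule not_Inr_image not_Inl_image, (rule insertI1 | rule insertI2, rule insertI1))+
  show "adj (G \<uplus>\<^sub>G H) (Inl u) (Inl v) \<longleftrightarrow> adj G u v"
    "adj (G \<uplus>\<^sub>G H) (Inr u') (Inr v') \<longleftrightarrow> adj H u' v'"
    "\<not> adj (G \<uplus>\<^sub>G H) (Inl u) (Inr v')" "\<not> adj (G \<uplus>\<^sub>G H) (Inr u') (Inl v)"
    unfolding adj_def edges_union by (simp_all only: inl_pair inr_pair 2) simp_all
qed

lemma no_loop_union:
  assumes "\<And>v. {v} \<notin> edges G" "\<And>v. {v} \<notin> edges H" shows "{v} \<notin> edges (G \<uplus>\<^sub>G H)"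
proof (cases v)
  case (Inl a)
  have "{Inl a} = Inl ` e \<longleftrightarrow> e = {a}" for e using inl_pair[of a a e] by auto
  moreover have "{Inl a} \<noteq> Inr ` e'" for e' by (rule not_Inr_image) simp
  ultimately show ?thesis unfolding Inl edges_union using assms by metis
next
  case (Inr a)
  have "{Inr a} = Inr ` e \<longleftrightarrow> e = {a}" for e using inr_pair[of a a e] by auto
  moreover have "{Inr a} \<noteq> Inl ` e'" for e' by (rule not_Inl_image) simp
  ultimately show ?thesis unfolding Inr edges_union using assms by metis
qed

text \<open>The union of cliques underlying both \<open>G_graph\<close> and
  \<open>C_graph\<close>.\<close>

definition base :: "nat \<Rightarrow> nat \<Rightarrow> (nat \<times> nat + nat \<times> nat) sgraph" where
  "base b a = copies b (complete_graph 3) \<uplus>\<^sub>G copies a (complete_graph 2)"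

definition base_cliques :: "nat \<Rightarrow> nat \<Rightarrow> (nat \<times> nat + nat \<times> nat) set set" where
  "base_cliques b a = (\<lambda>i. Inl ` ({i} \<times> {..<3})) ` {..<b} \<union> (\<lambda>i. Inr ` ({i} \<times> {..<2})) ` {..<a}"

lemma no_loop_base: "{v} \<notin> edges (base b a)"
  unfolding base_def by (intro no_loop_union no_loop_copies no_loop_complete)

lemma card_block: "card (Inl ` ({i} \<times> {..<3::nat}) :: (nat \<times> nat + nat \<times> nat) set) = 3"
  "card (Inr ` ({i} \<times> {..<2::nat}) :: (nat \<times> nat + nat \<times> nat) set) = 2"
  by (simp_all add: card_image)

lemma cliques_base: "cliques (adj (base b a)) (base_cliques b a) (verts (base b a))"
  unfolding cliques_def
proof (intro conjI ballI impI)
  show "finite (base_cliques b a)" by (simp add: base_cliques_def)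
  show "\<Union>(base_cliques b a) = verts (base b a)"
    by (auto simp: base_cliques_def base_def disjoint_union_def copies_def complete_graph_def)
  fix C assume C: "C \<in> base_cliques b a"
  then show "card C \<in> {2, 3}" by (auto simp: base_cliques_def card_block)
  show "adj (base b a) u v" if "u \<in> C" "v \<in> C" "u \<noteq> v" for u v
    using C that by (auto simp: base_cliques_def base_def adj_union adj_copies adj_complete)
  fix D assume D: "D \<in> base_cliques b a" "C \<noteq> D"
  show "C \<inter> D = {}" using C D by (auto simp: base_cliques_def)
  show "\<not> adj (base b a) u v" if "u \<in> C" "v \<in> D" for u v
    using C D that by (auto simp: base_cliques_def base_def adj_union adj_copies adj_complete)
qed

lemma base_cliques_counts: "card {C \<in> base_cliques b a. card C = 3} = b" "card {C \<in> base_cliques b a. card C = 2} = a"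
proof -
  have "{C \<in> base_cliques b a. card C = 3} = (\<lambda>i. Inl ` ({i} \<times> {..<3})) ` {..<b}"
    "{C \<in> base_cliques b a. card C = 2} = (\<lambda>i. Inr ` ({i} \<times> {..<2})) ` {..<a}"
    by (auto simp: base_cliques_def card_block)
  moreover have "inj_on (\<lambda>i. Inl ` ({i} \<times> {..<3::nat}) :: (nat \<times> nat + nat \<times> nat) set) {..<b}"
    "inj_on (\<lambda>i. Inr ` ({i} \<times> {..<2::nat}) :: (nat \<times> nat + nat \<times> nat) set) {..<a}"
    by (auto intro!: inj_onI simp: inj_image_eq_iff times_eq_iff lessThan_empty_iff)
  ultimately show "card {C \<in> base_cliques b a. card C = 3} = b" "card {C \<in> base_cliques b a. card C = 2} = a"
    by (simp_all add: card_image)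
qed

text \<open>Turns the \<open>components\<close> in the definition of \<open>star_join\<close> into
  the given family of cliques.\<close>

lemma components_clq:
  assumes ug: "ugraph (adj G)" and c: "cliques (adj G) \<C> (verts G)" shows "components G = \<C>"
proof -
  interpret ugraph "adj G" by (rule ug)
  note k = cliquesD[OF c]
  have cl: "{v \<in> verts G. (u, v) \<in> (adj_rel G)\<^sup>*} = C" if "u \<in> C" "C \<in> \<C>" for u C
  proof
    have "(u, v) \<in> (adj_rel G)\<^sup>* \<Longrightarrow> v \<in> C" for v
    proof (induction rule: rtrancl_induct)
      case (step y z)
      then have yz: "adj G y z" "z \<in> verts G" by (auto simp: adj_rel_def adj_def)
      then obtain D where "D \<in> \<C>" "z \<in> D" using k(2) by blast
      then show ?case using k(8)[OF that(2), of D y z] step yz by blast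
    qed (rule that)
    then show "{v \<in> verts G. (u, v) \<in> (adj_rel G)\<^sup>*} \<subseteq> C" by blast
    show "C \<subseteq> {v \<in> verts G. (u, v) \<in> (adj_rel G)\<^sup>*}"
    proof
      fix v assume v: "v \<in> C"
      have "u \<in> verts G" "v \<in> verts G" using that v k(2) by blast+
      moreover have "(u, v) \<in> (adj_rel G)\<^sup>*"
      proof (cases "u = v")
        case False
        then have "adj G u v" using k(6)[OF that(2,1) v] by blast
        then show ?thesis using calculation by (intro r_into_rtrancl) (auto simp: adj_rel_def adj_def)
      qed simp
      ultimately show "v \<in> {v \<in> verts G. (u, v) \<in> (adj_rel G)\<^sup>*}" by blast
    qed
  qed
  show ?thesis
  proof
    show "components G \<subseteq> \<C>"
    proof
      fix W assume "W \<in> components G"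
      then obtain u where u: "u \<in> verts G" "W = {v \<in> verts G. (u, v) \<in> (adj_rel G)\<^sup>*}"
        unfolding components_def by blast
      then obtain C where "C \<in> \<C>" "u \<in> C" using k(2) by blast
      then show "W \<in> \<C>" using cl u by simp
    qed
    show "\<C> \<subseteq> components G"
    proof
      fix C assume C: "C \<in> \<C>"
      then obtain u where "u \<in> C" using k(5) by blast
      then show "C \<in> components G" using cl[of u C] C k(2) unfolding components_def by blast
    qed
  qed
qed

lemma no_loop_star_join:
  assumes "\<And>v. {v} \<notin> edges G" shows "{v} \<notin> edges (star_join m G)"
proof -
  have "{v} \<notin> edges (complete_graph m \<uplus>\<^sub>G G)" by (intro no_loop_union no_loop_complete assms)
  moreover have "{v} \<noteq> {Inl 0, Inr w}" for w by (cases v) auto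
  ultimately show ?thesis unfolding star_join_def by auto
qed

text \<open>Without its vertex 0 the core \<open>K_m\<close> leaves nothing for \<open>m = 1\<close>
  and, for \<open>m = 3\<close>, a \<open>K_2\<close> joined completely to the centre, the one
  counted by the third parameter of \<open>star\<close>. Every other part is attached at its chosen
  vertex alone.\<close>

lemma star_join_star:
  fixes B :: "'b sgraph"
  assumes nl: "\<And>v. {v} \<notin> edges B" and c: "cliques (adj B) \<D> (verts B)" and m: "m = 1 \<or> m = 3"
  shows "\<exists>\<C>. ugraph.star (adj (star_join m B)) (verts (star_join m B)) (Inl 0) \<C>
    (card {D\<in>\<D>. card D = 2}) (if m = 3 then 1 else 0) (card {D\<in>\<D>. card D = 3})"
proof -
  let ?J = "star_join m B"
  have ugB: "ugraph (adj B)" by (rule ugraph_adj[OF nl])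
  have ugJ: "ugraph (adj ?J)" by (rule ugraph_adj[OF no_loop_star_join[OF nl]])
  note k = ugraph.cliquesD[OF ugB c]
  have comp: "components B = \<D>" by (rule components_clq[OF ugB c])
  define s where "s W = (SOME v. v \<in> W)" for W :: "'b set"
  have s: "s W \<in> W" if "W \<in> \<D>" for W unfolding s_def using k(5)[OF that] some_in_eq by blast
  have eJ: "edges ?J = edges (complete_graph m \<uplus>\<^sub>G B) \<union> {{Inl 0, Inr (s W)} |W. W \<in> \<D>}"
    by (simp add: star_join_def comp s_def)
  have vJ: "verts ?J = Inl ` {..<m} \<union> Inr ` verts B"
    by (simp add: star_join_def disjoint_union_def complete_graph_def)
  have aLL: "adj ?J (Inl i) (Inl j) \<longleftrightarrow> i < m \<and> j < m \<and> i \<noteq> j" for i j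
  proof -
    have "adj ?J (Inl i) (Inl j) \<longleftrightarrow> adj (complete_graph m \<uplus>\<^sub>G B) (Inl i) (Inl j)"
      unfolding adj_def eJ by (auto simp: doubleton_eq_iff)
    then show ?thesis by (simp add: adj_union adj_complete)
  qed
  have aRR: "adj ?J (Inr u) (Inr v) \<longleftrightarrow> adj B u v" for u v
  proof -
    have "adj ?J (Inr u) (Inr v) \<longleftrightarrow> adj (complete_graph m \<uplus>\<^sub>G B) (Inr u) (Inr v)"
      unfolding adj_def eJ by (auto simp: doubleton_eq_iff)
    then show ?thesis by (simp add: adj_union)
  qed
  have aLR: "adj ?J (Inl i) (Inr v) \<longleftrightarrow> i = 0 \<and> v \<in> s ` \<D>" for i v
  proof -
    have "\<not> adj (complete_graph m \<uplus>\<^sub>G B) (Inl i) (Inr v)" by (rule adj_union)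
    then show ?thesis unfolding adj_def eJ by (auto simp: doubleton_eq_iff)
  qed
  have aRL: "adj ?J (Inr v) (Inl i) \<longleftrightarrow> i = 0 \<and> v \<in> s ` \<D>" for i v
    using aLR[of i v] by (simp add: adj_def insert_commute)
  define P where "P = (if m = 3 then {{Inl 1, Inl 2}} else {} :: (nat + 'b) set set)"
  define \<C> where "\<C> = (`) Inr ` \<D> \<union> P"
  have cI: "card (Inr ` D :: (nat + 'b) set) = card D" for D :: "'b set" by (simp add: card_image)
  have PP: "C = {Inl 1, Inl 2} \<and> m = 3 \<and> card C = 2" if "C \<in> P" for C
    using that by (auto simp: P_def split: if_splits)
  have clqJ: "cliques (adj ?J) \<C> (verts ?J - {Inl 0})"
    unfolding cliques_def
  proof (intro conjI ballI impI)
    show "finite \<C>" using k(1) by (simp add: \<C>_def P_def)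
    have uP: "\<Union>P = Inl ` {..<m} - {Inl 0 :: nat + 'b}" using m
      by (auto simp: P_def lessThan_nat_numeral numeral_3_eq_3 less_Suc_eq)
    have uD: "\<Union>((`) Inr ` \<D>) = Inr ` verts B" using k(2) by auto
    show "\<Union>\<C> = verts ?J - {Inl 0}" unfolding \<C>_def vJ Union_Un_distrib uP uD by auto
    fix C assume C: "C \<in> \<C>"
    show "card C \<in> {2, 3}"
    proof (cases "C \<in> P")
      case False
      then obtain D where "D \<in> \<D>" "C = Inr ` D" using C by (auto simp: \<C>_def)
      then show ?thesis using k(3) cI by auto
    qed (use PP in auto)
    show "adj ?J u v" if uv: "u \<in> C" "v \<in> C" "u \<noteq> v" for u v
    proof (cases "C \<in> P")
      case True then show ?thesis using PP[OF True] that aLL by auto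
    next
      case False
      then obtain D where "D \<in> \<D>" "C = Inr ` D" using C by (auto simp: \<C>_def)
      moreover from this obtain u' v' where "u = Inr u'" "v = Inr v'" "u' \<in> D" "v' \<in> D" using uv(1,2) by blast
      ultimately show ?thesis using k(6)[of D u' v'] uv(3) aRR by simp
    qed
    fix D assume D: "D \<in> \<C>" "C \<noteq> D"
    show "C \<inter> D = {}"
      using C D k(7) by (auto simp: \<C>_def P_def split: if_splits)
    show "\<not> adj ?J u v" if uv: "u \<in> C" "v \<in> D" for u v
    proof (cases "C \<in> P")
      case True
      then have "D \<notin> P" using PP D(2) by blast
      then obtain D' where "D = Inr ` D'" using D by (auto simp: \<C>_def)
      then show ?thesis using PP[OF True] uv aLR by auto
    next
      case False
      then obtain C' where C': "C' \<in> \<D>" "C = Inr ` C'" using C by (auto simp: \<C>_def)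
      show ?thesis
      proof (cases "D \<in> P")
        case True
        then show ?thesis using PP[OF True] uv C' aRL by auto
      next
        case False
        then obtain D' where D': "D' \<in> \<D>" "D = Inr ` D'" using D by (auto simp: \<C>_def)
        then have "C' \<noteq> D'" using C' D(2) by blast
        then show ?thesis using k(8)[OF C'(1) D'(1)] uv C'(2) D'(2) aRR by auto
      qed
    qed
  qed
  have nbD: "nbhd (adj ?J) (Inr ` D) (Inl 0) = {Inr (s D)}" if D: "D \<in> \<D>" for D
  proof -
    have "v \<in> s ` \<D> \<longleftrightarrow> v = s D" if "v \<in> D" for v
      using s k(7)[OF D] that D by blast
    then show ?thesis using s[OF D] aLR by (auto simp: nbhd_def)
  qed
  have nfull: "\<not> Inr ` D \<subseteq> nbhd (adj ?J) (verts ?J) (Inl 0)" if D: "D \<in> \<D>" for D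
  proof
    assume "Inr ` D \<subseteq> nbhd (adj ?J) (verts ?J) (Inl 0)"
    then have "nbhd (adj ?J) (Inr ` D) (Inl 0) = Inr ` D" by (auto simp: nbhd_def)
    then have eq: "Inr ` D = {Inr (s D) :: nat + 'b}" using nbD[OF D] by metis
    have "card (Inr ` D :: (nat + 'b) set) = 1" unfolding eq by simp
    then show False using k(3)[OF D] cI by auto
  qed
  have full: "C \<subseteq> nbhd (adj ?J) (verts ?J) (Inl 0)" if "C \<in> P" for C
  proof -
    have "Inl i \<in> verts ?J \<longleftrightarrow> i < m" for i using vJ by auto
    then show ?thesis using PP[OF that] aLL[of 0 1] aLL[of 0 2] by (simp add: nbhd_def)
  qed
  have "ugraph.star (adj ?J) (verts ?J) (Inl 0) \<C> (card {D\<in>\<D>. card D = 2}) (if m = 3 then 1 else 0) (card {D\<in>\<D>. card D = 3})"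
    unfolding ugraph.star_def[OF ugJ]
  proof (intro conjI ballI)
    show "Inl 0 \<in> verts ?J" using m by (auto simp: vJ)
    show "cliques (adj ?J) \<C> (verts ?J - {Inl 0})" by (rule clqJ)
    show "card (nbhd (adj ?J) C (Inl 0)) = 1 \<or> card C = 2 \<and> C \<subseteq> nbhd (adj ?J) (verts ?J) (Inl 0)" if CC: "C \<in> \<C>" for C
    proof (cases "C \<in> P")
      case False
      then obtain D where "D \<in> \<D>" "C = Inr ` D" using CC by (auto simp: \<C>_def)
      then show ?thesis using nbD by simp
    qed (use PP full in blast)
    have inj: "inj_on ((`) Inr :: 'b set \<Rightarrow> (nat + 'b) set) X" for X by (auto intro!: inj_onI simp: inj_image_eq_iff)
    have "{C \<in> \<C>. card C = 2 \<and> \<not> C \<subseteq> nbhd (adj ?J) (verts ?J) (Inl 0)} = (`) Inr ` {D\<in>\<D>. card D = 2}"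
    proof (intro equalityI subsetI)
      fix C assume C: "C \<in> {C \<in> \<C>. card C = 2 \<and> \<not> C \<subseteq> nbhd (adj ?J) (verts ?J) (Inl 0)}"
      then have "C \<notin> P" using full by blast
      then show "C \<in> (`) Inr ` {D\<in>\<D>. card D = 2}" using C cI by (auto simp: \<C>_def)
    next
      fix C :: "(nat + 'b) set" assume "C \<in> (`) Inr ` {D\<in>\<D>. card D = 2}"
      then obtain D where "D \<in> \<D>" "card D = 2" "C = Inr ` D" by blast
      then show "C \<in> {C \<in> \<C>. card C = 2 \<and> \<not> C \<subseteq> nbhd (adj ?J) (verts ?J) (Inl 0)}"
        using nfull[of D] cI[of D] by (simp add: \<C>_def)
    qed
    then show "card {D\<in>\<D>. card D = 2} = card {C \<in> \<C>. card C = 2 \<and> \<not> C \<subseteq> nbhd (adj ?J) (verts ?J) (Inl 0)}"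
      by (simp add: card_image[OF inj])
    have "{C \<in> \<C>. card C = 3} = (`) Inr ` {D\<in>\<D>. card D = 3}"
      using PP cI by (fastforce simp: \<C>_def)
    then show "card {D\<in>\<D>. card D = 3} = card {C \<in> \<C>. card C = 3}"
      by (simp add: card_image[OF inj])
    have "{C \<in> \<C>. card C = 2 \<and> C \<subseteq> nbhd (adj ?J) (verts ?J) (Inl 0)} = P"
    proof (intro equalityI subsetI)
      fix C assume C: "C \<in> P"
      then have "card C = 2" using PP by blast
      then show "C \<in> {C \<in> \<C>. card C = 2 \<and> C \<subseteq> nbhd (adj ?J) (verts ?J) (Inl 0)}"
        using C full[OF C] by (simp add: \<C>_def)
    next
      fix C assume C: "C \<in> {C \<in> \<C>. card C = 2 \<and> C \<subseteq> nbhd (adj ?J) (verts ?J) (Inl 0)}"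
      then show "C \<in> P" using nfull unfolding \<C>_def by blast
    qed
    then show "(if m = 3 then 1 else 0) = card {C \<in> \<C>. card C = 2 \<and> C \<subseteq> nbhd (adj ?J) (verts ?J) (Inl 0)}"
      by (simp add: P_def)
  qed
  then show ?thesis by blast
qed

lemma no_loop_G_graph: "{v} \<notin> edges (G_graph n r)"
  using no_loop_base by (simp add: G_graph_def base_def)

lemma G_graph_clq:
  assumes "3 * r \<le> n + 1" "1 \<le> r"
  obtains \<C> where "cliques (adj (G_graph n r)) \<C> (verts (G_graph n r))"
    "card {C \<in> \<C>. card C = 3} = (if even (n + r) then r else r - 1)"
    "card {C \<in> \<C>. card C = 2} = (if even (n + r) then (n - 3 * r) div 2 else (n + 3 - 3 * r) div 2)"
proof -
  have *: "n mod 2 = r mod 2 \<longleftrightarrow> even (n + r)" by presburger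
  show ?thesis
    by (rule that[of "if even (n + r) then base_cliques r ((n - 3 * r) div 2) else base_cliques (r - 1) ((n + 3 - 3 * r) div 2)"])
      (simp_all add: G_graph_def * cliques_base[unfolded base_def] base_cliques_counts)
qed

lemma no_loop_C_graph: "{v} \<notin> edges (C_graph n r)"
  unfolding C_graph_def using no_loop_base[unfolded base_def] by (auto intro!: no_loop_star_join)

lemma C_graph_star:
  "\<exists>\<C>. ugraph.star (adj (C_graph n r)) (verts (C_graph n r)) (Inl 0) \<C>
    (if even (n + r) then (n - 3 * r) div 2 else (n - 3 * r - 1) div 2) (if even (n + r) then 1 else 0)
    (if even (n + r) then r - 1 else r)"
proof -
  have *: "n mod 2 = r mod 2 \<longleftrightarrow> even (n + r)" by presburger
  show ?thesis
    using star_join_star[OF no_loop_base cliques_base, of 3 "r - 1" "(n - 3 * r) div 2"]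
      star_join_star[OF no_loop_base cliques_base, of 1 r "(n - 3 * r - 1) div 2"]
    by (simp add: C_graph_def * base_cliques_counts base_def)
qed

lemma no_loop_E: "{v} \<notin> edges E_graph"
  by (auto simp: E_graph_def)

lemma E_graph_star:
  "ugraph.star (adj E_graph) (verts E_graph) v_c {{v_a1, v_a2}, {v_b1, v_b2}, {v_p, v_q}} 1 2 0"
proof -
  have ug: "ugraph (adj E_graph)" by (rule ugraph_adj[OF no_loop_E])
  have UN: "(UNIV :: E_vertex set) = {v_c, v_a1, v_a2, v_b1, v_b2, v_p, v_q}"
    by (auto intro: E_vertex.exhaust)
  have a: "adj E_graph u v \<longleftrightarrow> (u, v) \<in> {(v_c, v_a1), (v_a1, v_c), (v_c, v_a2), (v_a2, v_c), (v_a1, v_a2), (v_a2, v_a1),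
     (v_c, v_b1), (v_b1, v_c), (v_c, v_b2), (v_b2, v_c), (v_b1, v_b2), (v_b2, v_b1), (v_c, v_p), (v_p, v_c), (v_p, v_q), (v_q, v_p)}" for u v
    unfolding adj_def E_graph_def by (auto simp: doubleton_eq_iff)
  have v: "verts E_graph = {v_c, v_a1, v_a2, v_b1, v_b2, v_p, v_q}" by (simp add: E_graph_def UN)
  let ?C = "{{v_a1, v_a2}, {v_b1, v_b2}, {v_p, v_q}}"
  have nbE: "nbhd (adj E_graph) (verts E_graph) v_c = {v_a1, v_a2, v_b1, v_b2, v_p}"
    by (auto simp: nbhd_def v a)
  have "cliques (adj E_graph) ?C (verts E_graph - {v_c})"
    unfolding cliques_def v by (auto simp: a)
  moreover have "nbhd (adj E_graph) {v_p, v_q} v_c = {v_p}" by (auto simp: nbhd_def a)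
  moreover have "{C \<in> ?C. card C = 2 \<and> \<not> C \<subseteq> {v_a1, v_a2, v_b1, v_b2, v_p}} = {{v_p, v_q}}" by auto
  moreover have "{C \<in> ?C. card C = 2 \<and> C \<subseteq> {v_a1, v_a2, v_b1, v_b2, v_p}} = {{v_a1, v_a2}, {v_b1, v_b2}}" by auto
  moreover have "{C \<in> ?C. card C = 3} = {}" by auto
  moreover have "card {{v_a1, v_a2}, {v_b1, v_b2}} = 2" by (simp add: doubleton_eq_iff)
  ultimately show ?thesis unfolding ugraph.star_def[OF ug] nbE by (simp add: v)
qed

section \<open>The path on four and the cycle on five vertices\<close>

lemma no_loop_path: "{v} \<notin> edges (path_graph m)"
  by (auto simp: path_graph_def)

lemma path4_iso:
  assumes nl: "\<And>v. {v} \<notin> edges G" and p: "ugraph.path4 (adj G) (verts G)"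
  shows "G \<cong>\<^sub>G path_graph 4"
proof -
  have ug: "ugraph (adj G)" by (rule ugraph_adj[OF nl])
  obtain a b c d where d: "distinct [a, b, c, d]" and V: "verts G = {a, b, c, d}" and
    n: "nbhd (adj G) (verts G) a = {b}" "nbhd (adj G) (verts G) b = {a, c}"
      "nbhd (adj G) (verts G) c = {b, d}" "nbhd (adj G) (verts G) d = {c}"
    using p unfolding ugraph.path4_def[OF ug] by blast
  have e: "{u, v} \<in> edges G \<longleftrightarrow> v \<in> nbhd (adj G) (verts G) u" if "v \<in> {a, b, c, d}" for u v
    using that V by (auto simp: nbhd_def adj_def)
  have pe: "{i, j} \<in> edges (path_graph 4) \<longleftrightarrow> j = i + 1 \<and> j < 4 \<or> i = j + 1 \<and> i < 4" for i j
    by (auto simp: path_graph_def doubleton_eq_iff)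
  have "a \<noteq> b" "a \<noteq> c" "a \<noteq> d" "b \<noteq> c" "b \<noteq> d" "c \<noteq> d" using d by simp_all
  note dd = this this[symmetric]
  show ?thesis
  proof (rule iso_list[OF d])
    show "verts G = set [a, b, c, d]" by (simp add: V)
    show "verts (path_graph 4) = {..<length [a, b, c, d]}" by (simp add: path_graph_def)
    fix i j assume ij: "i < length [a, b, c, d]" "j < length [a, b, c, d]"
    then have "i \<in> {0, 1, 2, 3}" "j \<in> {0, 1, 2, 3}" by auto
    then show "{[a, b, c, d] ! i, [a, b, c, d] ! j} \<in> edges G \<longleftrightarrow> {i, j} \<in> edges (path_graph 4)"
      by (elim insertE emptyE) (simp_all add: e n pe dd nl no_loop_path)
  qed
qed

lemma cycle5_edges: "edges (cycle_graph 5) = {{0, 1}, {1, 2}, {2, 3}, {3, 4}, {4, 0}}"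
proof -
  have "edges (cycle_graph 5) = (\<lambda>i. {i, (i + 1) mod 5}) ` {..<5}"
    unfolding cycle_graph_def by auto
  moreover have "{..<5} = {0, 1, 2, 3, 4 :: nat}" by auto
  ultimately show ?thesis by (simp add: numeral_2_eq_2)
qed

lemma cycle5_adj: "{i, j} \<in> edges (cycle_graph 5) \<longleftrightarrow>
    (i, j) \<in> {(0, 1), (1, 0), (1, 2), (2, 1), (2, 3), (3, 2), (3, 4), (4, 3), (4, 0), (0, 4)}"
  by (auto simp: cycle5_edges doubleton_eq_iff)

lemma no_loop_cycle5: "{v} \<notin> edges (cycle_graph 5)"
  by (auto simp: cycle5_edges)

lemma cycle5_iso:
  assumes nl: "\<And>v. {v} \<notin> edges G" and p: "ugraph.cycle5 (adj G) (verts G)"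
  shows "G \<cong>\<^sub>G cycle_graph 5"
proof -
  have ug: "ugraph (adj G)" by (rule ugraph_adj[OF nl])
  obtain a b c d f where d: "distinct [a, b, c, d, f]" and V: "verts G = {a, b, c, d, f}" and
    n: "nbhd (adj G) (verts G) a = {f, b}" "nbhd (adj G) (verts G) b = {a, c}"
      "nbhd (adj G) (verts G) c = {b, d}" "nbhd (adj G) (verts G) d = {c, f}" "nbhd (adj G) (verts G) f = {d, a}"
    using p unfolding ugraph.cycle5_def[OF ug] by blast
  have e: "{u, v} \<in> edges G \<longleftrightarrow> v \<in> nbhd (adj G) (verts G) u" if "v \<in> {a, b, c, d, f}" for u v
    using that V by (auto simp: nbhd_def adj_def)
  have "a \<noteq> b" "a \<noteq> c" "a \<noteq> d" "a \<noteq> f" "b \<noteq> c" "b \<noteq> d" "b \<noteq> f" "c \<noteq> d" "c \<noteq> f" "d \<noteq> f" using d by simp_all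
  note dd = this this[symmetric]
  show ?thesis
  proof (rule iso_list[OF d])
    show "verts G = set [a, b, c, d, f]" by (simp add: V)
    show "verts (cycle_graph 5) = {..<length [a, b, c, d, f]}" by (simp add: cycle_graph_def)
    fix i j assume ij: "i < length [a, b, c, d, f]" "j < length [a, b, c, d, f]"
    then have "i \<in> {0, 1, 2, 3, 4}" "j \<in> {0, 1, 2, 3, 4}" by auto
    then show "{[a, b, c, d, f] ! i, [a, b, c, d, f] ! j} \<in> edges G \<longleftrightarrow> {i, j} \<in> edges (cycle_graph 5)"
      by (elim insertE emptyE) (simp_all add: e n cycle5_adj dd nl no_loop_cycle5)
  qed
qed

text \<open>The bound in (II) is 3 at \<open>(4, 1)\<close>, so exhibiting three sets gives
  equality. The next lemma serves \<open>C_5\<close> in the same way.\<close>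

lemma num_mis_path4: "3 \<le> num_mis (path_graph 4)"
proof -
  have V: "verts (path_graph 4) = {0, 1, 2, 3}" by (auto simp: path_graph_def)
  have pe: "adj (path_graph 4) i j \<longleftrightarrow> j = i + 1 \<and> j < 4 \<or> i = j + 1 \<and> i < 4" for i j
    by (auto simp: adj_def path_graph_def doubleton_eq_iff)
  have "{{0, 2}, {0, 3}, {1, 3}} \<subseteq> mis (adj (path_graph 4)) (verts (path_graph 4))"
    unfolding mis_def V by (auto simp: pe)
  then have "card {{0, 2}, {0, 3}, {1, 3 :: nat}} \<le> nmis (adj (path_graph 4)) (verts (path_graph 4))"
    by (rule card_mono[rotated]) (rule ugraph.finite_mis[OF ugraph_adj[OF no_loop_path]], simp add: V)
  moreover have "card {{0, 2}, {0, 3}, {1, 3 :: nat}} = 3" by (simp add: doubleton_eq_iff)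
  ultimately show ?thesis using num_mis_eq[OF no_loop_path] by simp
qed

lemma num_mis_cycle5: "5 \<le> num_mis (cycle_graph 5)"
proof -
  have V: "verts (cycle_graph 5) = {0, 1, 2, 3, 4}" by (auto simp: cycle_graph_def)
  have pe: "adj (cycle_graph 5) i j \<longleftrightarrow> (i, j) \<in> {(0, 1), (1, 0), (1, 2), (2, 1), (2, 3), (3, 2), (3, 4), (4, 3), (4, 0), (0, 4)}" for i j
    by (simp add: adj_def cycle5_adj)
  let ?F = "{{0, 2}, {1, 3}, {2, 4}, {0, 3}, {1, 4 :: nat}}"
  have "?F \<subseteq> mis (adj (cycle_graph 5)) (verts (cycle_graph 5))"
    unfolding mis_def V by (auto simp: pe)
  then have "card ?F \<le> nmis (adj (cycle_graph 5)) (verts (cycle_graph 5))"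
    by (rule card_mono[rotated]) (rule ugraph.finite_mis[OF ugraph_adj[OF no_loop_cycle5]], simp add: V)
  moreover have "card ?F = 5" by (simp add: doubleton_eq_iff)
  ultimately show ?thesis using num_mis_eq[OF no_loop_cycle5] by simp
qed

section \<open>The two bounds\<close>

lemma weight_of_parts: "n = 2 * a + 3 * b \<Longrightarrow> real (3 ^ b * 2 ^ a) = weight n b"
  using weight_small_cliques[of a b] by simp

text \<open>Removes truncated subtraction and division from the closed formulas.\<close>

lemma even_split:
  assumes "even (n + r)" "3 * r \<le> n + (1::nat)" obtains t where "n = 3 * r + 2 * t"
proof -
  obtain k where "n + r = 2 * k" using assms(1) by (elim evenE)
  then have "n = 3 * r + 2 * (k - 2 * r)" using assms(2) by linarith
  then show ?thesis by (rule that)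
qed

text \<open>The summand 3 stands for the triangle given up for the sake of parity:
  \<open>n = 3 * (r - 1) + 2 * t\<close> if \<open>1 \<le> r\<close>.\<close>

lemma odd_split:
  assumes "odd (n + r)" "3 * r \<le> n + (1::nat)" obtains t where "n + 3 = 3 * r + 2 * t"
proof -
  obtain k where "n + r = 2 * k + 1" using assms(1) by (elim oddE)
  then have "n + 3 = 3 * r + 2 * (k + 2 - 2 * r)" using assms(2) by linarith
  then show ?thesis by (rule that)
qed

lemma weight_less: "b < c \<Longrightarrow> weight n b < weight n c"
  unfolding weight_def
  by (intro mult_strict_left_mono power_strict_increasing) (use sqrt2_lb in auto)

lemma g_bound_real:
  assumes "1 \<le> r" "3 * r \<le> n + 1"
  shows "real (g_bound n r) = weight n (if even (n + r) then r else r - 1)"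
proof -
  have *: "n mod 2 = r mod 2 \<longleftrightarrow> even (n + r)" by presburger
  show ?thesis
  proof (cases "even (n + r)")
    case True
    then obtain t where "n = 3 * r + 2 * t" using even_split assms by blast
    then have "n = 2 * ((n - 3 * r) div 2) + 3 * r" by simp
    from weight_of_parts[OF this] show ?thesis using True by (simp add: g_bound_def *)
  next
    case False
    then obtain t where "n + 3 = 3 * r + 2 * t" using odd_split assms by blast
    then have "n = 2 * ((n + 3 - 3 * r) div 2) + 3 * (r - 1)" using assms(1) by simp
    from weight_of_parts[OF this] show ?thesis using False by (simp add: g_bound_def *)
  qed
qed

text \<open>For even \<open>n + r\<close> the first summand of \<open>c_bound\<close> is
  \<open>weight (n - 1) (r - 1)\<close>, that is \<open>2 / 3 * weight n r\<close>; for odd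
  \<open>n + r\<close> the value is \<open>weight (n - 1) r\<close>. Both are the counts for
  \<open>C(n, r)\<close> without its centre.\<close>

lemma c_bound_real:
  assumes "1 \<le> r" "3 * r \<le> n"
  shows "real (c_bound n r) = conn_bound n r"
proof -
  have *: "n mod 2 = r mod 2 \<longleftrightarrow> even (n + r)" by presburger
  show ?thesis
  proof (cases "even (n + r)")
    case True
    then obtain t where t: "n = 3 * r + 2 * t" using even_split[of n r] assms by auto
    then have "(n + 2 - 3 * r) div 2 = t + 1" by simp
    then have "n - 1 = 2 * ((n + 2 - 3 * r) div 2) + 3 * (r - 1)" using assms(1) t by simp
    from weight_of_parts[OF this] have "real (3 ^ (r - 1) * 2 ^ ((n + 2 - 3 * r) div 2)) = weight (n - 1) (r - 1)" .
    moreover have "weight (n - 1) (r - 1) = 2 / 3 * weight n r"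
      using weight_pred[OF assms(1), of "n - 1"] weight_shift1[of n r] assms by simp
    moreover have "(2::real) ^ (r - 1) = 2 ^ r / 2" using assms(1) by (simp add: power_diff)
    ultimately show ?thesis using True assms by (simp add: c_bound_def * conn_bound_def)
  next
    case False
    then obtain t where t: "n + 3 = 3 * r + 2 * t" using odd_split[of n r] assms by auto
    then have "(n - 3 * r - 1) div 2 = t - 2" "2 \<le> t" using assms by simp_all
    then have "n - 1 = 2 * ((n - 3 * r - 1) div 2) + 3 * r" using t by simp
    from weight_of_parts[OF this] have "real (3 ^ r * 2 ^ ((n - 3 * r - 1) div 2)) = weight (n - 1) r" .
    moreover have "weight n r / sqrt 2 = weight (n - 1) r" using weight_shift1[of n r] assms by simp
    ultimately show ?thesis using False assms by (simp add: c_bound_def * conn_bound_def)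
  qed
qed

text \<open>Among unions of small cliques the number of triangles decides, and parity limits it to
  \<open>?k\<close>. All other graphs stay strictly below, since 8/9 is less than 2 sqrt 2 / 3, the
  cost of one cycle.\<close>

lemma mis_bound:
  fixes G :: "'a sgraph"
  assumes r1: "1 \<le> r" and fs: "finite_simple_graph G" and n: "card (verts G) = n" and nc: "num_cycles G \<le> r"
    and rn: "3 * r \<le> n + 1"
  shows "num_mis G \<le> g_bound n r" "num_mis G = g_bound n r \<longleftrightarrow> G \<cong>\<^sub>G G_graph n r"
proof -
  note nl = simple_no_loop[OF fs]
  have ug: "ugraph (adj G)" by (rule ugraph_adj[OF nl])
  interpret ugraph "adj G" by (rule ug)
  have fin: "finite (verts G)" using fs by (simp add: finite_simple_graph_def)
  have cyc: "ncyc (adj G) (verts G) \<le> r" using ncyc_le_num_cycles[OF fs] nc by simp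
  have nm: "num_mis G = nmis (adj G) (verts G)" by (rule num_mis_eq[OF nl])
  have ugG: "ugraph (adj (G_graph n r))" by (rule ugraph_adj[OF no_loop_G_graph])
  obtain \<D> where D: "cliques (adj (G_graph n r)) \<D> (verts (G_graph n r))"
    "card {C \<in> \<D>. card C = 3} = (if even (n + r) then r else r - 1)"
    "card {C \<in> \<D>. card C = 2} = (if even (n + r) then (n - 3 * r) div 2 else (n + 3 - 3 * r) div 2)"
    by (rule G_graph_clq[OF rn r1])
  let ?k = "if even (n + r) then r else r - 1"
  have g: "real (g_bound n r) = weight n ?k" by (rule g_bound_real[OF r1 rn])
  have nG: "real (num_mis (G_graph n r)) = weight n ?k"
  proof -
    define a where "a = card {C \<in> \<D>. card C = 2}"
    define b where "b = card {C \<in> \<D>. card C = 3}"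
    have mis: "num_mis (G_graph n r) = 2 ^ a * 3 ^ b"
      using ugraph.cliques_counts(2)[OF ugG D(1)] num_mis_eq[OF no_loop_G_graph] by (simp add: a_def b_def)
    have nab: "n = 2 * a + 3 * b"
    proof (cases "even (n + r)")
      case True
      then obtain t where "n = 3 * r + 2 * t" using even_split rn by blast
      then show ?thesis unfolding a_def b_def D(2,3) by simp
    next
      case False
      then obtain t where "n + 3 = 3 * r + 2 * t" using odd_split rn by blast
      then show ?thesis unfolding a_def b_def D(2,3) using False r1 by simp
    qed
    have bk: "?k = b" using D(2) by (simp add: b_def)
    show ?thesis unfolding mis bk using weight_of_parts[OF nab] by (simp add: mult.commute)
  qed
  have conv: "G \<cong>\<^sub>G G_graph n r \<Longrightarrow> num_mis G = g_bound n r"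
    using num_mis_iso[of G "G_graph n r"] nl no_loop_G_graph nG g by simp
  have main: "real (num_mis G) < weight n ?k \<or> (real (num_mis G) = weight n ?k \<and> G \<cong>\<^sub>G G_graph n r)"
  proof (cases "small_cliques (adj G) (verts G)")
    case True
    then obtain \<C> where c: "cliques (adj G) \<C> (verts G)" by (auto simp: small_cliques_def)
    define a where "a = card {C \<in> \<C>. card C = 2}"
    define b where "b = card {C \<in> \<C>. card C = 3}"
    note k = cliques_counts[OF c, folded a_def b_def]
    have nab: "n = 2 * a + 3 * b" using k(3) n by simp
    have nmb: "real (num_mis G) = weight n b" using weight_of_parts[OF nab] k(2) nm by (simp add: mult.commute)
    have "b \<le> r" using k(4) cyc by simp
    \<comment> \<open>As \<open>n + b\<close> is even, \<open>b = r\<close> is possible only if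
      \<open>n + r\<close> is even.\<close>
    then have bk: "b \<le> ?k" using nab by (cases "b = r") auto
    show ?thesis
    proof (cases "b = ?k")
      case True
      have "G \<cong>\<^sub>G G_graph n r"
      proof (rule cliques_graph_iso[OF ug ugG c D(1)])
        show "card {C \<in> \<C>. card C = 3} = card {D \<in> \<D>. card D = 3}" using True D(2) by (simp add: b_def)
        have "a = (if even (n + r) then (n - 3 * r) div 2 else (n + 3 - 3 * r) div 2)"
          using nab True r1 rn by (cases "even (n + r)") auto
        then show "card {C \<in> \<C>. card C = 2} = card {D \<in> \<D>. card D = 2}" using D(3) by (simp add: a_def)
      qed
      then show ?thesis using nmb True by simp
    next
      case False
      then show ?thesis using weight_less[of b ?k n] bk nmb by simp
    qed
  next
    case False
    have w: "real (num_mis G) \<le> 8 / 9 * weight n r" using nmis_W_bad[OF fin cyc n False] nm by simp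
    have pos: "0 < weight n r" by (rule weight_pos)
    have "8 / 9 * weight n r < weight n ?k"
    proof (cases "even (n + r)")
      case False
      have "weight n (r - 1) = 2 / 3 * (sqrt 2 * weight n r)" using weight_pred[OF r1, of n] by simp
      moreover have "141421 / 100000 * weight n r \<le> sqrt 2 * weight n r" by (rule sqrt2_times) (use pos in simp)
      ultimately have "8 / 9 * weight n r < weight n (r - 1)" using pos by linarith
      then show ?thesis using False by simp
    qed (use pos in simp)
    then show ?thesis using w by linarith
  qed
  then have "real (num_mis G) \<le> real (g_bound n r)" using g by linarith
  then show "num_mis G \<le> g_bound n r" by simp
  show "num_mis G = g_bound n r \<longleftrightarrow> G \<cong>\<^sub>G G_graph n r"
    using main conv g by auto
qed

lemma star_num_mis:
  assumes nl: "\<And>v. {v} \<notin> edges H" and s: "ugraph.star (adj H) (verts H) y \<C> a f b"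
  shows "num_mis H = 2 ^ (a + f) * 3 ^ b + (if f = 0 then 0 else 2 ^ b)"
  using ugraph.star_nm(1)[OF ugraph_adj[OF nl] s] num_mis_eq[OF nl] by simp

lemma num_mis_C_graph:
  assumes "1 \<le> r" "3 * r \<le> n" shows "num_mis (C_graph n r) = c_bound n r"
proof -
  have *: "n mod 2 = r mod 2 \<longleftrightarrow> even (n + r)" by presburger
  obtain \<C> where s: "ugraph.star (adj (C_graph n r)) (verts (C_graph n r)) (Inl 0) \<C>
    (if even (n + r) then (n - 3 * r) div 2 else (n - 3 * r - 1) div 2) (if even (n + r) then 1 else 0)
    (if even (n + r) then r - 1 else r)" using C_graph_star by blast
  show ?thesis
  proof (cases "even (n + r)")
    case True
    then obtain t where "n = 3 * r + 2 * t" using even_split[of n r] assms by auto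
    then have "(n + 2 - 3 * r) div 2 = Suc ((n - 3 * r) div 2)" by simp
    then show ?thesis using star_num_mis[OF no_loop_C_graph s] True by (simp add: c_bound_def * mult.commute)
  next
    case False
    then show ?thesis using star_num_mis[OF no_loop_C_graph s] by (simp add: c_bound_def * mult.commute)
  qed
qed

text \<open>From isomorphism to equality only the counts of the listed graphs are evaluated. The
  converse combines \<open>conn_bounded\<close> with the equality case of
  \<open>spider_bound\<close>.\<close>

lemma mis_bound_connected:
  fixes G :: "'a sgraph"
  assumes r1: "1 \<le> r" and fs: "finite_simple_graph G" and n: "card (verts G) = n" and nc: "num_cycles G \<le> r"
    and rn: "3 * r \<le> n" and con: "connected_graph G"
  shows "num_mis G \<le> c_bound n r"
    "num_mis G = c_bound n r \<longleftrightarrow>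
           G \<cong>\<^sub>G C_graph n r
           \<or> (n = 4 \<and> r = 1 \<and> G \<cong>\<^sub>G path_graph 4)
           \<or> (n = 5 \<and> r = 1 \<and> G \<cong>\<^sub>G cycle_graph 5)
           \<or> (n = 7 \<and> r = 2 \<and> (G \<cong>\<^sub>G C_graph 7 1 \<or> G \<cong>\<^sub>G E_graph))" (is "_ \<longleftrightarrow> ?shape")
proof -
  note nl = simple_no_loop[OF fs]
  have ug: "ugraph (adj G)" by (rule ugraph_adj[OF nl])
  interpret ugraph "adj G" by (rule ug)
  let ?E = "adj G" and ?V = "verts G"
  have fin: "finite ?V" using fs by (simp add: finite_simple_graph_def)
  have cyc: "ncyc ?E ?V \<le> r" using ncyc_le_num_cycles[OF fs] nc by simp
  have nm: "num_mis G = nmis ?E ?V" by (rule num_mis_eq[OF nl])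
  have c: "conn ?E ?V" by (rule connected_conn[OF nl con])
  have n3: "3 \<le> n" using rn r1 by simp
  have V: "?V \<noteq> {}" "card ?V \<noteq> 2" using n3 n by auto
  have cb: "real (c_bound n r) = conn_bound n r" by (rule c_bound_real[OF r1 rn])
  have cl: "conn_bounded ?V r" by (rule conn_bounded[OF fin c V cyc])
  then have le: "real (num_mis G) \<le> conn_bound n r" using nm n by (simp add: conn_bounded_def)
  then show bound: "num_mis G \<le> c_bound n r" using cb by simp
  have conv: "num_mis G = c_bound n r" if "G \<cong>\<^sub>G C_graph n r"
    using num_mis_iso[OF that nl no_loop_C_graph] num_mis_C_graph[OF r1 rn] by simp
  have conv4: "num_mis G = c_bound n r" if "n = 4" "r = 1" "G \<cong>\<^sub>G path_graph 4"
    using num_mis_iso[OF that(3) nl no_loop_path] num_mis_path4 bound that by (simp add: c_bound_def)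
  have conv5: "num_mis G = c_bound n r" if "n = 5" "r = 1" "G \<cong>\<^sub>G cycle_graph 5"
    using num_mis_iso[OF that(3) nl no_loop_cycle5] num_mis_cycle5 bound that by (simp add: c_bound_def)
  have conv7: "num_mis G = c_bound n r" if "n = 7" "r = 2" "G \<cong>\<^sub>G C_graph 7 1"
    using num_mis_iso[OF that(3) nl no_loop_C_graph] num_mis_C_graph[of 1 7] that by (simp add: c_bound_def)
  have convE: "num_mis G = c_bound n r" if "n = 7" "r = 2" "G \<cong>\<^sub>G E_graph"
    using num_mis_iso[OF that(3) nl no_loop_E] star_num_mis[OF no_loop_E E_graph_star] that by (simp add: c_bound_def)
  have forth: ?shape if eq: "num_mis G = c_bound n r"
  proof -
    have eqr: "real (nmis ?E ?V) = conn_bound n r" using eq nm cb by simp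
    have sp: ?thesis if s: "spider ?V"
    proof -
      have ugC: "ugraph (adj (C_graph n r))" for n r by (rule ugraph_adj[OF no_loop_C_graph])
      obtain \<D> where D: "ugraph.star (adj (C_graph n r)) (verts (C_graph n r)) (Inl 0) \<D>
        (if even (n + r) then (n - 3 * r) div 2 else (n - 3 * r - 1) div 2) (if even (n + r) then 1 else 0)
        (if even (n + r) then r - 1 else r)" using C_graph_star by blast
      have "3 * r \<le> card ?V" "real (nmis ?E ?V) = conn_bound (card ?V) r" using rn n eqr by simp_all
      from spider_bound(2)[OF s c cyc this, unfolded extremal_def]
      consider (free) y \<C> a where "star ?V y \<C> a 0 r" | (full) y \<C> a where "star ?V y \<C> a 1 (r - 1)"
        | (C7) y \<C> where "card ?V = 7" "r = 2" "star ?V y \<C> 2 1 0" | (E7) y \<C> where "card ?V = 7" "r = 2" "star ?V y \<C> 1 2 0"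
        by blast
      then show ?thesis
      proof cases
        case free
        have "n = 1 + 2 * a + 3 * r" using star_nm(2)[OF free] n by simp
        then have "odd (n + r)" "(n - 3 * r - 1) div 2 = a" by simp_all
        then have "ugraph.star (adj (C_graph n r)) (verts (C_graph n r)) (Inl 0) \<D> a 0 r" using D by simp
        from star_graph_iso[OF ug ugC free this] show ?thesis by blast
      next
        case full
        have "n = 1 + 2 * (a + 1) + 3 * (r - 1)" using star_nm(2)[OF full] n by simp
        then have "even (n + r)" "(n - 3 * r) div 2 = a" using r1 by auto
        then have "ugraph.star (adj (C_graph n r)) (verts (C_graph n r)) (Inl 0) \<D> a 1 (r - 1)" using D by simp
        from star_graph_iso[OF ug ugC full this] show ?thesis by blast
      next
        case C7
        obtain \<D>' where "ugraph.star (adj (C_graph 7 1)) (verts (C_graph 7 1)) (Inl 0) \<D>' 2 1 0"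
          using C_graph_star[of 7 1] by auto
        from star_graph_iso[OF ug ugC C7(3) this] show ?thesis using C7 n by simp
      next
        case E7
        from star_graph_iso[OF ug ugraph_adj[OF no_loop_E] E7(3) E_graph_star] show ?thesis using E7 n by simp
      qed
    qed
    show ?thesis
    proof (cases "n = 3")
      \<comment> \<open>Here \<open>r = 1\<close> and the count is 3, which forces a triangle. It is
        passed on as a spider, since \<open>conn_bounded\<close> describes the equality case only
        from four vertices on.\<close>
      case True
      then have r: "r = 1" using rn r1 by simp
      have "small_cliques ?E ?V"
      proof (rule ccontr)
        assume "\<not> small_cliques ?E ?V"
        then have "real (nmis ?E ?V) \<le> 8 / 9 * weight 3 1" using nmis_W_bad[OF fin cyc n] True r by simp
        then show False using eqr True r by (simp add: conn_bound_def weight_consts)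
      qed
      then obtain \<C> where cq: "cliques ?E \<C> ?V" by (auto simp: small_cliques_def)
      note k = cliquesD[OF cq]
      obtain C where C: "C \<in> \<C>" using V k(2) by blast
      have "C = ?V"
      proof (rule ccontr)
        assume "C \<noteq> ?V"
        then obtain a b where ab: "a \<in> C" "b \<in> ?V - C" "?E a b"
          using connD[OF c, of C] C k(2,5) by blast
        then obtain D where "D \<in> \<C>" "b \<in> D" using k(2) by blast
        then show False using k(8)[OF C, of D a b] ab by blast
      qed
      obtain y where y: "y \<in> ?V" using V by blast
      have "small_cliques ?E (?V - {y})"
      proof (rule small_cliques_clique)
        show "card (?V - {y}) = 2 \<or> card (?V - {y}) = 3" using n True y by simp
        show "?E u v" if "u \<in> ?V - {y}" "v \<in> ?V - {y}" "u \<noteq> v" for u v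
          using k(6)[OF C, of u v] that \<open>C = ?V\<close> by simp
      qed
      then show ?thesis using sp y by (auto simp: spider_def)
    next
      case False
      then have "4 \<le> n" using n3 by simp
      then have "spider ?V \<or> path4 ?V \<or> cycle5 ?V" using cl eqr n by (auto simp: conn_bounded_def)
      then show ?thesis
      proof (elim disjE)
        assume p: "path4 ?V"
        then have "n = 4" using n by (auto simp: path4_def)
        then have "r = 1" using rn r1 by simp
        then show ?thesis using path4_iso[OF nl p] \<open>n = 4\<close> by blast
      next
        assume p: "cycle5 ?V"
        then have "n = 5" using n by (auto simp: cycle5_def)
        then have "r = 1" using rn r1 by simp
        then show ?thesis using cycle5_iso[OF nl p] \<open>n = 5\<close> by blast
      qed (rule sp)
    qed
  qed
  show "num_mis G = c_bound n r \<longleftrightarrow> ?shape"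
    using forth conv conv4 conv5 conv7 convE by blast
qed

theorem theorem3p1:
  fixes G :: "'a sgraph" and n r :: nat
  assumes "r \<ge> 1"
    and "finite_simple_graph G"
    and "card (verts G) = n"
    and "num_cycles G \<le> r"
  shows
    "(n \<ge> 3 * r - 1 \<longrightarrow>
        num_mis G \<le> g_bound n r \<and>
        (num_mis G = g_bound n r \<longleftrightarrow> G \<cong>\<^sub>G G_graph n r))
     \<and>
     (n \<ge> 3 * r \<and> connected_graph G \<longrightarrow>
        num_mis G \<le> c_bound n r \<and>
        (num_mis G = c_bound n r \<longleftrightarrow>
           G \<cong>\<^sub>G C_graph n r
           \<or> (n = 4 \<and> r = 1 \<and> G \<cong>\<^sub>G path_graph 4)
           \<or> (n = 5 \<and> r = 1 \<and> G \<cong>\<^sub>G cycle_graph 5)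
           \<or> (n = 7 \<and> r = 2 \<and> (G \<cong>\<^sub>G C_graph 7 1 \<or> G \<cong>\<^sub>G E_graph))))"
proof (intro conjI impI)
  assume "n \<ge> 3 * r - 1"
  then have "3 * r \<le> n + 1" by simp
  from mis_bound[OF assms this]
  show "num_mis G \<le> g_bound n r" "num_mis G = g_bound n r \<longleftrightarrow> G \<cong>\<^sub>G G_graph n r" .
next
  assume "n \<ge> 3 * r \<and> connected_graph G"
  then have h: "3 * r \<le> n" "connected_graph G" by simp_all
  from mis_bound_connected[OF assms h]
  show "num_mis G \<le> c_bound n r"
    "num_mis G = c_bound n r \<longleftrightarrow>
           G \<cong>\<^sub>G C_graph n r
           \<or> (n = 4 \<and> r = 1 \<and> G \<cong>\<^sub>G path_graph 4)
           \<or> (n = 5 \<and> r = 1 \<and> G \<cong>\<^sub>G cycle_graph 5)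
           \<or> (n = 7 \<and> r = 2 \<and> (G \<cong>\<^sub>G C_graph 7 1 \<or> G \<cong>\<^sub>G E_graph))" .
qed

end
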